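(* Let $\alpha=\omega^{\delta_n}s_n+\dots+\omega^{\delta_0}s_0+k$ be an infinite ordinal in Cantor normal form, where $n,k\in\omega$, $s_0,\dots,s_n$ are positive integers and $0<\delta_0<\dots<\delta_n$ are ordinals. Then (a) $\mathrm{sq}\,\mathbb P(\alpha)\cong\prod_{i=0}^n\big(\mathrm{sq}\,\mathbb P(\omega^{\delta_i})\big)^{s_i}$; (b) $\min\{\gamma+\beta:\alpha=\beta+\gamma\}=\omega^{\delta_n}s_n$; (c) if $\mathbb X$ is a chainable relational structure and $\mathbb L\in\mathcal L_{\mathbb X}$ with $\mathbb L\cong\alpha$, then: $\mathbb B_{\mathbb X}\cong\mathrm{ro}(\mathbb{CP}_{|\alpha|})$ if $\mathcal L_{\mathbb X}$ is the set of all linear orders on the domain $X$ (case (i)); $\mathbb B_{\mathbb X}\cong\mathrm{ro}\big(\mathrm{sq}(\mathbb P(\omega^{\delta_n}))^{s_n}\big)$ if $\mathcal L_{\mathbb X}=\bigcup_{\mathbb L=\mathbb I+\mathbb F}\{\mathbb F+\mathbb I,\ \mathbb I^*+\mathbb F^*\}$ (case (ii)); and $\mathbb B_{\mathbb X}\cong\mathrm{ro}\big(\prod_{i=0}^n(\mathrm{sq}\,\mathbb P(\omega^{\delta_i}))^{s_i}\big)$ if there is $n'\in\omega$ such that $\mathcal L_{\mathbb X}$ is the set of all orders $\mathbb K_{\lhd_K}+\mathbb M+\mathbb H_{\lhd_H}$ and $\mathbb H_{\lhd_H}+\mathbb M^*+\mathbb K_{\lhd_K}$, where $\mathbb L=\mathbb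 K+\mathbb M+\mathbb H$ with $|K\cup H|\le n'$ and $\lhd_K,\lhd_H$ are arbitrary linear orders on $K,H$ (case (iii)).
   Context: For an ordinal $\alpha$, $\mathbb P(\alpha)$ is the poset of copies of the well order $\langle\alpha,<\rangle$: $\{f[\alpha]: f$ a self-embedding of $\langle\alpha,<\rangle\}$ ordered by $\subset$; $\mathrm{sq}$ denotes separative quotient; powers and products of posets are direct products with coordinatewise order. For a relational structure $\mathbb X$ with domain $X$, $\mathbb P(\mathbb X)$ is the set of images of self-embeddings ordered by $\subset$ and $\mathbb B_{\mathbb X}=\mathrm{ro}(\mathrm{sq}(\mathbb P(\mathbb X)))$ its Boolean completion. $\mathbb X$ is chainable iff there is a linear order $\lhd$ on $X$ whose partial automorphisms are all partial automorphisms of $\mathbb X$; $\mathcal L_{\mathbb X}$ is the set of all such $\langle X,\lhd\rangle$. $\mathbb L=\mathbb I+\mathbb F$ ranges over decompositions of $\mathbb L$ into an initial part and a final part; $\mathbb K+\mathbb M+\mathbb H$ ranges over decompositions into initial, middle and final intervals; $^*$ is reverse order. $\mathbb{CP}_\kappa=(P(\kappa)/[\kappa]^{<\kappa})^+$. (It is known that for a chainable $\mathbb X$ and $\mathbb L\in\mathcal L_{\mathbb X}$ one of cases (i)–(iii) holds.) *)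

theory Defs
  imports Main "HOL-Library.FuncSet"
begin

unbundle cardinal_syntax

text \<open>
  All orders are reflexive relations whose carrier is their \<^const>\<open>Field\<close>. Ordinals are
  well-orders, compared by \<open>=o\<close>, \<open>\<le>o\<close> and \<open><o\<close>; the finite ordinal \<open>k\<close> is
  \<open>natLeq_on k\<close>.
\<close>

subsection \<open>Ordinal arithmetic\<close>

definition osum :: "'a rel \<Rightarrow> 'b rel \<Rightarrow> ('a + 'b) rel" where
  "osum r s = {(Inl x, Inl y) | x y. (x, y) \<in> r} \<union> {(Inr x, Inr y) | x y. (x, y) \<in> s}
     \<union> {(Inl x, Inr y) | x y. x \<in> Field r \<and> y \<in> Field s}"

text \<open>The sum of the orders \<open>r i\<close>, concatenated along the order \<open>d\<close> of the indices \<open>i\<close>.\<close>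

definition osum_family :: "'i rel \<Rightarrow> ('i \<Rightarrow> 'a rel) \<Rightarrow> ('i \<times> 'a) rel" where
  "osum_family d r = {((i, x), (j, y)) | i x j y.
     (i, j) \<in> d \<and> x \<in> Field (r i) \<and> y \<in> Field (r j) \<and> (i = j \<longrightarrow> (x, y) \<in> r i)}"

definition oprod :: "'a rel \<Rightarrow> 'b rel \<Rightarrow> ('b \<times> 'a) rel" where
  "oprod r s = osum_family s (\<lambda>_. r)"

text \<open>
  The ordinal power \<open>\<omega>\<^sup>\<delta>\<close> in its standard set-theoretic form: functions from \<open>\<delta>\<close> to \<open>\<omega>\<close> of
  finite support, compared at the largest argument where they differ.
\<close>

definition fin_supp :: "'d set \<Rightarrow> ('d \<Rightarrow> nat) set" where
  "fin_supp D = {f. {x. f x \<noteq> 0} \<subseteq> D \<and> finite {x. f x \<noteq> 0}}"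

definition omega_exp :: "'d rel \<Rightarrow> ('d \<Rightarrow> nat) rel" where
  "omega_exp \<delta> = {(f, g). f \<in> fin_supp (Field \<delta>) \<and> g \<in> fin_supp (Field \<delta>) \<and>
     (f = g \<or> (\<exists>x\<in>Field \<delta>. f x < g x \<and> (\<forall>y. (x, y) \<in> \<delta> \<and> y \<noteq> x \<longrightarrow> f y = g y)))}"

text \<open>
  \<open>\<omega>\<^bsup>\<delta> n\<^esup> \<cdot> s n + \<dots> + \<omega>\<^bsup>\<delta> 0\<^esup> \<cdot> s 0 + k\<close>; the indices are traversed downwards from \<open>n\<close> to \<open>0\<close>.
\<close>

definition cantor_sum ::
  "nat \<Rightarrow> (nat \<Rightarrow> 'd rel) \<Rightarrow> (nat \<Rightarrow> nat) \<Rightarrow> nat \<Rightarrow> (nat \<times> nat \<times> ('d \<Rightarrow> nat) + nat) rel" where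
  "cantor_sum n \<delta> s k =
     osum (osum_family ((natLeq_on (Suc n))\<inverse>) (\<lambda>i. oprod (omega_exp (\<delta> i)) (natLeq_on (s i))))
          (natLeq_on k)"

text \<open>The ordinal represented by \<open>r\<close> is the minimum of the ordinals represented by members of \<open>R\<close>.\<close>

definition is_min_ordinal :: "'a rel set \<Rightarrow> 'b rel \<Rightarrow> bool" where
  "is_min_ordinal R r \<longleftrightarrow> (\<exists>r'\<in>R. r' =o r) \<and> (\<forall>r'\<in>R. r \<le>o r')"

subsection \<open>Posets\<close>

definition poset_iso :: "'a rel \<Rightarrow> 'b rel \<Rightarrow> bool" (infix \<open>\<cong>\<^sub>p\<close> 50) where
  "P \<cong>\<^sub>p Q \<longleftrightarrow> (\<exists>f. bij_betw f (Field P) (Field Q) \<and>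
     (\<forall>x\<in>Field P. \<forall>y\<in>Field P. (x, y) \<in> P \<longleftrightarrow> (f x, f y) \<in> Q))"

definition poset_prod :: "'i set \<Rightarrow> ('i \<Rightarrow> 'a rel) \<Rightarrow> ('i \<Rightarrow> 'a) rel" where
  "poset_prod I P = {(f, g). f \<in> (\<Pi>\<^sub>E i\<in>I. Field (P i)) \<and> g \<in> (\<Pi>\<^sub>E i\<in>I. Field (P i)) \<and>
     (\<forall>i\<in>I. (f i, g i) \<in> P i)}"

definition poset_power :: "'a rel \<Rightarrow> nat \<Rightarrow> (nat \<Rightarrow> 'a) rel" where
  "poset_power P m = poset_prod {..<m} (\<lambda>_. P)"

text \<open>The separative modification of a poset, and its antisymmetric quotient.\<close>

definition sm :: "'a rel \<Rightarrow> 'a rel" where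
  "sm P = {(p, q). p \<in> Field P \<and> q \<in> Field P \<and>
     (\<forall>r. (r, p) \<in> P \<longrightarrow> (\<exists>t. (t, r) \<in> P \<and> (t, q) \<in> P))}"

definition sq :: "'a rel \<Rightarrow> 'a set rel" where
  "sq P = (let E = sm P \<inter> (sm P)\<inverse> in {(E `` {p}, E `` {q}) | p q. (p, q) \<in> sm P})"

text \<open>
  Regular open sets of the topology whose open sets are the downward closed subsets of \<open>P\<close>, ordered
  by inclusion. Isomorphisms of Boolean algebras are the same as isomorphisms of their orders.
\<close>

definition poset_cl :: "'a rel \<Rightarrow> 'a set \<Rightarrow> 'a set" where
  "poset_cl P U = {p \<in> Field P. \<exists>q\<in>U. (q, p) \<in> P}"

definition poset_int :: "'a rel \<Rightarrow> 'a set \<Rightarrow> 'a set" where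
  "poset_int P A = {p \<in> Field P. \<forall>q. (q, p) \<in> P \<longrightarrow> q \<in> A}"

definition ro :: "'a rel \<Rightarrow> 'a set rel" where
  "ro P = {(U, V). U \<subseteq> V \<and> poset_int P (poset_cl P U) = U \<and> poset_int P (poset_cl P V) = V}"

text \<open>
  \<open>(P(\<kappa>)/[\<kappa>]\<^bsup><\<kappa>\<^esup>)\<^sup>+\<close>, where in the quotient algebra \<open>[A] \<le> [B]\<close> means that \<open>A - B\<close> lies in
  the ideal, and \<open>[A]\<close> is nonzero when \<open>A\<close> does not.
\<close>

definition CP :: "'a rel \<Rightarrow> 'a set set rel" where
  "CP \<kappa> = (let E = {(A, B). A \<subseteq> Field \<kappa> \<and> B \<subseteq> Field \<kappa> \<and> |(A - B) \<union> (B - A)| <o \<kappa>}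
     in {(E `` {A}, E `` {B}) | A B. A \<subseteq> Field \<kappa> \<and> B \<subseteq> Field \<kappa> \<and>
           \<not> |A| <o \<kappa> \<and> \<not> |B| <o \<kappa> \<and> |A - B| <o \<kappa>})"

subsection \<open>Relational structures\<close>

record ('a, 'i) rel_struct =
  universe :: "'a set"
  symbols :: "'i set"
  arity :: "'i \<Rightarrow> nat"
  interp :: "'i \<Rightarrow> 'a list set"

definition tuples :: "'a set \<Rightarrow> nat \<Rightarrow> 'a list set" where
  "tuples A m = {xs. set xs \<subseteq> A \<and> length xs = m}"

definition relational_structure :: "('a, 'i) rel_struct \<Rightarrow> bool" where
  "relational_structure \<X> \<longleftrightarrow>
     (\<forall>i\<in>symbols \<X>. interp \<X> i \<subseteq> tuples (universe \<X>) (arity \<X> i))"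

text \<open>The linear order \<open>r\<close>, in its strict form, as a structure with one binary relation.\<close>

definition order_struct :: "'a rel \<Rightarrow> ('a, unit) rel_struct" where
  "order_struct r = \<lparr>universe = Field r, symbols = {()}, arity = (\<lambda>_. 2),
     interp = (\<lambda>_. {[x, y] | x y. (x, y) \<in> r \<and> x \<noteq> y})\<rparr>"

definition self_embeddings :: "('a, 'i) rel_struct \<Rightarrow> ('a \<Rightarrow> 'a) set" where
  "self_embeddings \<X> = {f. f ` universe \<X> \<subseteq> universe \<X> \<and> inj_on f (universe \<X>) \<and>
     (\<forall>i\<in>symbols \<X>. \<forall>xs\<in>tuples (universe \<X>) (arity \<X> i).
        xs \<in> interp \<X> i \<longleftrightarrow> map f xs \<in> interp \<X> i)}"

text \<open>The poset \<open>\<P>(\<X>)\<close> of copies, and its Boolean completion \<open>\<B>\<^sub>\<X>\<close>.\<close>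

definition copies :: "('a, 'i) rel_struct \<Rightarrow> 'a set rel" where
  "copies \<X> = {(f ` universe \<X>, g ` universe \<X>) | f g.
     f \<in> self_embeddings \<X> \<and> g \<in> self_embeddings \<X> \<and> f ` universe \<X> \<subseteq> g ` universe \<X>}"

definition BX :: "('a, 'i) rel_struct \<Rightarrow> 'a set set set rel" where
  "BX \<X> = ro (sq (copies \<X>))"

text \<open>Partial automorphisms are the isomorphisms between (arbitrary) substructures.\<close>

definition partial_auts :: "('a, 'i) rel_struct \<Rightarrow> ('a \<rightharpoonup> 'a) set" where
  "partial_auts \<X> = {\<phi>. dom \<phi> \<subseteq> universe \<X> \<and> ran \<phi> \<subseteq> universe \<X> \<and> inj_on \<phi> (dom \<phi>) \<and>
     (\<forall>i\<in>symbols \<X>. \<forall>xs\<in>tuples (dom \<phi>) (arity \<X> i).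
        xs \<in> interp \<X> i \<longleftrightarrow> map (\<lambda>x. the (\<phi> x)) xs \<in> interp \<X> i)}"

text \<open>The set \<open>\<L>\<^sub>\<X>\<close> of linear orders chaining \<open>\<X>\<close>.\<close>

definition LX :: "('a, 'i) rel_struct \<Rightarrow> 'a rel set" where
  "LX \<X> = {r. linear_order_on (universe \<X>) r \<and> partial_auts (order_struct r) \<subseteq> partial_auts \<X>}"

definition chainable :: "('a, 'i) rel_struct \<Rightarrow> bool" where
  "chainable \<X> \<longleftrightarrow> (\<exists>r. linear_order_on (universe \<X>) r \<and>
     partial_auts (order_struct r) \<subseteq> partial_auts \<X>)"

subsection \<open>Rearrangements of a linear order\<close>

text \<open>The sum of linear orders on disjoint subsets of one type.\<close>

definition lsum :: "'a rel \<Rightarrow> 'a rel \<Rightarrow> 'a rel" (infixr \<open>\<oplus>\<^sub>l\<close> 65) where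
  "r \<oplus>\<^sub>l s = r \<union> s \<union> Field r \<times> Field s"

text \<open>Decompositions \<open>L = I + F\<close> and \<open>L = K + M + H\<close>; the parts may be empty.\<close>

definition decomp2 :: "'a rel \<Rightarrow> 'a set \<Rightarrow> 'a set \<Rightarrow> bool" where
  "decomp2 L I F \<longleftrightarrow> Field L = I \<union> F \<and> I \<inter> F = {} \<and> I \<times> F \<subseteq> L"

definition decomp3 :: "'a rel \<Rightarrow> 'a set \<Rightarrow> 'a set \<Rightarrow> 'a set \<Rightarrow> bool" where
  "decomp3 L K M H \<longleftrightarrow> Field L = K \<union> M \<union> H \<and> K \<inter> M = {} \<and> K \<inter> H = {} \<and> M \<inter> H = {} \<and>
     K \<times> M \<subseteq> L \<and> K \<times> H \<subseteq> L \<and> M \<times> H \<subseteq> L"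

definition cyclic_rearrangements :: "'a rel \<Rightarrow> 'a rel set" where
  "cyclic_rearrangements L = (\<Union>(I, F)\<in>{(I, F). decomp2 L I F}.
     {Restr L F \<oplus>\<^sub>l Restr L I, (Restr L I)\<inverse> \<oplus>\<^sub>l (Restr L F)\<inverse>})"

definition end_rearrangements :: "nat \<Rightarrow> 'a rel \<Rightarrow> 'a rel set" where
  "end_rearrangements m L = (\<Union>(K, M, H)\<in>{(K, M, H). decomp3 L K M H \<and>
       finite (K \<union> H) \<and> card (K \<union> H) \<le> m}.
     \<Union>(rK, rH)\<in>{(rK, rH). linear_order_on K rK \<and> linear_order_on H rH}.
     {rK \<oplus>\<^sub>l Restr L M \<oplus>\<^sub>l rH, rH \<oplus>\<^sub>l (Restr L M)\<inverse> \<oplus>\<^sub>l rK})"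

end

theory Submission
  imports Defs
begin

text \<open>
  Cut \<open>\<alpha>\<close> into blocks of types \<open>\<omega>\<^bsup>\<delta> i\<^esup>\<close>, in weakly decreasing order, with the elements of the
  finite remainder as additional blocks. Every block embeds into each of its tails, and no block
  embeds boundedly into itself or into a later one. Hence a strictly increasing \<open>f\<close> maps each block
  into itself: if \<open>f\<close> moved a point \<open>x\<close> to a later block, it would iterate copies of the block of
  \<open>x\<close> between the points \<open>x\<close>, \<open>f x\<close>, \<open>f (f x)\<close>, and so on, and two consecutive points among these lie in
  one block. So copies of \<open>\<alpha>\<close> are exactly the unions of copies of the blocks, which gives (a), since
  separative quotients commute with products. For (b), the remainder after \<open>\<omega>\<^bsup>\<delta> n\<^esup> \<cdot> s n\<close> is absorbed
  when put in front of it, and every cut of \<open>\<alpha>\<close> leaves \<open>s n\<close> leading blocks after rotation.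

  For (c), an order \<open>L\<close> chaining \<open>\<X>\<close> pulled back along a self-embedding of \<open>\<X>\<close> chains \<open>\<X>\<close> again, so
  it is one of the listed rearrangements, and it is a well-order. In case (i) all injections are
  self-embeddings, in case (iii) the copies of \<open>\<X>\<close> are those of \<open>L\<close>, and in case (ii) the copies of
  \<open>\<omega>\<^bsup>\<delta> n\<^esup> \<cdot> s n\<close> in \<open>L\<close> form a dense set of copies of \<open>\<X>\<close>.
\<close>

subsection \<open>Isomorphisms, products and separative quotients of preorders\<close>

text \<open>An element of \<open>omega_exp \<delta>\<close> is a polynomial in \<omega> with
  finitely many terms. Adding a fixed \<open>u\<close> pointwise (the natural sum) is strictly
  increasing and never lands below \<open>u\<close>. This one operation supplies the embeddings into
  tails, the absorption of the remainder and the rotations. Bounded embeddings are impossible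
  because a strictly increasing self-map of a well-order never moves a point down.

  The obstacle in (c) is that a pulled-back order differs from \<open>L\<close>, so the maps that
  arise are increasing from one chaining order to another, while chaining controls only partial
  automorphisms of a single order. All relations being finitary, only finite partial maps need to be
  examined, and these have room to be factored through auxiliary sets. Reversed rearrangements drop
  out because no infinite set is well-ordered in both directions.

  Completions are compared along maps that may be neither injective nor order reflecting, as long as
  they are dense and preserve incompatibility. One lemma thus serves separative quotients, sets
  modulo smaller sets, and dense families of copies.\<close>

lemma poset_isoI:
  assumes "bij_betw f (Field P) (Field Q)"
    and "\<And>x y. x \<in> Field P \<Longrightarrow> y \<in> Field P \<Longrightarrow> (x, y) \<in> P \<longleftrightarrow> (f x, f y) \<in> Q"
  shows "P \<cong>\<^sub>p Q"
  using assms unfolding poset_iso_def by blast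

lemma poset_iso_iff_iso: "P \<cong>\<^sub>p Q \<longleftrightarrow> (\<exists>f. iso P Q f)"
  unfolding poset_iso_def iso_iff2 by blast

lemma poset_iso_sym:
  assumes "P \<cong>\<^sub>p Q" shows "Q \<cong>\<^sub>p P"
proof -
  obtain f where f: "bij_betw f (Field P) (Field Q)"
    and m: "\<And>x y. x \<in> Field P \<Longrightarrow> y \<in> Field P \<Longrightarrow> (x, y) \<in> P \<longleftrightarrow> (f x, f y) \<in> Q"
    using assms unfolding poset_iso_def by blast
  let ?g = "inv_into (Field P) f"
  have g: "bij_betw ?g (Field Q) (Field P)" using f by (rule bij_betw_inv_into)
  show ?thesis
  proof (rule poset_isoI[OF g])
    fix x y assume xy: "x \<in> Field Q" "y \<in> Field Q"
    then have "?g x \<in> Field P" "?g y \<in> Field P" using g by (auto intro: bij_betw_apply)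
    then show "(x, y) \<in> Q \<longleftrightarrow> (?g x, ?g y) \<in> P"
      using m bij_betw_inv_into_right[OF f] xy by simp
  qed
qed

lemma poset_iso_trans [trans]:
  assumes "P \<cong>\<^sub>p Q" "Q \<cong>\<^sub>p R" shows "P \<cong>\<^sub>p R"
proof -
  obtain f where f: "bij_betw f (Field P) (Field Q)"
    and fm: "\<And>x y. x \<in> Field P \<Longrightarrow> y \<in> Field P \<Longrightarrow> (x, y) \<in> P \<longleftrightarrow> (f x, f y) \<in> Q"
    using assms(1) unfolding poset_iso_def by blast
  obtain g where g: "bij_betw g (Field Q) (Field R)"
    and gm: "\<And>x y. x \<in> Field Q \<Longrightarrow> y \<in> Field Q \<Longrightarrow> (x, y) \<in> Q \<longleftrightarrow> (g x, g y) \<in> R"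
    using assms(2) unfolding poset_iso_def by blast
  show ?thesis
    by (rule poset_isoI[OF bij_betw_trans[OF f g]])
      (use fm gm f in \<open>auto dest: bij_betwE\<close>)
qed

lemma in_FieldD: "x \<in> Field r \<Longrightarrow> \<exists>y. (x, y) \<in> r \<or> (y, x) \<in> r"
  by (auto simp: Field_def)

lemma PreorderI:
  assumes "\<And>x. x \<in> Field P \<Longrightarrow> (x, x) \<in> P"
    and "\<And>x y z. (x, y) \<in> P \<Longrightarrow> (y, z) \<in> P \<Longrightarrow> (x, z) \<in> P"
  shows "Preorder P"
  unfolding preorder_on_def refl_on_def using assms
  by (auto simp: FieldI1 FieldI2 intro: transI)

lemma Preorder_refl: "Preorder P \<Longrightarrow> x \<in> Field P \<Longrightarrow> (x, x) \<in> P"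
  unfolding preorder_on_def refl_on_def by blast

lemma Preorder_trans: "Preorder P \<Longrightarrow> (x, y) \<in> P \<Longrightarrow> (y, z) \<in> P \<Longrightarrow> (x, z) \<in> P"
  unfolding preorder_on_def by (meson transD)

section \<open>Products of preorders\<close>

lemma Field_poset_prod:
  assumes "\<And>i. i \<in> I \<Longrightarrow> Preorder (P i)"
  shows "Field (poset_prod I P) = (\<Pi>\<^sub>E i\<in>I. Field (P i))"
proof
  show "Field (poset_prod I P) \<subseteq> (\<Pi>\<^sub>E i\<in>I. Field (P i))"
    unfolding poset_prod_def Field_def by blast
  show "(\<Pi>\<^sub>E i\<in>I. Field (P i)) \<subseteq> Field (poset_prod I P)"
  proof
    fix f assume f: "f \<in> (\<Pi>\<^sub>E i\<in>I. Field (P i))"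
    have "(f, f) \<in> poset_prod I P"
      using f assms Preorder_refl unfolding poset_prod_def by fastforce
    then show "f \<in> Field (poset_prod I P)" by (rule FieldI1)
  qed
qed

lemma poset_prod_iff:
  assumes "\<And>i. i \<in> I \<Longrightarrow> Preorder (P i)"
  shows "(f, g) \<in> poset_prod I P \<longleftrightarrow> f \<in> Field (poset_prod I P) \<and> g \<in> Field (poset_prod I P) \<and>
    (\<forall>i\<in>I. (f i, g i) \<in> P i)"
  by (subst (1) poset_prod_def) (simp add: Field_poset_prod assms)

lemma Preorder_poset_prod:
  assumes "\<And>i. i \<in> I \<Longrightarrow> Preorder (P i)"
  shows "Preorder (poset_prod I P)"
proof (rule PreorderI)
  fix x assume "x \<in> Field (poset_prod I P)"
  then show "(x, x) \<in> poset_prod I P"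
    using assms Preorder_refl by (fastforce simp: poset_prod_iff[OF assms] Field_poset_prod[OF assms])
next
  fix x y z assume "(x, y) \<in> poset_prod I P" "(y, z) \<in> poset_prod I P"
  then show "(x, z) \<in> poset_prod I P"
    using assms Preorder_trans unfolding poset_prod_def by fastforce
qed

lemma Preorder_poset_power: "Preorder P \<Longrightarrow> Preorder (poset_power P m)"
  unfolding poset_power_def by (rule Preorder_poset_prod)

lemma Field_poset_power:
  assumes "Preorder P" shows "Field (poset_power P m) = (\<Pi>\<^sub>E t\<in>{..<m}. Field P)"
  unfolding poset_power_def using assms by (rule Field_poset_prod)

lemma poset_prod_cong:
  assumes iso: "\<And>i. i \<in> I \<Longrightarrow> P i \<cong>\<^sub>p Q i"
    and P: "\<And>i. i \<in> I \<Longrightarrow> Preorder (P i)" and Q: "\<And>i. i \<in> I \<Longrightarrow> Preorder (Q i)"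
  shows "poset_prod I P \<cong>\<^sub>p poset_prod I Q"
proof -
  have "\<forall>i\<in>I. \<exists>f. bij_betw f (Field (P i)) (Field (Q i)) \<and>
     (\<forall>x\<in>Field (P i). \<forall>y\<in>Field (P i). (x, y) \<in> P i \<longleftrightarrow> (f x, f y) \<in> Q i)"
    using iso unfolding poset_iso_def by blast
  from bchoice[OF this] obtain f where
    f: "\<And>i. i \<in> I \<Longrightarrow> bij_betw (f i) (Field (P i)) (Field (Q i))"
    and m: "\<And>i x y. i \<in> I \<Longrightarrow> x \<in> Field (P i) \<Longrightarrow> y \<in> Field (P i) \<Longrightarrow>
      (x, y) \<in> P i \<longleftrightarrow> (f i x, f i y) \<in> Q i"
    by blast
  let ?F = "\<lambda>x. \<lambda>i\<in>I. f i (x i)"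
  let ?G = "\<lambda>y. \<lambda>i\<in>I. inv_into (Field (P i)) (f i) (y i)"
  have im: "f i x \<in> Field (Q i)" if "i \<in> I" "x \<in> Field (P i)" for i x
    using f[OF that(1)] that(2) by (rule bij_betw_apply)
  have im': "inv_into (Field (P i)) (f i) y \<in> Field (P i)" if "i \<in> I" "y \<in> Field (Q i)" for i y
    using bij_betw_inv_into[OF f[OF that(1)]] that(2) by (rule bij_betw_apply)
  have "bij_betw ?F (\<Pi>\<^sub>E i\<in>I. Field (P i)) (\<Pi>\<^sub>E i\<in>I. Field (Q i))"
  proof (rule bij_betw_byWitness[where f' = ?G])
    show "\<forall>a\<in>\<Pi>\<^sub>E i\<in>I. Field (P i). ?G (?F a) = a"
      using bij_betw_inv_into_left[OF f] by (auto simp: PiE_iff extensional_def fun_eq_iff)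
    show "\<forall>a\<in>\<Pi>\<^sub>E i\<in>I. Field (Q i). ?F (?G a) = a"
      using bij_betw_inv_into_right[OF f] by (auto simp: PiE_iff extensional_def fun_eq_iff)
  qed (use im im' in \<open>auto simp: PiE_iff image_subset_iff\<close>)
  then have bij: "bij_betw ?F (Field (poset_prod I P)) (Field (poset_prod I Q))"
    by (simp add: Field_poset_prod P Q)
  show ?thesis
  proof (rule poset_isoI[OF bij])
    fix x y assume xy: "x \<in> Field (poset_prod I P)" "y \<in> Field (poset_prod I P)"
    then have "(?F x, ?F y) \<in> poset_prod I Q \<longleftrightarrow> (\<forall>i\<in>I. (f i (x i), f i (y i)) \<in> Q i)"
      using bij_betw_apply[OF bij] by (simp add: poset_prod_iff Q)
    also have "\<dots> \<longleftrightarrow> (\<forall>i\<in>I. (x i, y i) \<in> P i)"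
      using m xy by (simp add: Field_poset_prod P PiE_iff)
    finally show "(x, y) \<in> poset_prod I P \<longleftrightarrow> (?F x, ?F y) \<in> poset_prod I Q"
      using xy by (simp add: poset_prod_iff P)
  qed
qed

lemma poset_prod_singleton:
  assumes "Preorder (P i)"
  shows "poset_prod {i} P \<cong>\<^sub>p P i"
proof (rule poset_isoI[of "\<lambda>f. f i"])
  have P: "Preorder (P j)" if "j \<in> {i}" for j using assms that by simp
  have FP: "Field (poset_prod {i} P) = (\<Pi>\<^sub>E j\<in>{i}. Field (P j))"
    using P by (rule Field_poset_prod)
  show "bij_betw (\<lambda>f. f i) (Field (poset_prod {i} P)) (Field (P i))"
    by (rule bij_betw_byWitness[where f' = "\<lambda>x. \<lambda>j\<in>{i}. x"])
      (auto simp: FP PiE_iff extensional_def fun_eq_iff split: if_splits)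
  show "\<And>x y. x \<in> Field (poset_prod {i} P) \<Longrightarrow> y \<in> Field (poset_prod {i} P) \<Longrightarrow>
    (x, y) \<in> poset_prod {i} P \<longleftrightarrow> (x i, y i) \<in> P i"
    unfolding FP by (simp add: poset_prod_def)
qed

section \<open>Separative modification and separative quotient\<close>

lemma smI:
  assumes "p \<in> Field P" "q \<in> Field P"
    and "\<And>r. (r, p) \<in> P \<Longrightarrow> \<exists>t. (t, r) \<in> P \<and> (t, q) \<in> P"
  shows "(p, q) \<in> sm P"
  using assms unfolding sm_def by blast

lemma smD:
  assumes "(p, q) \<in> sm P"
  shows "p \<in> Field P" "q \<in> Field P" "(r, p) \<in> P \<Longrightarrow> \<exists>t. (t, r) \<in> P \<and> (t, q) \<in> P"
  using assms unfolding sm_def by auto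

lemma subset_sm:
  assumes "Preorder P" "(p, q) \<in> P" shows "(p, q) \<in> sm P"
proof (rule smI)
  fix r assume r: "(r, p) \<in> P"
  have "(r, r) \<in> P" using r assms(1) by (simp add: FieldI1 Preorder_refl)
  moreover have "(r, q) \<in> P" using assms r by (meson Preorder_trans)
  ultimately show "\<exists>t. (t, r) \<in> P \<and> (t, q) \<in> P" by blast
qed (use assms(2) in \<open>auto intro: FieldI1 FieldI2\<close>)

lemma sm_trans:
  assumes "Preorder P" "(p, q) \<in> sm P" "(q, r) \<in> sm P" shows "(p, r) \<in> sm P"
proof (rule smI)
  fix x assume "(x, p) \<in> P"
  then obtain t where t: "(t, x) \<in> P" "(t, q) \<in> P" using smD(3)[OF assms(2)] by blast
  then obtain u where "(u, t) \<in> P" "(u, r) \<in> P" using smD(3)[OF assms(3)] by blast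
  then show "\<exists>t. (t, x) \<in> P \<and> (t, r) \<in> P" using t assms(1) by (meson Preorder_trans)
qed (use assms in \<open>auto dest: smD\<close>)

definition sep_class :: "'a rel \<Rightarrow> 'a \<Rightarrow> 'a set" where
  "sep_class P p = (sm P \<inter> (sm P)\<inverse>) `` {p}"

context
  fixes P :: "'a rel"
  assumes P: "Preorder P"
begin

lemma sm_refl: "p \<in> Field P \<Longrightarrow> (p, p) \<in> sm P"
  using subset_sm[OF P] Preorder_refl[OF P] by blast

lemma sep_class_eq_iff:
  assumes "p \<in> Field P" "q \<in> Field P"
  shows "sep_class P p = sep_class P q \<longleftrightarrow> (p, q) \<in> sm P \<and> (q, p) \<in> sm P"
proof
  assume "sep_class P p = sep_class P q"
  moreover have "q \<in> sep_class P q" using sm_refl[OF assms(2)] unfolding sep_class_def by auto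
  ultimately show "(p, q) \<in> sm P \<and> (q, p) \<in> sm P" unfolding sep_class_def by auto
next
  assume "(p, q) \<in> sm P \<and> (q, p) \<in> sm P"
  then show "sep_class P p = sep_class P q"
    unfolding sep_class_def using sm_trans[OF P] by blast
qed

lemma sq_eq: "sq P = {(sep_class P p, sep_class P q) | p q. (p, q) \<in> sm P}"
  unfolding sq_def sep_class_def Let_def by simp

lemma sq_iff:
  assumes "p \<in> Field P" "q \<in> Field P"
  shows "(sep_class P p, sep_class P q) \<in> sq P \<longleftrightarrow> (p, q) \<in> sm P"
proof
  assume "(sep_class P p, sep_class P q) \<in> sq P"
  then obtain p' q' where "(p', q') \<in> sm P" "sep_class P p = sep_class P p'"
    "sep_class P q = sep_class P q'"
    unfolding sq_eq by blast
  then show "(p, q) \<in> sm P"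
    using sep_class_eq_iff assms smD sm_trans[OF P] by metis
qed (auto simp: sq_eq)

lemma Field_sq: "Field (sq P) = sep_class P ` Field P"
proof
  show "Field (sq P) \<subseteq> sep_class P ` Field P"
  proof
    fix x assume "x \<in> Field (sq P)"
    then obtain p q where "(p, q) \<in> sm P" "x = sep_class P p \<or> x = sep_class P q"
      unfolding sq_eq Field_def by blast
    then show "x \<in> sep_class P ` Field P" using smD by fast
  qed
  show "sep_class P ` Field P \<subseteq> Field (sq P)"
  proof
    fix x assume "x \<in> sep_class P ` Field P"
    then have "(x, x) \<in> sq P" using sq_iff sm_refl by blast
    then show "x \<in> Field (sq P)" by (rule FieldI1)
  qed
qed

lemma Partial_order_sq: "Preorder (sq P)" "antisym (sq P)"
proof -
  show "Preorder (sq P)"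
  proof (rule PreorderI)
    fix x y z assume a: "(x, y) \<in> sq P" "(y, z) \<in> sq P"
    then have "x \<in> Field (sq P)" "y \<in> Field (sq P)" "z \<in> Field (sq P)"
      by (auto intro: FieldI1 FieldI2)
    then obtain p q r where pqr: "x = sep_class P p" "y = sep_class P q" "z = sep_class P r"
      "p \<in> Field P" "q \<in> Field P" "r \<in> Field P"
      unfolding Field_sq by blast
    have "(p, q) \<in> sm P" "(q, r) \<in> sm P" using a pqr sq_iff by auto
    then show "(x, z) \<in> sq P" using sm_trans[OF P] sq_iff pqr by blast
  qed (auto simp: Field_sq sq_iff sm_refl)
  show "antisym (sq P)"
  proof (rule antisymI)
    fix x y assume a: "(x, y) \<in> sq P" "(y, x) \<in> sq P"
    then have "x \<in> Field (sq P)" "y \<in> Field (sq P)" by (auto intro: FieldI1)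
    then obtain p q where "x = sep_class P p" "y = sep_class P q" "p \<in> Field P" "q \<in> Field P"
      unfolding Field_sq by blast
    then show "x = y" using a sq_iff sep_class_eq_iff by auto
  qed
qed

text \<open>Since \<open>Q\<close> is antisymmetric, \<open>g\<close> identifies two points exactly
  when each lies below the other in \<open>sm P\<close>, that is, when \<open>sq P\<close>
  identifies them. So \<open>g\<close> factors through the quotient as a bijection.\<close>

lemma sq_iso_criterion:
  assumes Q: "Preorder Q" "antisym Q" and g: "g ` Field P = Field Q"
    and iff: "\<And>p q. p \<in> Field P \<Longrightarrow> q \<in> Field P \<Longrightarrow> (p, q) \<in> sm P \<longleftrightarrow> (g p, g q) \<in> Q"
  shows "sq P \<cong>\<^sub>p Q"
proof -
  have eq: "sep_class P p = sep_class P q \<longleftrightarrow> g p = g q" if "p \<in> Field P" "q \<in> Field P" for p q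
  proof -
    have "sep_class P p = sep_class P q \<longleftrightarrow> (g p, g q) \<in> Q \<and> (g q, g p) \<in> Q"
      unfolding sep_class_eq_iff[OF that] using iff that by blast
    also have "\<dots> \<longleftrightarrow> g p = g q"
      using Q g that Preorder_refl[OF Q(1)] antisymD[OF Q(2)] by (metis imageI)
    finally show ?thesis .
  qed
  \<comment> \<open>Any representative of the class \<open>c\<close> would do: by \<open>eq\<close>
    all of them have the same value under \<open>g\<close>.\<close>
  define F where "F c = g (SOME p. p \<in> Field P \<and> sep_class P p = c)" for c
  have F: "F (sep_class P p) = g p" if p: "p \<in> Field P" for p
  proof -
    have "\<exists>q. q \<in> Field P \<and> sep_class P q = sep_class P p" using p by blast
    from someI_ex[OF this] show ?thesis unfolding F_def using eq p by blast
  qed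
  show ?thesis
  proof (rule poset_isoI[of F])
    have "F ` Field (sq P) = Field Q"
      unfolding Field_sq image_image using F g by (metis (no_types, lifting) image_cong)
    moreover have "inj_on F (Field (sq P))"
      unfolding Field_sq using F eq by (simp add: inj_on_def)
    ultimately show "bij_betw F (Field (sq P)) (Field Q)" unfolding bij_betw_def by blast
  qed (use F iff sq_iff in \<open>auto simp: Field_sq\<close>)
qed

end

lemma sq_cong:
  assumes "P \<cong>\<^sub>p Q" "Preorder P" "Preorder Q"
  shows "sq P \<cong>\<^sub>p sq Q"
proof -
  obtain f where f: "bij_betw f (Field P) (Field Q)"
    and m: "\<And>x y. x \<in> Field P \<Longrightarrow> y \<in> Field P \<Longrightarrow> (x, y) \<in> P \<longleftrightarrow> (f x, f y) \<in> Q"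
    using assms(1) unfolding poset_iso_def by blast
  have im: "Field Q = f ` Field P" using f by (simp add: bij_betw_def)
  have down: "\<exists>t\<in>Field P. u = f t" if "(u, v) \<in> Q" for u v
    using FieldI1[OF that] im by blast
  have sm: "(p, q) \<in> sm P \<longleftrightarrow> (f p, f q) \<in> sm Q" if pq: "p \<in> Field P" "q \<in> Field P" for p q
  proof
    assume a: "(p, q) \<in> sm P"
    show "(f p, f q) \<in> sm Q"
    proof (rule smI)
      fix r assume r: "(r, f p) \<in> Q"
      then obtain r' where r': "r' \<in> Field P" "r = f r'" using down by blast
      then have "(r', p) \<in> P" using r m pq by blast
      then obtain t where t: "(t, r') \<in> P" "(t, q) \<in> P" using smD(3)[OF a] by blast
      then have "t \<in> Field P" by (simp add: FieldI1)
      then show "\<exists>t. (t, r) \<in> Q \<and> (t, f q) \<in> Q" using t r' m pq by blast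
    qed (use im pq in auto)
  next
    assume a: "(f p, f q) \<in> sm Q"
    show "(p, q) \<in> sm P"
    proof (rule smI)
      fix r assume r: "(r, p) \<in> P"
      then have rF: "r \<in> Field P" by (simp add: FieldI1)
      then obtain t where t: "(t, f r) \<in> Q" "(t, f q) \<in> Q"
        using smD(3)[OF a] r m pq by blast
      then obtain t' where "t' \<in> Field P" "t = f t'" using down by blast
      then show "\<exists>t. (t, r) \<in> P \<and> (t, q) \<in> P" using t rF m pq by blast
    qed (use pq in auto)
  qed
  show ?thesis
  proof (rule sq_iso_criterion[where g = "\<lambda>p. sep_class Q (f p)", OF assms(2) Partial_order_sq[OF assms(3)]])
    show "(\<lambda>p. sep_class Q (f p)) ` Field P = Field (sq Q)"
      unfolding Field_sq[OF assms(3)] im by auto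
  qed (use sm im sq_iff[OF assms(3)] in auto)
qed

text \<open>A test point \<open>r\<close> below the coordinate \<open>p i\<close> becomes the test
  point \<open>p(i := r)\<close> of the product, where reflexivity takes care of the other
  coordinates. Conversely, witnesses for the single coordinates are chosen simultaneously.\<close>

lemma sm_poset_prod:
  assumes P: "\<And>i. i \<in> I \<Longrightarrow> Preorder (P i)"
    and pq: "p \<in> Field (poset_prod I P)" "q \<in> Field (poset_prod I P)"
  shows "(p, q) \<in> sm (poset_prod I P) \<longleftrightarrow> (\<forall>i\<in>I. (p i, q i) \<in> sm (P i))"
proof
  assume a: "(p, q) \<in> sm (poset_prod I P)"
  have pq': "p \<in> (\<Pi>\<^sub>E i\<in>I. Field (P i))" "q \<in> (\<Pi>\<^sub>E i\<in>I. Field (P i))"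
    using pq by (simp_all add: Field_poset_prod[OF P])
  show "\<forall>i\<in>I. (p i, q i) \<in> sm (P i)"
  proof
    fix i assume i: "i \<in> I"
    show "(p i, q i) \<in> sm (P i)"
    proof (rule smI)
      fix r assume r: "(r, p i) \<in> P i"
      have "(p(i := r), p) \<in> poset_prod I P"
        unfolding poset_prod_def mem_Collect_eq case_prod_conv
      proof (intro conjI ballI)
        show "p(i := r) \<in> (\<Pi>\<^sub>E i\<in>I. Field (P i))"
          using pq'(1) FieldI1[OF r] i by (auto simp: PiE_iff extensional_def)
        show "((p(i := r)) j, p j) \<in> P j" if "j \<in> I" for j
          using r Preorder_refl[OF P[OF that]] pq'(1) that by (auto simp: PiE_iff)
      qed (rule pq'(1))
      then obtain t where "(t, p(i := r)) \<in> poset_prod I P" "(t, q) \<in> poset_prod I P"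
        using smD(3)[OF a] by blast
      then show "\<exists>t. (t, r) \<in> P i \<and> (t, q i) \<in> P i"
        using i unfolding poset_prod_def by fastforce
    qed (use pq' i in auto)
  qed
next
  assume a: "\<forall>i\<in>I. (p i, q i) \<in> sm (P i)"
  show "(p, q) \<in> sm (poset_prod I P)"
  proof (rule smI)
    fix r assume r: "(r, p) \<in> poset_prod I P"
    then have "\<forall>i\<in>I. \<exists>t. (t, r i) \<in> P i \<and> (t, q i) \<in> P i"
      using a smD(3) unfolding poset_prod_def by fast
    from bchoice[OF this] obtain t where t: "\<And>i. i \<in> I \<Longrightarrow> (t i, r i) \<in> P i \<and> (t i, q i) \<in> P i"
      by blast
    then have "restrict t I \<in> (\<Pi>\<^sub>E i\<in>I. Field (P i))" by (auto intro: FieldI1)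
    then have "(restrict t I, r) \<in> poset_prod I P" "(restrict t I, q) \<in> poset_prod I P"
      using t FieldI1[OF r] pq(2) by (simp_all add: poset_prod_iff P Field_poset_prod)
    then show "\<exists>t. (t, r) \<in> poset_prod I P \<and> (t, q) \<in> poset_prod I P" by blast
  qed (use pq in auto)
qed

lemma sq_poset_prod:
  assumes P: "\<And>i. i \<in> I \<Longrightarrow> Preorder (P i)"
  shows "sq (poset_prod I P) \<cong>\<^sub>p poset_prod I (\<lambda>i. sq (P i))"
proof -
  have S: "Preorder (sq (P i))" "antisym (sq (P i))" if "i \<in> I" for i
    using Partial_order_sq[OF P[OF that]] .
  let ?g = "\<lambda>p. \<lambda>i\<in>I. sep_class (P i) (p i)"
  have g: "?g p \<in> (\<Pi>\<^sub>E i\<in>I. Field (sq (P i)))" if "p \<in> Field (poset_prod I P)" for p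
    using that P by (simp add: Field_poset_prod Field_sq PiE_iff)
  show ?thesis
  proof (rule sq_iso_criterion[where g = ?g])
    show "Preorder (poset_prod I P)" using P by (rule Preorder_poset_prod)
    show "Preorder (poset_prod I (\<lambda>i. sq (P i)))" using S by (intro Preorder_poset_prod)
    show "antisym (poset_prod I (\<lambda>i. sq (P i)))"
    proof (rule antisymI)
      fix x y assume "(x, y) \<in> poset_prod I (\<lambda>i. sq (P i))" "(y, x) \<in> poset_prod I (\<lambda>i. sq (P i))"
      then have xy: "x \<in> (\<Pi>\<^sub>E i\<in>I. Field (sq (P i)))" "y \<in> (\<Pi>\<^sub>E i\<in>I. Field (sq (P i)))"
        "\<And>i. i \<in> I \<Longrightarrow> (x i, y i) \<in> sq (P i) \<and> (y i, x i) \<in> sq (P i)"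
        by (simp_all add: poset_prod_def)
      from xy(1,2) show "x = y"
        by (rule PiE_ext) (use xy(3) S(2) antisymD in metis)
    qed
    show "?g ` Field (poset_prod I P) = Field (poset_prod I (\<lambda>i. sq (P i)))"
    proof
      show "?g ` Field (poset_prod I P) \<subseteq> Field (poset_prod I (\<lambda>i. sq (P i)))"
        using g S by (simp add: Field_poset_prod image_subset_iff)
      show "Field (poset_prod I (\<lambda>i. sq (P i))) \<subseteq> ?g ` Field (poset_prod I P)"
      proof
        fix x assume "x \<in> Field (poset_prod I (\<lambda>i. sq (P i)))"
        then have x: "x \<in> (\<Pi>\<^sub>E i\<in>I. Field (sq (P i)))" using S by (simp add: Field_poset_prod)
        then have "\<forall>i\<in>I. \<exists>p. p \<in> Field (P i) \<and> x i = sep_class (P i) p"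
          using P Field_sq by blast
        from bchoice[OF this] obtain p where p:
          "\<And>i. i \<in> I \<Longrightarrow> p i \<in> Field (P i) \<and> x i = sep_class (P i) (p i)" by blast
        have "restrict p I \<in> Field (poset_prod I P)" using p P by (simp add: Field_poset_prod)
        moreover have "?g (restrict p I) = x"
          using x p by (auto simp: fun_eq_iff PiE_iff extensional_def)
        ultimately show "x \<in> ?g ` Field (poset_prod I P)" by blast
      qed
    qed
    fix p q assume pq: "p \<in> Field (poset_prod I P)" "q \<in> Field (poset_prod I P)"
    have "(?g p, ?g q) \<in> poset_prod I (\<lambda>i. sq (P i)) \<longleftrightarrow>
      (\<forall>i\<in>I. (sep_class (P i) (p i), sep_class (P i) (q i)) \<in> sq (P i))"
      using g[OF pq(1)] g[OF pq(2)] by (auto simp: poset_prod_def)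
    also have "\<dots> \<longleftrightarrow> (\<forall>i\<in>I. (p i, q i) \<in> sm (P i))"
      using pq P by (auto simp: Field_poset_prod PiE_iff sq_iff)
    also have "\<dots> \<longleftrightarrow> (p, q) \<in> sm (poset_prod I P)"
      using sm_poset_prod[OF P pq] by blast
    finally show "(p, q) \<in> sm (poset_prod I P) \<longleftrightarrow> (?g p, ?g q) \<in> poset_prod I (\<lambda>i. sq (P i))"
      by blast
  qed
qed

subsection \<open>Regular open algebras\<close>

lemma Field_ro: "Field (ro P) = {U. poset_int P (poset_cl P U) = U}"
  unfolding ro_def Field_def by blast

lemma poset_int_cl:
  "Preorder P \<Longrightarrow> poset_int P (poset_cl P U) =
    {p \<in> Field P. \<forall>q. (q, p) \<in> P \<longrightarrow> (\<exists>r\<in>U. (r, q) \<in> P)}"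
  unfolding poset_int_def poset_cl_def by (auto intro: FieldI1)

lemma regular_open_iff:
  assumes "Preorder P"
  shows "U \<in> Field (ro P) \<longleftrightarrow>
    (\<forall>p. p \<in> U \<longleftrightarrow> p \<in> Field P \<and> (\<forall>q. (q, p) \<in> P \<longrightarrow> (\<exists>r\<in>U. (r, q) \<in> P)))"
  unfolding Field_ro mem_Collect_eq poset_int_cl[OF assms] by blast

lemma regular_open_down:
  assumes P: "Preorder P" and U: "U \<in> Field (ro P)" and "p \<in> U" "(q, p) \<in> P"
  shows "q \<in> U"
proof -
  have "\<exists>r\<in>U. (r, q') \<in> P" if "(q', q) \<in> P" for q'
    using assms that Preorder_trans[OF P] unfolding regular_open_iff[OF P] by blast
  then show ?thesis using U assms(4) FieldI1 unfolding regular_open_iff[OF P] by metis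
qed

lemma ro_dense_map:
  assumes P: "Preorder P" and Q: "Preorder Q"
    and e: "\<And>p. p \<in> Field P \<Longrightarrow> e p \<in> Field Q"
    and mono: "\<And>p p'. (p, p') \<in> P \<Longrightarrow> (e p, e p') \<in> Q"
    and compat: "\<And>p p' y. p \<in> Field P \<Longrightarrow> p' \<in> Field P \<Longrightarrow> (y, e p) \<in> Q \<Longrightarrow> (y, e p') \<in> Q \<Longrightarrow>
      \<exists>q. (q, p) \<in> P \<and> (q, p') \<in> P"
    and dense: "\<And>y. y \<in> Field Q \<Longrightarrow> \<exists>p\<in>Field P. (e p, y) \<in> Q"
  shows "ro P \<cong>\<^sub>p ro Q"
proof -
  note trP = Preorder_trans[OF P] and trQ = Preorder_trans[OF Q]
  note rfP = Preorder_refl[OF P] and rfQ = Preorder_refl[OF Q]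
  note roP = regular_open_iff[OF P] and roQ = regular_open_iff[OF Q]
  note dnP = regular_open_down[OF P] and dnQ = regular_open_down[OF Q]
  define F where "F U = {p \<in> Field P. e p \<in> U}" for U
  define G where "G V = {y \<in> Field Q. \<forall>z. (z, y) \<in> Q \<longrightarrow> (\<exists>p\<in>V. (e p, z) \<in> Q)}" for V
  have F_in: "F U \<in> Field (ro P)" if U: "U \<in> Field (ro Q)" for U
    unfolding roP
  proof (intro allI iffI)
    fix p assume "p \<in> F U"
    then show "p \<in> Field P \<and> (\<forall>q. (q, p) \<in> P \<longrightarrow> (\<exists>r\<in>F U. (r, q) \<in> P))"
      using dnQ[OF U] mono rfP FieldI1 unfolding F_def by (metis (no_types, lifting) mem_Collect_eq)
  next
    fix p assume p: "p \<in> Field P \<and> (\<forall>q. (q, p) \<in> P \<longrightarrow> (\<exists>r\<in>F U. (r, q) \<in> P))"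
    have "\<exists>z\<in>U. (z, y) \<in> Q" if y: "(y, e p) \<in> Q" for y
    proof -
      \<comment> \<open>The point \<open>y\<close> need not be an image, so density first provides
        an image below it, to which \<open>compat\<close> applies.\<close>
      obtain p1 where p1: "p1 \<in> Field P" "(e p1, y) \<in> Q" using dense[OF FieldI1[OF y]] by blast
      then have "(e p1, e p) \<in> Q" "(e p1, e p1) \<in> Q" using y trQ e rfQ by blast+
      then obtain q where q: "(q, p1) \<in> P" "(q, p) \<in> P" using compat p1(1) p by blast
      then obtain r where "r \<in> F U" "(r, q) \<in> P" using p by blast
      then have "e r \<in> U" "(e r, y) \<in> Q"
        using q p1 mono trQ unfolding F_def by blast+
      then show ?thesis by blast
    qed
    then have "e p \<in> U" using U p e unfolding roQ by blast
    then show "p \<in> F U" using p unfolding F_def by blast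
  qed
  have G_in: "G V \<in> Field (ro Q)" if V: "V \<in> Field (ro P)" for V
    unfolding roQ
  proof (intro allI iffI)
    fix y assume y: "y \<in> G V"
    have "z \<in> G V" if "(z, y) \<in> Q" for z
      using y that trQ FieldI1[OF that] unfolding G_def by blast
    then show "y \<in> Field Q \<and> (\<forall>q. (q, y) \<in> Q \<longrightarrow> (\<exists>r\<in>G V. (r, q) \<in> Q))"
      using y rfQ FieldI1 unfolding G_def by (metis (no_types, lifting) mem_Collect_eq)
  next
    fix y assume y: "y \<in> Field Q \<and> (\<forall>q. (q, y) \<in> Q \<longrightarrow> (\<exists>r\<in>G V. (r, q) \<in> Q))"
    have "\<exists>p\<in>V. (e p, z) \<in> Q" if z: "(z, y) \<in> Q" for z
    proof -
      obtain w where w: "w \<in> G V" "(w, z) \<in> Q" using y z by blast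
      then obtain p where "p \<in> V" "(e p, w) \<in> Q" using rfQ unfolding G_def by blast
      then show ?thesis using w trQ by blast
    qed
    then show "y \<in> G V" using y unfolding G_def by blast
  qed
  have FG: "F (G V) = V" if V: "V \<in> Field (ro P)" for V
  proof (intro set_eqI iffI)
    fix p assume p: "p \<in> V"
    then have pF: "p \<in> Field P" using V unfolding roP by blast
    have "\<exists>q\<in>V. (e q, z) \<in> Q" if z: "(z, e p) \<in> Q" for z
    proof -
      obtain p1 where p1: "p1 \<in> Field P" "(e p1, z) \<in> Q" using dense[OF FieldI1[OF z]] by blast
      then have "(e p1, e p) \<in> Q" "(e p1, e p1) \<in> Q" using z trQ e rfQ by blast+
      then obtain q where q: "(q, p1) \<in> P" "(q, p) \<in> P" using compat p1(1) pF by blast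
      then show ?thesis using dnP[OF V p] mono p1 trQ by blast
    qed
    then show "p \<in> F (G V)" using pF e unfolding F_def G_def by blast
  next
    fix p assume p: "p \<in> F (G V)"
    have "\<exists>r\<in>V. (r, q) \<in> P" if q: "(q, p) \<in> P" for q
    proof -
      obtain p' where p': "p' \<in> V" "(e p', e q) \<in> Q" using p mono[OF q] unfolding F_def G_def by blast
      then have "p' \<in> Field P" using V unfolding roP by blast
      then obtain r where "(r, p') \<in> P" "(r, q) \<in> P"
        using compat[of p' q "e p'"] p' rfQ e FieldI1[OF q] by blast
      then show ?thesis using dnP[OF V] p'(1) by blast
    qed
    then show "p \<in> V" using V p unfolding roP F_def by blast
  qed
  have GF: "G (F U) = U" if U: "U \<in> Field (ro Q)" for U
  proof (intro set_eqI iffI)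
    fix y assume y: "y \<in> U"
    have "\<exists>p\<in>F U. (e p, z) \<in> Q" if z: "(z, y) \<in> Q" for z
    proof -
      obtain p where p: "p \<in> Field P" "(e p, z) \<in> Q" using dense[OF FieldI1[OF z]] by blast
      then have "e p \<in> U" using dnQ[OF U y] z trQ by blast
      then show ?thesis using p unfolding F_def by blast
    qed
    moreover have "y \<in> Field Q" using U y unfolding roQ by blast
    ultimately show "y \<in> G (F U)" unfolding G_def by blast
  next
    fix y assume y: "y \<in> G (F U)"
    have "\<exists>r\<in>U. (r, z) \<in> Q" if "(z, y) \<in> Q" for z
      using y that unfolding G_def F_def by blast
    then show "y \<in> U" using U y unfolding roQ G_def by blast
  qed
  have bij: "bij_betw F (Field (ro Q)) (Field (ro P))"
    by (rule bij_betw_byWitness[where f' = G]) (use F_in G_in FG GF in auto)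
  have "ro Q \<cong>\<^sub>p ro P"
  proof (rule poset_isoI[OF bij])
    fix U U' assume UU: "U \<in> Field (ro Q)" "U' \<in> Field (ro Q)"
    have "U \<subseteq> U' \<longleftrightarrow> F U \<subseteq> F U'"
    proof
      assume "F U \<subseteq> F U'"
      then have "G (F U) \<subseteq> G (F U')" unfolding G_def by blast
      then show "U \<subseteq> U'" using GF UU by simp
    qed (auto simp: F_def)
    then show "(U, U') \<in> ro Q \<longleftrightarrow> (F U, F U') \<in> ro P"
      using UU F_in[OF UU(1)] F_in[OF UU(2)] unfolding Field_ro by (auto simp: ro_def)
  qed
  then show ?thesis by (rule poset_iso_sym)
qed

text \<open>The map \<open>sep_class P\<close> is onto, and a class below two classes yields a point
  below both representatives by using the defining property of \<open>sm\<close> twice.\<close>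

lemma ro_sq:
  assumes P: "Preorder P"
  shows "ro P \<cong>\<^sub>p ro (sq P)"
proof (rule ro_dense_map[OF P Partial_order_sq(1)[OF P], of "sep_class P"])
  fix p p' assume "(p, p') \<in> P"
  then show "(sep_class P p, sep_class P p') \<in> sq P"
    using sq_iff[OF P] subset_sm[OF P] by (simp add: FieldI1 FieldI2)
next
  fix p p' y assume a: "p \<in> Field P" "p' \<in> Field P" "(y, sep_class P p) \<in> sq P" "(y, sep_class P p') \<in> sq P"
  then obtain r where r: "r \<in> Field P" "y = sep_class P r"
    using FieldI1 Field_sq[OF P] by (metis imageE)
  then have rp: "(r, p) \<in> sm P" "(r, p') \<in> sm P" using a sq_iff[OF P] by auto
  obtain t where t: "(t, r) \<in> P" "(t, p) \<in> P" using smD(3)[OF rp(1)] r Preorder_refl[OF P] by blast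
  obtain u where u: "(u, t) \<in> P" "(u, p') \<in> P" using smD(3)[OF rp(2) t(1)] by blast
  then show "\<exists>q. (q, p) \<in> P \<and> (q, p') \<in> P" using t Preorder_trans[OF P] by blast
next
  fix y assume "y \<in> Field (sq P)"
  then obtain p where "p \<in> Field P" "y = sep_class P p" using Field_sq[OF P] by blast
  then show "\<exists>p\<in>Field P. (sep_class P p, y) \<in> sq P" using sq_iff[OF P] sm_refl[OF P] by blast
qed (simp add: Field_sq[OF P])

lemma ro_cong:
  assumes "P \<cong>\<^sub>p Q" and P: "Preorder P" and Q: "Preorder Q"
  shows "ro P \<cong>\<^sub>p ro Q"
proof -
  obtain f where f: "bij_betw f (Field P) (Field Q)"
    and m: "\<And>x y. x \<in> Field P \<Longrightarrow> y \<in> Field P \<Longrightarrow> (x, y) \<in> P \<longleftrightarrow> (f x, f y) \<in> Q"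
    using assms(1) unfolding poset_iso_def by blast
  have im: "Field Q = f ` Field P" using f by (simp add: bij_betw_def)
  show ?thesis
  proof (rule ro_dense_map[OF P Q, of f])
    fix p p' y assume a: "p \<in> Field P" "p' \<in> Field P" "(y, f p) \<in> Q" "(y, f p') \<in> Q"
    then obtain q where "q \<in> Field P" "y = f q" using FieldI1[OF a(3)] im by blast
    then show "\<exists>q. (q, p) \<in> P \<and> (q, p') \<in> P" using a m by blast
  next
    fix y assume "y \<in> Field Q"
    then obtain p where "p \<in> Field P" "y = f p" "(y, y) \<in> Q" using im Preorder_refl[OF Q] by blast
    then show "\<exists>p\<in>Field P. (f p, y) \<in> Q" by blast
  next
    fix p p' assume "(p, p') \<in> P"
    then show "(f p, f p') \<in> Q" using m FieldI1 FieldI2 by metis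
  qed (use im in blast)
qed

subsection \<open>Strictly increasing maps between well-orders\<close>

text \<open>Explicit domains and codomains allow maps between parts of one order without restricting
  the relation, and composition needs no change of relation. Only the strict parts are compared;
  injectivity on a linearly ordered domain follows in \<open>emb_inj_on\<close>.\<close>

definition emb :: "'a rel \<Rightarrow> 'a set \<Rightarrow> 'b rel \<Rightarrow> 'b set \<Rightarrow> ('a \<Rightarrow> 'b) \<Rightarrow> bool" where
  "emb r A s C f \<longleftrightarrow> (\<forall>x\<in>A. f x \<in> C) \<and>
     (\<forall>x\<in>A. \<forall>y\<in>A. (x, y) \<in> r \<and> x \<noteq> y \<longrightarrow> (f x, f y) \<in> s \<and> f x \<noteq> f y)"

lemma embI:
  assumes "\<And>x. x \<in> A \<Longrightarrow> f x \<in> C"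
    and "\<And>x y. x \<in> A \<Longrightarrow> y \<in> A \<Longrightarrow> (x, y) \<in> r \<Longrightarrow> x \<noteq> y \<Longrightarrow> (f x, f y) \<in> s \<and> f x \<noteq> f y"
  shows "emb r A s C f"
  using assms unfolding emb_def by blast

lemma embD:
  assumes "emb r A s C f"
  shows "x \<in> A \<Longrightarrow> f x \<in> C"
    and "x \<in> A \<Longrightarrow> y \<in> A \<Longrightarrow> (x, y) \<in> r \<Longrightarrow> x \<noteq> y \<Longrightarrow> (f x, f y) \<in> s"
    and "x \<in> A \<Longrightarrow> y \<in> A \<Longrightarrow> (x, y) \<in> r \<Longrightarrow> x \<noteq> y \<Longrightarrow> f x \<noteq> f y"
  using assms unfolding emb_def by blast+

lemma emb_comp:
  assumes "emb r A s C f" "emb s C t D g"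
  shows "emb r A t D (\<lambda>x. g (f x))"
  using assms unfolding emb_def by blast

lemma emb_funpow:
  assumes "emb r A r A f" shows "emb r A r A (f ^^ m)"
proof (induction m)
  case (Suc m)
  then show ?case using emb_comp[OF Suc assms] by (simp add: comp_def)
qed (auto simp: emb_def)

section \<open>Linear orders and well-orders\<close>

lemma Linear_orderD:
  assumes "linear_order_on A r"
  shows "x \<in> A \<Longrightarrow> (x, x) \<in> r"
    and "(x, y) \<in> r \<Longrightarrow> (y, z) \<in> r \<Longrightarrow> (x, z) \<in> r"
    and "(x, y) \<in> r \<Longrightarrow> (y, x) \<in> r \<Longrightarrow> x = y"
    and "x \<in> A \<Longrightarrow> y \<in> A \<Longrightarrow> x \<noteq> y \<Longrightarrow> (x, y) \<in> r \<or> (y, x) \<in> r"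
    and "(x, y) \<in> r \<Longrightarrow> x \<in> A \<and> y \<in> A"
proof -
  have "refl_on A r" "trans r" "antisym r" "total_on A r" "r \<subseteq> A \<times> A"
    using assms unfolding order_on_defs by auto
  then show "x \<in> A \<Longrightarrow> (x, x) \<in> r"
    and "(x, y) \<in> r \<Longrightarrow> (y, z) \<in> r \<Longrightarrow> (x, z) \<in> r"
    and "(x, y) \<in> r \<Longrightarrow> (y, x) \<in> r \<Longrightarrow> x = y"
    and "x \<in> A \<Longrightarrow> y \<in> A \<Longrightarrow> x \<noteq> y \<Longrightarrow> (x, y) \<in> r \<or> (y, x) \<in> r"
    and "(x, y) \<in> r \<Longrightarrow> x \<in> A \<and> y \<in> A"
    by (auto simp: refl_on_def total_on_def dest: transD antisymD)
qed

lemma Linear_order_notD: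
  assumes "linear_order_on A r" "x \<in> A" "y \<in> A" "(x, y) \<notin> r"
  shows "(y, x) \<in> r" "x \<noteq> y"
  using Linear_orderD(1,4)[OF assms(1)] assms(2-) by metis+

lemma Field_linear_order_on: "linear_order_on A r \<Longrightarrow> Field r = A"
  by (auto simp: Field_def dest: Linear_orderD(1,5))

lemma linear_order_onI:
  assumes "\<And>x y. (x, y) \<in> r \<Longrightarrow> x \<in> A \<and> y \<in> A"
    and "\<And>x. x \<in> A \<Longrightarrow> (x, x) \<in> r"
    and "\<And>x y z. (x, y) \<in> r \<Longrightarrow> (y, z) \<in> r \<Longrightarrow> (x, z) \<in> r"
    and "\<And>x y. (x, y) \<in> r \<Longrightarrow> (y, x) \<in> r \<Longrightarrow> x = y"
    and "\<And>x y. x \<in> A \<Longrightarrow> y \<in> A \<Longrightarrow> x \<noteq> y \<Longrightarrow> (x, y) \<in> r \<or> (y, x) \<in> r"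
  shows "linear_order_on A r"
proof -
  have "trans r" "antisym r" by (rule transI, erule (1) assms(3)) (rule antisymI, erule (1) assms(4))
  moreover have "r \<subseteq> A \<times> A" using assms(1) by auto
  ultimately show ?thesis
    using assms(2,5) unfolding order_on_defs refl_on_def total_on_def by simp
qed

lemma linear_order_pullback:
  assumes r: "linear_order_on B r" and f: "inj_on f A" "\<And>x. x \<in> A \<Longrightarrow> f x \<in> B"
  shows "linear_order_on A {(x, y). x \<in> A \<and> y \<in> A \<and> (f x, f y) \<in> r}" (is "linear_order_on A ?r")
proof (rule linear_order_onI)
  fix x y assume "x \<in> A" "y \<in> A" "x \<noteq> y"
  then show "(x, y) \<in> ?r \<or> (y, x) \<in> ?r"
    using Linear_orderD(4)[OF r, of "f x" "f y"] f by (auto dest: inj_onD)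
next
  fix x y assume "(x, y) \<in> ?r"
    "(y, x) \<in> ?r"
  then show "x = y" using Linear_orderD(3)[OF r, of "f x" "f y"] f(1) by (auto dest: inj_onD)
next
  fix x y z assume "(x, y) \<in> ?r"
    "(y, z) \<in> ?r"
  then show "(x, z) \<in> ?r"
    using Linear_orderD(2)[OF r, of "f x" "f y" "f z"] by simp
qed (use f(2) Linear_orderD(1)[OF r] in auto)

lemma well_order_onD: "well_order_on A r \<Longrightarrow> linear_order_on A r" "well_order_on A r \<Longrightarrow> wf (r - Id)"
  unfolding well_order_on_def by auto

lemma linear_order_on_Restr:
  assumes "linear_order_on B r" "A \<subseteq> B" shows "linear_order_on A (Restr r A)"
proof (rule linear_order_onI)
  show "\<And>x y z. (x, y) \<in> Restr r A \<Longrightarrow> (y, z) \<in> Restr r A \<Longrightarrow> (x, z) \<in> Restr r A"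
    by (auto intro: Linear_orderD(2)[OF assms(1)])
  show "\<And>x y. x \<in> A \<Longrightarrow> y \<in> A \<Longrightarrow> x \<noteq> y \<Longrightarrow> (x, y) \<in> Restr r A \<or> (y, x) \<in> Restr r A"
    using assms(2) by (auto dest: Linear_orderD(4)[OF assms(1)])
  show "\<And>x y. (x, y) \<in> Restr r A \<Longrightarrow> (y, x) \<in> Restr r A \<Longrightarrow> x = y"
    by (auto intro: Linear_orderD(3)[OF assms(1)])
qed (use assms(2) Linear_orderD(1)[OF assms(1)] in auto)

lemma well_order_on_Restr:
  assumes "well_order_on B r" "A \<subseteq> B" shows "well_order_on A (Restr r A)"
proof -
  have "wf (Restr r A - Id)" by (rule wf_subset[OF well_order_onD(2)[OF assms(1)]]) blast
  then show ?thesis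
    using linear_order_on_Restr[OF well_order_onD(1)[OF assms(1)] assms(2)]
    unfolding well_order_on_def by simp
qed

lemma emb_inj_on:
  assumes "linear_order_on B r" "A \<subseteq> B" "emb r A s C f" shows "inj_on f A"
proof (rule inj_onI, rule ccontr)
  fix x y assume xy: "x \<in> A" "y \<in> A" "f x = f y" "x \<noteq> y"
  then have "(x, y) \<in> r \<or> (y, x) \<in> r" using Linear_orderD(4)[OF assms(1)] assms(2) by auto
  then show False using embD(3)[OF assms(3) xy(1,2)] embD(3)[OF assms(3) xy(2,1)] xy by auto
qed

lemma emb_iff:
  assumes r: "linear_order_on B r" "A \<subseteq> B" and s: "linear_order_on D s" "C \<subseteq> D"
    and f: "emb r A s C f" and xy: "x \<in> A" "y \<in> A"
  shows "(f x, f y) \<in> s \<longleftrightarrow> (x, y) \<in> r"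
proof
  assume a: "(f x, f y) \<in> s"
  show "(x, y) \<in> r"
  proof (rule ccontr)
    assume n: "(x, y) \<notin> r"
    have "x \<noteq> y" "(y, x) \<in> r" using Linear_order_notD[OF r(1) _ _ n] r(2) xy by auto
    then have "(f y, f x) \<in> s" "f y \<noteq> f x" using embD(2,3)[OF f xy(2,1)] by auto
    then show False using a Linear_orderD(3)[OF s(1)] by blast
  qed
next
  assume a: "(x, y) \<in> r"
  show "(f x, f y) \<in> s"
    using embD(1)[OF f xy(1)] embD(2)[OF f xy a] Linear_orderD(1)[OF s(1)] s(2) by (cases "x = y") auto
qed

text \<open>If \<open>f x\<close> were strictly below \<open>x\<close>, then \<open>f (f x)\<close>
  would be strictly below \<open>f x\<close>, against the induction hypothesis at
  \<open>f x\<close>.\<close>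

lemma emb_ge:
  assumes r: "Well_order r" "A \<subseteq> Field r" and f: "emb r A r A f" and x: "x \<in> A"
  shows "(x, f x) \<in> r"
  using x
proof (induction x rule: wf_induct_rule[OF well_order_onD(2)[OF r(1)]])
  case (1 x)
  show ?case
  proof (rule ccontr)
    assume n: "(x, f x) \<notin> r"
    have fx: "f x \<in> A" using embD(1)[OF f 1(2)] .
    have a: "(f x, x) \<in> r" "f x \<noteq> x"
      using Linear_order_notD[OF well_order_onD(1)[OF r(1)] _ _ n] r(2) 1(2) fx by auto
    then have "(f x, f (f x)) \<in> r" using 1(1) fx by blast
    moreover have "(f (f x), f x) \<in> r" "f (f x) \<noteq> f x"
      using embD(2,3)[OF f fx 1(2) a] by auto
    ultimately show False using Linear_orderD(3)[OF well_order_onD(1)[OF r(1)]] by blast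
  qed
qed

lemma well_order_on_emb:
  assumes r: "linear_order_on A r" and s: "Well_order s" and f: "emb r A s C f"
  shows "well_order_on A r"
proof -
  have "r - Id \<subseteq> inv_image (s - Id) f"
    by (auto simp: inv_image_def dest: Linear_orderD(5)[OF r] intro: embD(2)[OF f] dest: embD(3)[OF f])
  then have "wf (r - Id)"
    by (rule wf_subset[OF wf_inv_image[OF well_order_onD(2)[OF s]]])
  then show ?thesis using r unfolding well_order_on_def by blast
qed

lemma poset_iso_emb:
  assumes f: "bij_betw f (Field r) (Field s)"
    and m: "\<And>x y. x \<in> Field r \<Longrightarrow> y \<in> Field r \<Longrightarrow> (x, y) \<in> r \<longleftrightarrow> (f x, f y) \<in> s"
  shows "emb r (Field r) s (Field s) f"
  by (rule embI) (use f m in \<open>auto simp: bij_betw_def inj_on_def\<close>)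

text \<open>Otherwise \<open>s\<close> is isomorphic to a proper initial segment of
  \<open>r\<close>, the part below some \<open>a\<close>. Following \<open>f\<close> by that
  isomorphism gives a self-embedding of \<open>r\<close> that moves \<open>a\<close> strictly down,
  which \<open>emb_ge\<close> forbids.\<close>

lemma emb_imp_ordLeq:
  assumes r: "Well_order r" and s: "Well_order s" and f: "emb r (Field r) s (Field s) f"
  shows "r \<le>o s"
proof (rule ccontr)
  assume "\<not> r \<le>o s"
  then have "s <o r" using not_ordLeq_iff_ordLess[OF s r] by blast
  then obtain a where a: "a \<in> Field r" "s =o Restr r (underS r a)"
    using ordLess_iff_ordIso_Restr[OF r s] by blast
  then obtain g where g: "iso s (Restr r (underS r a)) g" unfolding ordIso_def by auto
  have "emb s (Field s) (Restr r (underS r a)) (Field (Restr r (underS r a))) g"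
    using g unfolding iso_iff2 by (intro poset_iso_emb) auto
  then have g': "emb s (Field s) r (underS r a) g"
    by (auto simp: emb_def Field_def)
  have gf: "emb r (Field r) r (underS r a) (\<lambda>x. g (f x))" using emb_comp[OF f g'] .
  moreover have "underS r a \<subseteq> Field r" by (auto simp: underS_def Field_def)
  ultimately have "emb r (Field r) r (Field r) (\<lambda>x. g (f x))"
    unfolding emb_def by blast
  then have "(a, g (f a)) \<in> r" using emb_ge[OF r _ _ a(1)] by blast
  moreover have "(g (f a), a) \<in> r" "g (f a) \<noteq> a"
    using embD(1)[OF gf a(1)] unfolding underS_def by auto
  ultimately show False using Linear_orderD(3)[OF well_order_onD(1)[OF r]] by blast
qed

lemma ordLeq_imp_emb:
  assumes "r \<le>o s" shows "\<exists>f. emb r (Field r) s (Field s) f"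
proof -
  obtain f where f: "embed r s f" and r: "Well_order r" using assms unfolding ordLeq_def by auto
  have "emb r (Field r) s (Field s) f"
    using embed_compat[OF f] embed_inj_on[OF r f] embed_Field[OF f]
    unfolding emb_def compat_def inj_on_def by blast
  then show ?thesis by blast
qed

lemma ordIso_iff_poset_iso: "r =o s \<longleftrightarrow> Well_order r \<and> Well_order s \<and> r \<cong>\<^sub>p s"
  unfolding ordIso_def poset_iso_iff_iso by auto

lemma Well_order_poset_iso:
  assumes "r \<cong>\<^sub>p s" "Well_order s" shows "Well_order r"
proof -
  obtain f where f: "bij_betw f (Field r) (Field s)"
    and m: "\<And>x y. x \<in> Field r \<Longrightarrow> y \<in> Field r \<Longrightarrow> (x, y) \<in> r \<longleftrightarrow> (f x, f y) \<in> s"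
    using assms(1) unfolding poset_iso_def by blast
  have "r = {(x, y). x \<in> Field r \<and> y \<in> Field r \<and> (f x, f y) \<in> s}"
    using m FieldI1[of _ _ r] FieldI2[of _ _ r] by blast
  moreover have "linear_order_on (Field r) {(x, y). x \<in> Field r \<and> y \<in> Field r \<and> (f x, f y) \<in> s}"
    using linear_order_pullback[OF well_order_onD(1)[OF assms(2)]] f unfolding bij_betw_def by blast
  ultimately have "Linear_order r" by simp
  then show ?thesis by (rule well_order_on_emb[OF _ assms(2) poset_iso_emb[OF f m]])
qed

text \<open>Induction along \<open>r\<close> shows that the part of \<open>A\<close> strictly below
  any \<open>a\<close> is finite: its greatest element \<open>m\<close> covers it by
  \<open>m\<close> and the part strictly below \<open>m\<close>. The same argument, run once more,
  covers \<open>A\<close> itself.\<close>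

lemma finite_well_order_reverse:
  assumes r: "linear_order_on B r" "wf (r - Id)" and A: "A \<subseteq> B"
    and max: "\<And>S. S \<subseteq> A \<Longrightarrow> S \<noteq> {} \<Longrightarrow> \<exists>m\<in>S. \<forall>x\<in>S. (x, m) \<in> r"
  shows "finite A"
proof -
  have fin: "finite S" if S: "S \<subseteq> A" and below: "\<And>m. m \<in> S \<Longrightarrow> finite {x \<in> A. (x, m) \<in> r \<and> x \<noteq> m}" for S
  proof (cases "S = {}")
    case False
    obtain m where m: "m \<in> S" "\<forall>x\<in>S. (x, m) \<in> r" using max[OF S False] by blast
    then have "S \<subseteq> insert m {x \<in> A. (x, m) \<in> r \<and> x \<noteq> m}" using S by blast
    then show ?thesis using below[OF m(1)] finite_subset by blast
  qed simp
  have "finite {x \<in> A. (x, a) \<in> r \<and> x \<noteq> a}" for a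
  proof (induction a rule: wf_induct_rule[OF r(2)])
    case (1 a)
    show ?case by (rule fin) (use 1 in auto)
  qed
  then show ?thesis using fin by blast
qed

text \<open>This eliminates the reversed alternatives in \<open>cyclic_rearrangements\<close> and
  \<open>end_rearrangements\<close> as soon as the rearranged order is known to be a
  well-order.\<close>

lemma finite_if_both_well_ordered:
  assumes r: "linear_order_on B r" "wf (r - Id)" and s: "Well_order s" and A: "A \<subseteq> B" "A \<subseteq> Field s"
    and rev: "\<And>x y. x \<in> A \<Longrightarrow> y \<in> A \<Longrightarrow> (x, y) \<in> r \<longleftrightarrow> (y, x) \<in> s"
  shows "finite A"
proof (rule finite_well_order_reverse[OF r A(1)])
  fix S assume S: "S \<subseteq> A" "S \<noteq> {}"
  then obtain m where m: "m \<in> S" "\<And>y. (y, m) \<in> s - Id \<Longrightarrow> y \<notin> S"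
    by (metis wfE_min[OF well_order_onD(2)[OF s]] ex_in_conv)
  have "(x, m) \<in> r" if "x \<in> S" for x
  proof (rule ccontr)
    assume n: "(x, m) \<notin> r"
    have "x \<in> A" "m \<in> A" using that m(1) S(1) by auto
    then have "(x, m) \<in> s" "m \<noteq> x"
      using Linear_order_notD[OF well_order_onD(1)[OF s], of m x] n rev A(2) by auto
    then show False using m(2) that by auto
  qed
  then show "\<exists>m\<in>S. \<forall>x\<in>S. (x, m) \<in> r" using m(1) by blast
qed

section \<open>Ordinal sums\<close>

lemma osum_simps [simp]:
  "(Inl x, Inl y) \<in> osum r s \<longleftrightarrow> (x, y) \<in> r"
  "(Inr x', Inr y') \<in> osum r s \<longleftrightarrow> (x', y') \<in> s"
  "(Inl x, Inr y') \<in> osum r s \<longleftrightarrow> x \<in> Field r \<and> y' \<in> Field s"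
  "(Inr x', Inl y) \<notin> osum r s"
  by (auto simp: osum_def)

lemma Field_osum:
  assumes "Linear_order r" "Linear_order s"
  shows "Field (osum r s) = Inl ` Field r \<union> Inr ` Field s"
proof
  show "Field (osum r s) \<subseteq> Inl ` Field r \<union> Inr ` Field s"
    by (auto simp: osum_def Field_def)
  have "(Inl x, Inl x) \<in> osum r s" if "x \<in> Field r" for x
    using Linear_orderD(1)[OF assms(1) that] by simp
  moreover have "(Inr x, Inr x) \<in> osum r s" if "x \<in> Field s" for x
    using Linear_orderD(1)[OF assms(2) that] by simp
  ultimately show "Inl ` Field r \<union> Inr ` Field s \<subseteq> Field (osum r s)"
    by (blast intro: FieldI1)
qed

lemma Linear_order_osum:
  assumes r: "Linear_order r" and s: "Linear_order s"
  shows "Linear_order (osum r s)"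
proof (rule linear_order_onI)
  fix x y assume "(x, y) \<in> osum r s"
  then show "x \<in> Field (osum r s) \<and> y \<in> Field (osum r s)" by (auto intro: FieldI1 FieldI2)
next
  fix x assume "x \<in> Field (osum r s)"
  then show "(x, x) \<in> osum r s"
    using Linear_orderD(1)[OF r] Linear_orderD(1)[OF s] by (auto simp: Field_osum r s)
next
  fix x y z assume "(x, y) \<in> osum r s" "(y, z) \<in> osum r s"
  then show "(x, z) \<in> osum r s"
    by (cases x; cases y; cases z)
      (auto intro: FieldI1 FieldI2 Linear_orderD(2)[OF r] Linear_orderD(2)[OF s])
next
  fix x y assume "(x, y) \<in> osum r s" "(y, x) \<in> osum r s"
  then show "x = y"
    by (cases x; cases y) (auto intro: Linear_orderD(3)[OF r] Linear_orderD(3)[OF s])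
next
  fix x y assume "x \<in> Field (osum r s)" "y \<in> Field (osum r s)" "x \<noteq> y"
  then show "(x, y) \<in> osum r s \<or> (y, x) \<in> osum r s"
    by (auto simp: Field_osum r s dest: Linear_orderD(4)[OF r] Linear_orderD(4)[OF s])
qed

lemma Well_order_osum:
  assumes r: "Well_order r" and s: "Well_order s"
  shows "Well_order (osum r s)"
proof -
  have "wf (osum r s - Id)"
  proof (rule wfI_min)
    fix x :: "'a + 'b" and Q assume x: "x \<in> Q"
    show "\<exists>z\<in>Q. \<forall>y. (y, z) \<in> osum r s - Id \<longrightarrow> y \<notin> Q"
    proof (cases "\<exists>a. Inl a \<in> Q")
      case True
      then obtain a where "a \<in> {a. Inl a \<in> Q}" by blast
      then obtain z where z: "Inl z \<in> Q" "\<And>y. (y, z) \<in> r - Id \<Longrightarrow> Inl y \<notin> Q"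
        by (rule wfE_min[OF well_order_onD(2)[OF r]]) blast
      have "y \<notin> Q" if "(y, Inl z) \<in> osum r s - Id" for y
        using that z(2) by (cases y) auto
      then show ?thesis using z(1) by blast
    next
      case False
      then obtain b where "b \<in> {b. Inr b \<in> Q}" using x by (cases x) auto
      then obtain z where z: "Inr z \<in> Q" "\<And>y. (y, z) \<in> s - Id \<Longrightarrow> Inr y \<notin> Q"
        by (rule wfE_min[OF well_order_onD(2)[OF s]]) blast
      have "y \<notin> Q" if "(y, Inr z) \<in> osum r s - Id" for y
        using that z(2) False by (cases y) auto
      then show ?thesis using z(1) by blast
    qed
  qed
  then show ?thesis
    using Linear_order_osum[OF well_order_onD(1)[OF r] well_order_onD(1)[OF s]]
    unfolding well_order_on_def by blast
qed

text \<open>The bijection \<open>h\<close> onto a subset of \<open>C\<close> need not respect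
  \<open>r\<close>. Pulling \<open>s\<close> back along it gives a second well-order
  \<open>t\<close> on \<open>S\<close>, and two well-orders on one finite set are
  isomorphic.\<close>

lemma finite_order_emb:
  assumes S: "finite S" "well_order_on S r" and C: "infinite C" "well_order_on C s"
  shows "\<exists>c. emb r S s C c"
proof -
  obtain C0 where C0: "C0 \<subseteq> C" "finite C0" "card C0 = card S"
    using infinite_arbitrarily_large[OF C(1), of "card S"] by blast
  have FS: "Field r = S" "Field s = C"
    using Field_linear_order_on[OF well_order_onD(1)] S C by auto
  obtain h where h: "bij_betw h S C0" using C0 S(1) by (metis finite_same_card_bij)
  define t where "t = {(x, y). x \<in> S \<and> y \<in> S \<and> (h x, h y) \<in> s}"
  have s: "linear_order_on C s" using well_order_onD(1)[OF C(2)] .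
  have hC: "h x \<in> C" if "x \<in> S" for x using h C0 that by (auto dest: bij_betwE)
  have "linear_order_on S t"
    unfolding t_def using linear_order_pullback[OF s] h hC unfolding bij_betw_def by blast
  moreover have ht: "emb t S s C h"
    using h hC unfolding t_def emb_def bij_betw_def inj_on_def by blast
  ultimately have t: "well_order_on S t" using C(2) FS well_order_on_emb by metis
  then have "r =o t" using S finite_well_order_on_ordIso by blast
  then obtain g where "emb r (Field r) t (Field t) g"
    using ordLeq_imp_emb ordIso_iff_ordLeq by blast
  moreover have "Field t = S" using Field_linear_order_on[OF well_order_onD(1)[OF t]] .
  ultimately have "emb r S t S g" using FS by simp
  from emb_comp[OF this ht] show ?thesis by blast
qed

subsection \<open>Copies of structures and of orders\<close>

lemma tuples_2: "xs \<in> tuples A 2 \<longleftrightarrow> (\<exists>x\<in>A. \<exists>y\<in>A. xs = [x, y])"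
  unfolding tuples_def by (auto simp: numeral_2_eq_2 length_Suc_conv)

lemma Field_copies: "Field (copies \<X>) = {f ` universe \<X> | f. f \<in> self_embeddings \<X>}"
  unfolding copies_def Field_def by blast

lemma copies_iff: "(A, B) \<in> copies \<X> \<longleftrightarrow> A \<in> Field (copies \<X>) \<and> B \<in> Field (copies \<X>) \<and> A \<subseteq> B"
  unfolding Field_copies unfolding copies_def by blast

lemma Preorder_copies: "Preorder (copies \<X>)"
  by (rule PreorderI) (auto simp: copies_iff)

lemma self_embeddings_order:
  assumes r: "Linear_order r"
  shows "self_embeddings (order_struct r) = {f. emb r (Field r) r (Field r) f}"
proof (intro set_eqI iffI)
  fix f assume f: "f \<in> self_embeddings (order_struct r)"
  then have m: "(x, y) \<in> r \<and> x \<noteq> y \<longleftrightarrow> (f x, f y) \<in> r \<and> f x \<noteq> f y"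
    if "x \<in> Field r" "y \<in> Field r" for x y
  proof -
    have "[x, y] \<in> tuples (universe (order_struct r)) (arity (order_struct r) ())"
      using that by (simp add: order_struct_def tuples_2)
    then have "[x, y] \<in> interp (order_struct r) () \<longleftrightarrow> map f [x, y] \<in> interp (order_struct r) ()"
      using f unfolding self_embeddings_def by (auto simp: order_struct_def)
    then show ?thesis by (simp add: order_struct_def)
  qed
  have "f ` Field r \<subseteq> Field r" using f unfolding self_embeddings_def order_struct_def by simp
  then show "f \<in> {f. emb r (Field r) r (Field r) f}" using m unfolding emb_def by blast
next
  fix f assume "f \<in> {f. emb r (Field r) r (Field r) f}"
  then have f: "emb r (Field r) r (Field r) f" by simp
  have inj: "inj_on f (Field r)" using emb_inj_on[OF r _ f] by blast
  have "(x, y) \<in> r \<longleftrightarrow> (f x, f y) \<in> r" if "x \<in> Field r" "y \<in> Field r" for x y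
    using emb_iff[OF r _ r _ f] that by blast
  then have "[x, y] \<in> interp (order_struct r) () \<longleftrightarrow> map f [x, y] \<in> interp (order_struct r) ()"
    if "x \<in> Field r" "y \<in> Field r" for x y
    using that inj unfolding order_struct_def inj_on_def by auto
  then have "\<forall>xs\<in>tuples (Field r) 2. xs \<in> interp (order_struct r) () \<longleftrightarrow>
      map f xs \<in> interp (order_struct r) ()"
    by (metis tuples_2)
  moreover have "f ` Field r \<subseteq> Field r" using embD(1)[OF f] by blast
  ultimately show "f \<in> self_embeddings (order_struct r)"
    using inj unfolding self_embeddings_def by (simp add: order_struct_def)
qed

definition ocopies :: "'a rel \<Rightarrow> 'a set set" where
  "ocopies r = {f ` Field r | f. emb r (Field r) r (Field r) f}"

lemma Field_copies_order: "Linear_order r \<Longrightarrow> Field (copies (order_struct r)) = ocopies r"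
  unfolding Field_copies ocopies_def self_embeddings_order by (simp add: order_struct_def)

lemma ocopies_subset: "A \<in> ocopies r \<Longrightarrow> A \<subseteq> Field r"
  unfolding ocopies_def emb_def by auto

subsection \<open>Self-embeddings preserve blocks\<close>

context
  fixes W :: "'a rel" and b :: "'a \<Rightarrow> nat" and N :: nat
  assumes W: "Well_order W"
    and mono: "\<And>x y. (x, y) \<in> W \<Longrightarrow> b x \<le> b y"
    and bound: "\<And>x. x \<in> Field W \<Longrightarrow> b x < N"
    and tail: "\<And>x. x \<in> Field W \<Longrightarrow>
      \<exists>h. emb W {y \<in> Field W. b y = b x} W {y \<in> Field W. b y = b x \<and> (x, y) \<in> W} h"
    and dom: "\<And>x z. x \<in> Field W \<Longrightarrow> z \<in> Field W \<Longrightarrow> b x \<le> b z \<Longrightarrow>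
      \<exists>g. emb W {y \<in> Field W. b y = b z} W {y \<in> Field W. b y = b x} g"
begin

text \<open>By \<open>dom\<close> the later block, that of \<open>z\<close>, embeds back into the
  block of \<open>x\<close>. Composed with a bounded \<open>h\<close>, this would be a
  self-embedding of the block of \<open>z\<close> that moves \<open>z\<close> strictly down.\<close>

lemma no_bounded_emb:
  assumes xz: "x \<in> Field W" "z \<in> Field W" "b x \<le> b z"
  shows "\<not> emb W {y \<in> Field W. b y = b x} W {y \<in> Field W. b y = b z \<and> (y, z) \<in> W \<and> y \<noteq> z} h"
proof
  let ?B = "{y \<in> Field W. b y = b z}"
  assume h: "emb W {y \<in> Field W. b y = b x} W {y \<in> Field W. b y = b z \<and> (y, z) \<in> W \<and> y \<noteq> z} h"
  obtain g where g: "emb W ?B W {y \<in> Field W. b y = b x} g" using dom[OF xz] by blast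
  have hg: "emb W ?B W {y \<in> Field W. b y = b z \<and> (y, z) \<in> W \<and> y \<noteq> z} (\<lambda>y. h (g y))"
    by (rule emb_comp[OF g h])
  then have hg': "emb W ?B W ?B (\<lambda>y. h (g y))" unfolding emb_def by simp
  have "(z, h (g z)) \<in> W" by (rule emb_ge[OF W _ hg']) (use xz(2) in auto)
  moreover have "(h (g z), z) \<in> W" "h (g z) \<noteq> z" using embD(1)[OF hg, of z] xz(2) by auto
  ultimately show False using Linear_orderD(3)[OF well_order_onD(1)[OF W]] by blast
qed

lemma emb_preserves_block:
  assumes f: "emb W (Field W) W (Field W) f" and x: "x \<in> Field W"
  shows "b (f x) = b x"
proof (rule ccontr)
  note lin = well_order_onD(1)[OF W]
  assume "b (f x) \<noteq> b x"
  moreover have "b x \<le> b (f x)" using mono[OF emb_ge[OF W _ f x]] by simp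
  ultimately have less: "b x < b (f x)" by simp
  have fm: "emb W (Field W) W (Field W) (f ^^ m)" for m using f by (rule emb_funpow)
  define p where "p m = (f ^^ m) x" for m
  have pF: "p m \<in> Field W" for m unfolding p_def using embD(1)[OF fm x] .
  have step: "b (p m) \<le> b (p (Suc m))" for m
    using mono[OF emb_ge[OF W _ f pF[of m]]] unfolding p_def by simp
  \<comment> \<open>Otherwise the block numbers would increase strictly along the orbit of
    \<open>x\<close> and exceed the bound \<open>N\<close>.\<close>
  have "\<exists>m. b (p m) = b (p (Suc m))"
  proof (rule ccontr)
    assume "\<not> ?thesis"
    then have "b (p m) < b (p (Suc m))" for m using step[of m] by (simp add: le_neq_implies_less)
    then have "strict_mono (\<lambda>m. b (p m))" by (simp add: strict_mono_Suc_iff)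
    then have "N \<le> b (p N)" by (rule strict_mono_imp_increasing)
    then show False using bound[OF pF[of N]] by simp
  qed
  then obtain m where m: "b (p m) = b (p (Suc m))" by blast
  have xm: "b x \<le> b (p (Suc m))"
  proof -
    have "b (p 0) \<le> b (p (Suc m))" using step by (rule lift_Suc_mono_le) simp
    then show ?thesis by (simp add: p_def)
  qed
  let ?B = "{y \<in> Field W. b y = b x}"
  obtain h where h: "emb W ?B W {y \<in> Field W. b y = b x \<and> (x, y) \<in> W} h" using tail[OF x] by blast
  \<comment> \<open>By \<open>tail\<close>, \<open>h\<close> copies the block of \<open>x\<close>
    into its part above \<open>x\<close>. That part lies below \<open>f x\<close>, which is in a
    later block. So \<open>f ^^ m\<close> carries the copy between \<open>p m\<close> and
    \<open>p (Suc m)\<close>, hence boundedly into the block that these two points share.\<close>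
  have "emb W ?B W {y \<in> Field W. b y = b (p (Suc m)) \<and> (y, p (Suc m)) \<in> W \<and> y \<noteq> p (Suc m)}
    (\<lambda>y. (f ^^ m) (h y))"
  proof (rule embI)
    fix y assume y: "y \<in> ?B"
    have hy: "h y \<in> Field W" "b (h y) = b x" "(x, h y) \<in> W" using embD(1)[OF h y] by auto
    have fx: "f x \<in> Field W" using embD(1)[OF f x] .
    have ne: "h y \<noteq> f x" using hy(2) less by auto
    have lt: "(h y, f x) \<in> W"
      using Linear_orderD(4)[OF lin hy(1) fx ne] mono[of "f x" "h y"] hy(2) less by auto
    have Suc: "(f ^^ m) (f x) = p (Suc m)" unfolding p_def by (simp add: funpow_swap1)
    have up: "((f ^^ m) (h y), p (Suc m)) \<in> W" "(f ^^ m) (h y) \<noteq> p (Suc m)"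
      using embD(2,3)[OF fm hy(1) fx lt ne, of m] Suc by auto
    have lo: "(p m, (f ^^ m) (h y)) \<in> W"
      unfolding p_def using emb_iff[OF lin _ lin _ fm x hy(1)] hy(3) by simp
    have "b ((f ^^ m) (h y)) = b (p (Suc m))" using mono[OF lo] mono[OF up(1)] m by simp
    then show "(f ^^ m) (h y) \<in>
      {y \<in> Field W. b y = b (p (Suc m)) \<and> (y, p (Suc m)) \<in> W \<and> y \<noteq> p (Suc m)}"
      using up embD(1)[OF fm hy(1)] by simp
  next
    fix y y' assume y: "y \<in> ?B" "y' \<in> ?B" "(y, y') \<in> W" "y \<noteq> y'"
    have F: "h y \<in> Field W" "h y' \<in> Field W" using embD(1)[OF h y(1)] embD(1)[OF h y(2)] by auto
    show "((f ^^ m) (h y), (f ^^ m) (h y')) \<in> W \<and> (f ^^ m) (h y) \<noteq> (f ^^ m) (h y')"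
      using embD(2,3)[OF fm F embD(2,3)[OF h y]] by blast
  qed
  then show False using no_bounded_emb[OF x pF xm] by blast
qed

end

subsection \<open>Powers of \<open>\<omega>\<close>\<close>

lemma fin_supp_zero: "(\<lambda>_. 0) \<in> fin_supp D"
  unfolding fin_supp_def by simp

lemma fin_supp_add:
  assumes "f \<in> fin_supp D" "g \<in> fin_supp D" shows "(\<lambda>x. f x + g x) \<in> fin_supp D"
proof -
  have "{x. f x + g x \<noteq> 0} \<subseteq> {x. f x \<noteq> 0} \<union> {x. g x \<noteq> 0}" by auto
  then show ?thesis using assms finite_subset unfolding fin_supp_def by blast
qed

lemma fin_supp_single: "d \<in> D \<Longrightarrow> (\<lambda>x. if x = d then c else 0) \<in> fin_supp D"
  unfolding fin_supp_def by (auto intro: finite_subset[of _ "{d}"])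

lemma Field_omega_exp: "Field (omega_exp \<delta>) = fin_supp (Field \<delta>)"
  unfolding omega_exp_def Field_def by blast

text \<open>Without the support conditions, the strict comparison is stable under pointwise addition
  of an arbitrary function.\<close>

definition olt :: "'d rel \<Rightarrow> ('d \<Rightarrow> nat) \<Rightarrow> ('d \<Rightarrow> nat) \<Rightarrow> bool" where
  "olt \<delta> f g \<longleftrightarrow> (\<exists>x\<in>Field \<delta>. f x < g x \<and> (\<forall>y. (x, y) \<in> \<delta> \<and> y \<noteq> x \<longrightarrow> f y = g y))"

lemma olt_neq: "olt \<delta> f g \<Longrightarrow> f \<noteq> g"
  unfolding olt_def by auto

lemma omega_exp_iff:
  "(f, g) \<in> omega_exp \<delta> \<longleftrightarrow>
    f \<in> fin_supp (Field \<delta>) \<and> g \<in> fin_supp (Field \<delta>) \<and> (f = g \<or> olt \<delta> f g)"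
  unfolding omega_exp_def olt_def by simp

lemma olt_add: "olt \<delta> f g \<Longrightarrow> olt \<delta> (\<lambda>x. f x + u x) (\<lambda>x. g x + u x)"
  unfolding olt_def by fastforce

lemma finite_linear_order_max:
  assumes r: "linear_order_on A r" and S: "finite S" "S \<noteq> {}" "S \<subseteq> A"
  shows "\<exists>m\<in>S. \<forall>x\<in>S. (x, m) \<in> r"
  using S
proof (induction S rule: finite_ne_induct)
  case (singleton x)
  then show ?case using Linear_orderD(1)[OF r] by auto
next
  case (insert x S)
  then obtain m where m: "m \<in> S" "\<And>y. y \<in> S \<Longrightarrow> (y, m) \<in> r" by auto
  show ?case
  proof (cases "(x, m) \<in> r")
    case True
    then show ?thesis using m by blast
  next
    case False
    then have "(m, x) \<in> r" using Linear_order_notD(1)[OF r _ _ False] insert.prems m(1) by auto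
    then have "(y, x) \<in> r" if "y \<in> S" for y using Linear_orderD(2)[OF r m(2)[OF that]] by blast
    moreover have "(x, x) \<in> r" using Linear_orderD(1)[OF r] insert.prems by blast
    ultimately show ?thesis by blast
  qed
qed

text \<open>At the largest argument where \<open>f\<close> is nonzero the sum exceeds
  \<open>u\<close>, and beyond it the two agree. Hence adding \<open>u\<close> maps everything into
  the tail that starts at \<open>u\<close>.\<close>

lemma omega_exp_le_add:
  assumes \<delta>: "Linear_order \<delta>" and fg: "f \<in> fin_supp (Field \<delta>)" "u \<in> fin_supp (Field \<delta>)"
  shows "(u, \<lambda>x. f x + u x) \<in> omega_exp \<delta>"
proof (cases "f = (\<lambda>_. 0)")
  case False
  then have "{x. f x \<noteq> 0} \<noteq> {}" by auto
  then obtain m where m: "f m \<noteq> 0" "\<And>x. f x \<noteq> 0 \<Longrightarrow> (x, m) \<in> \<delta>" "m \<in> Field \<delta>"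
    using finite_linear_order_max[OF \<delta>, of "{x. f x \<noteq> 0}"] fg(1) unfolding fin_supp_def by blast
  have "f y = 0" if "(m, y) \<in> \<delta> \<and> y \<noteq> m" for y
    using that m(2)[of y] Linear_orderD(3)[OF \<delta>, of m y] by auto
  then have "olt \<delta> u (\<lambda>x. f x + u x)" unfolding olt_def using m by (intro bexI[of _ m]) auto
  then show ?thesis using fin_supp_add[OF fg] fg(2) unfolding omega_exp_iff by simp
qed (use fg in \<open>simp add: omega_exp_iff\<close>)

text \<open>In terms of polynomials in \<omega>, every exponent \<open>x\<close> is replaced by
  \<open>e x\<close> and the coefficients are kept.\<close>

definition push :: "'d set \<Rightarrow> ('d \<Rightarrow> 'e) \<Rightarrow> ('d \<Rightarrow> nat) \<Rightarrow> 'e \<Rightarrow> nat" where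
  "push D e g y = (if y \<in> e ` D then g (inv_into D e y) else 0)"

lemma push_apply: "inj_on e D \<Longrightarrow> x \<in> D \<Longrightarrow> push D e g (e x) = g x"
  unfolding push_def by simp

lemma push_nonzero: "push D e g y \<noteq> 0 \<Longrightarrow> \<exists>x\<in>D. y = e x"
  unfolding push_def by (auto split: if_splits)

lemma push_fin_supp:
  assumes "inj_on e D" "\<And>x. x \<in> D \<Longrightarrow> e x \<in> D'" "g \<in> fin_supp D"
  shows "push D e g \<in> fin_supp D'"
proof -
  have "{y. push D e g y \<noteq> 0} \<subseteq> e ` {x. g x \<noteq> 0}"
  proof
    fix y assume y: "y \<in> {y. push D e g y \<noteq> 0}"
    then obtain x where "x \<in> D" "y = e x" using push_nonzero[of D e g y] by blast
    then show "y \<in> e ` {x. g x \<noteq> 0}" using y push_apply[OF assms(1)] by simp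
  qed
  moreover have "finite (e ` {x. g x \<noteq> 0})" "e ` {x. g x \<noteq> 0} \<subseteq> D'"
    using assms(2,3) unfolding fin_supp_def by auto
  ultimately show ?thesis unfolding fin_supp_def using finite_subset by auto
qed

text \<open>The deciding argument \<open>x\<close> moves to \<open>e x\<close>. Arguments beyond
  \<open>e x\<close> are images of arguments beyond \<open>x\<close>, where the two functions agree,
  or lie outside the range of \<open>e\<close>, where both pushed functions vanish.\<close>

lemma olt_push:
  assumes \<delta>: "Linear_order \<delta>" "Linear_order \<delta>'" and e: "emb \<delta> (Field \<delta>) \<delta>' (Field \<delta>') e"
    and fg: "olt \<delta> f g"
  shows "olt \<delta>' (push (Field \<delta>) e f) (push (Field \<delta>) e g)"
proof -
  have inj: "inj_on e (Field \<delta>)" using emb_inj_on[OF \<delta>(1) _ e] by simp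
  obtain x where x: "x \<in> Field \<delta>" "f x < g x" "\<And>y. (x, y) \<in> \<delta> \<Longrightarrow> y \<noteq> x \<Longrightarrow> f y = g y"
    using fg unfolding olt_def by blast
  have "push (Field \<delta>) e f y = push (Field \<delta>) e g y" if y: "(e x, y) \<in> \<delta>'" "y \<noteq> e x" for y
  proof (cases "y \<in> e ` Field \<delta>")
    case True
    then obtain z where z: "z \<in> Field \<delta>" "y = e z" by blast
    then have "(x, z) \<in> \<delta>" using emb_iff[OF \<delta>(1) _ \<delta>(2) _ e x(1) z(1)] y by simp
    then show ?thesis using z y x(3)[of z] by (auto simp: push_apply[OF inj])
  qed (simp add: push_def)
  then show ?thesis
    unfolding olt_def using embD(1)[OF e x(1)] x(1,2)
    by (intro bexI[of _ "e x"]) (auto simp: push_apply[OF inj])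
qed

subsection \<open>Cantor normal forms\<close>

lemma oprod_iff:
  "((t, g), (t', g')) \<in> oprod (omega_exp \<delta>) (natLeq_on m) \<longleftrightarrow>
    t < m \<and> t' < m \<and> g \<in> fin_supp (Field \<delta>) \<and> g' \<in> fin_supp (Field \<delta>) \<and>
    (t < t' \<or> t = t' \<and> (g, g') \<in> omega_exp \<delta>)"
  unfolding oprod_def osum_family_def by (auto simp: Field_omega_exp omega_exp_iff)

lemma Field_oprod:
  "Field (oprod (omega_exp \<delta>) (natLeq_on m)) = {..<m} \<times> fin_supp (Field \<delta>)"
proof (intro set_eqI iffI)
  fix x assume "x \<in> Field (oprod (omega_exp \<delta>) (natLeq_on m))"
  then show "x \<in> {..<m} \<times> fin_supp (Field \<delta>)"
    by (cases x) (auto dest!: in_FieldD simp: oprod_iff)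
next
  fix x assume "x \<in> {..<m} \<times> fin_supp (Field \<delta>)"
  then have "(x, x) \<in> oprod (omega_exp \<delta>) (natLeq_on m)"
    by (cases x) (auto simp: oprod_iff omega_exp_iff)
  then show "x \<in> Field (oprod (omega_exp \<delta>) (natLeq_on m))" by (rule FieldI1)
qed

lemma cantor_sum_Inl_iff:
  "(Inl (i, t, g), Inl (i', t', g')) \<in> cantor_sum n \<delta> s k \<longleftrightarrow>
    i \<le> n \<and> i' \<le> n \<and> t < s i \<and> t' < s i' \<and> g \<in> fin_supp (Field (\<delta> i)) \<and>
    g' \<in> fin_supp (Field (\<delta> i')) \<and>
    (i' < i \<or> i = i' \<and> (t < t' \<or> t = t' \<and> (g, g') \<in> omega_exp (\<delta> i)))"
  unfolding cantor_sum_def osum_simps osum_family_def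
  by (auto simp: Field_oprod oprod_iff less_Suc_eq_le)

lemma cantor_sum_Inr_iff:
  "(Inr m, Inr m') \<in> cantor_sum n \<delta> s k \<longleftrightarrow> m < k \<and> m' < k \<and> m \<le> m'"
  unfolding cantor_sum_def osum_simps by auto

lemma Field_cantor_sum:
  "Field (cantor_sum n \<delta> s k) =
    {Inl (i, t, g) | i t g. i \<le> n \<and> t < s i \<and> g \<in> fin_supp (Field (\<delta> i))} \<union> {Inr m | m. m < k}"
  (is "?l = ?r")
proof (intro set_eqI iffI)
  have fam: "i \<le> n \<and> t < s i \<and> g \<in> fin_supp (Field (\<delta> i))"
    if "(i, t, g) \<in> Field (osum_family ((natLeq_on (Suc n))\<inverse>)
      (\<lambda>i. oprod (omega_exp (\<delta> i)) (natLeq_on (s i))))" for i t g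
    using in_FieldD[OF that] unfolding osum_family_def by (auto simp: Field_oprod)
  fix x assume x: "x \<in> ?l"
  then show "x \<in> ?r"
  proof (cases x)
    case (Inl a)
    obtain i t g where a: "a = (i, t, g)" by (cases a) auto
    have "a \<in> Field (osum_family ((natLeq_on (Suc n))\<inverse>)
      (\<lambda>i. oprod (omega_exp (\<delta> i)) (natLeq_on (s i))))"
      using in_FieldD[OF x] unfolding Inl cantor_sum_def osum_def by (auto intro: FieldI1 FieldI2)
    then have "i \<le> n \<and> t < s i \<and> g \<in> fin_supp (Field (\<delta> i))" unfolding a by (rule fam)
    then show ?thesis unfolding Inl a by blast
  next
    case (Inr m)
    then show ?thesis
      using in_FieldD[OF x] unfolding cantor_sum_def osum_def by (auto simp: Field_natLeq_on)
  qed
next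
  fix x assume "x \<in> ?r"
  then have "(x, x) \<in> cantor_sum n \<delta> s k"
    by (auto simp: cantor_sum_Inl_iff cantor_sum_Inr_iff omega_exp_iff)
  then show "x \<in> ?l" by (rule FieldI1)
qed

lemma cantor_sum_Inl_Inr:
  assumes "Inl a \<in> Field (cantor_sum n \<delta> s k)" "m < k"
  shows "(Inl a, Inr m) \<in> cantor_sum n \<delta> s k"
proof -
  obtain i t g where a: "a = (i, t, g)" by (cases a) auto
  have "((i, t, g), (i, t, g)) \<in> osum_family ((natLeq_on (Suc n))\<inverse>)
      (\<lambda>i. oprod (omega_exp (\<delta> i)) (natLeq_on (s i)))"
    using assms(1) unfolding a Field_cantor_sum osum_family_def
    by (auto simp: Field_oprod oprod_iff omega_exp_iff)
  then show ?thesis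
    unfolding cantor_sum_def osum_simps a using assms(2) by (auto simp: Field_natLeq_on intro: FieldI1)
qed

lemma block_code_less_iff:
  fixes a a' stride t t' :: nat
  assumes "t < stride" "t' < stride"
  shows "a * stride + t < a' * stride + t' \<longleftrightarrow> a < a' \<or> a = a' \<and> t < t'"
proof -
  have less: "c * stride + u < c' * stride + u'" if "c < c'" "u < stride" for c c' u u'
  proof -
    have "c * stride + u < Suc c * stride" using that(2) by simp
    also have "\<dots> \<le> c' * stride" using that(1) by (intro mult_le_mono1) simp
    finally show ?thesis by simp
  qed
  show ?thesis
    using less[of a a' t t'] less[of a' a t' t] assms by (cases a a' rule: linorder_cases) auto
qed

text \<open>With the isomorphism \<open>\<phi>\<close> as a parameter, the results apply to
  \<alpha>, to each order isomorphic to \<alpha> on another carrier and, with \<open>n\<close> and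
  \<open>k\<close> replaced by 0, to the leading term alone.\<close>

locale cantor_form =
  fixes W :: "'a rel" and n k :: nat and \<delta> :: "nat \<Rightarrow> 'd rel" and s :: "nat \<Rightarrow> nat"
    and \<phi> :: "nat \<times> nat \<times> ('d \<Rightarrow> nat) + nat \<Rightarrow> 'a"
  assumes W: "Well_order W"
    and \<delta>: "\<And>i. i \<le> n \<Longrightarrow> Well_order (\<delta> i)"
    and \<delta>_nonempty: "Field (\<delta> n) \<noteq> {}"
    and \<delta>_less: "\<And>i j. i < j \<Longrightarrow> j \<le> n \<Longrightarrow> \<delta> i <o \<delta> j"
    and s_pos: "\<And>i. i \<le> n \<Longrightarrow> 0 < s i"
    and \<phi>_bij: "bij_betw \<phi> (Field (cantor_sum n \<delta> s k)) (Field W)"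
    and \<phi>_iff: "\<And>x y. x \<in> Field (cantor_sum n \<delta> s k) \<Longrightarrow> y \<in> Field (cantor_sum n \<delta> s k) \<Longrightarrow>
      (x, y) \<in> cantor_sum n \<delta> s k \<longleftrightarrow> (\<phi> x, \<phi> y) \<in> W"
begin

section \<open>Coordinates and block numbers\<close>

abbreviation fs :: "nat \<Rightarrow> ('d \<Rightarrow> nat) set" where
  "fs i \<equiv> fin_supp (Field (\<delta> i))"

abbreviation \<Omega> :: "nat \<Rightarrow> ('d \<Rightarrow> nat) rel" where
  "\<Omega> i \<equiv> omega_exp (\<delta> i)"

definition p :: "nat \<Rightarrow> nat \<Rightarrow> ('d \<Rightarrow> nat) \<Rightarrow> 'a" where
  "p i t g = \<phi> (Inl (i, t, g))"

definition q :: "nat \<Rightarrow> 'a" where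
  "q m = \<phi> (Inr m)"

definition decode :: "'a \<Rightarrow> nat \<times> nat \<times> ('d \<Rightarrow> nat) + nat" where
  "decode x = inv_into (Field (cantor_sum n \<delta> s k)) \<phi> x"

definition fun_of :: "'a \<Rightarrow> 'd \<Rightarrow> nat" where
  "fun_of x = snd (snd (projl (decode x)))"

definition pos_of :: "'a \<Rightarrow> nat" where
  "pos_of x = fst (snd (projl (decode x)))"

text \<open>A positive base exceeding every position \<open>t < s i\<close>, so that block numbers
  are compared like two-digit numbers: first by exponent, then by position.\<close>

definition stride :: nat where
  "stride = Suc (\<Sum>i\<le>n. s i)"

text \<open>
  The numbering of the blocks has gaps, so some numbers belong to no block. Every element of the
  finite part \<open>k\<close> is a block of its own.
\<close>

definition block :: "'a \<Rightarrow> nat" where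
  "block x = (case decode x of Inl (i, t, g) \<Rightarrow> (n - i) * stride + t | Inr m \<Rightarrow> (n + 1) * stride + m)"

abbreviation block_of :: "'a \<Rightarrow> 'a set" where
  "block_of x \<equiv> {y \<in> Field W. block y = block x}"

lemmas lin = well_order_onD(1)[OF W]

lemma less_stride: "i \<le> n \<Longrightarrow> t < s i \<Longrightarrow> t < stride"
proof -
  assume "i \<le> n" "t < s i"
  moreover have "s i \<le> (\<Sum>i\<le>n. s i)" using \<open>i \<le> n\<close> by (intro member_le_sum) auto
  ultimately show ?thesis unfolding stride_def by simp
qed

lemma code_bound: "i \<le> n \<Longrightarrow> t < s i \<Longrightarrow> (n - i) * stride + t < (n + 1) * stride"
  using block_code_less_iff[of t stride 0 "n - i" "n + 1"] less_stride[of i t] by (simp add: stride_def)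

lemma Inl_in: "i \<le> n \<Longrightarrow> t < s i \<Longrightarrow> g \<in> fs i \<Longrightarrow> Inl (i, t, g) \<in> Field (cantor_sum n \<delta> s k)"
  unfolding Field_cantor_sum by blast

lemma Inr_in: "m < k \<Longrightarrow> Inr m \<in> Field (cantor_sum n \<delta> s k)"
  unfolding Field_cantor_sum by blast

lemma decode_\<phi>: "x \<in> Field (cantor_sum n \<delta> s k) \<Longrightarrow> decode (\<phi> x) = x"
  unfolding decode_def by (rule bij_betw_inv_into_left[OF \<phi>_bij])

lemma p_in [simp]: "i \<le> n \<Longrightarrow> t < s i \<Longrightarrow> g \<in> fs i \<Longrightarrow> p i t g \<in> Field W"
  unfolding p_def using \<phi>_bij Inl_in by (rule bij_betw_apply)

lemma q_in [simp]: "m < k \<Longrightarrow> q m \<in> Field W"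
  unfolding q_def using \<phi>_bij Inr_in by (rule bij_betw_apply)

lemma decode_p [simp]: "i \<le> n \<Longrightarrow> t < s i \<Longrightarrow> g \<in> fs i \<Longrightarrow> decode (p i t g) = Inl (i, t, g)"
  unfolding p_def by (rule decode_\<phi>[OF Inl_in])

lemma decode_q [simp]: "m < k \<Longrightarrow> decode (q m) = Inr m"
  unfolding q_def by (rule decode_\<phi>[OF Inr_in])

lemma fun_of_p [simp]: "i \<le> n \<Longrightarrow> t < s i \<Longrightarrow> g \<in> fs i \<Longrightarrow> fun_of (p i t g) = g"
  unfolding fun_of_def by simp

lemma pos_of_p [simp]: "i \<le> n \<Longrightarrow> t < s i \<Longrightarrow> g \<in> fs i \<Longrightarrow> pos_of (p i t g) = t"
  unfolding pos_of_def by simp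

lemma block_p [simp]: "i \<le> n \<Longrightarrow> t < s i \<Longrightarrow> g \<in> fs i \<Longrightarrow> block (p i t g) = (n - i) * stride + t"
  unfolding block_def by simp

lemma block_q [simp]: "m < k \<Longrightarrow> block (q m) = (n + 1) * stride + m"
  unfolding block_def by simp

lemma Field_cases [consumes 1, case_names p q]:
  assumes "x \<in> Field W"
  obtains i t g where "i \<le> n" "t < s i" "g \<in> fs i" "x = p i t g" | m where "m < k" "x = q m"
proof -
  obtain y where y: "y \<in> Field (cantor_sum n \<delta> s k)" "x = \<phi> y"
    using assms \<phi>_bij unfolding bij_betw_def by blast
  then show ?thesis using that unfolding Field_cantor_sum p_def q_def by blast
qed

lemma p_le_iff:
  assumes "i \<le> n" "t < s i" "g \<in> fs i" "i' \<le> n" "t' < s i'" "g' \<in> fs i'"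
  shows "(p i t g, p i' t' g') \<in> W \<longleftrightarrow>
    i' < i \<or> i = i' \<and> (t < t' \<or> t = t' \<and> (g, g') \<in> \<Omega> i)"
  using \<phi>_iff[OF Inl_in[OF assms(1-3)] Inl_in[OF assms(4-6)]] assms
  unfolding p_def by (auto simp: cantor_sum_Inl_iff)

lemma p_eq_iff:
  assumes "i \<le> n" "t < s i" "g \<in> fs i" "i' \<le> n" "t' < s i'" "g' \<in> fs i'"
  shows "p i t g = p i' t' g' \<longleftrightarrow> i = i' \<and> t = t' \<and> g = g'"
  using decode_p[OF assms(1-3)] decode_p[OF assms(4-6)] by (metis Inl_inject Pair_inject)

lemma p_lex_iff:
  assumes "i \<le> n" "t < s i" "g \<in> fs i" "t' < s i" "g' \<in> fs i"
  shows "(p i t g, p i t' g') \<in> W \<and> p i t g \<noteq> p i t' g' \<longleftrightarrow>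
    t < t' \<or> t = t' \<and> olt (\<delta> i) g g'"
  using p_le_iff[OF assms(1-3) assms(1,4,5)] p_eq_iff[OF assms(1-3) assms(1,4,5)]
    olt_neq[of "\<delta> i" g g'] assms(3,5)
  by (auto simp: omega_exp_iff)

lemma p_less_iff:
  assumes "i \<le> n" "t < s i" "g \<in> fs i" "g' \<in> fs i"
  shows "(p i t g, p i t g') \<in> W \<and> p i t g \<noteq> p i t g' \<longleftrightarrow> olt (\<delta> i) g g'"
  using p_lex_iff[OF assms(1-3) assms(2,4)] by simp

section \<open>Comparison of blocks\<close>

lemma block_less:
  assumes xy: "x \<in> Field W" "y \<in> Field W" and less: "block x < block y"
  shows "(x, y) \<in> W" "x \<noteq> y"
proof -
  show "x \<noteq> y" using less by auto
  show "(x, y) \<in> W"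
    using xy(1)
  proof (cases rule: Field_cases)
    case x: (p i t g)
    show ?thesis
      using xy(2)
    proof (cases rule: Field_cases)
      case y: (p i' t' g')
      have "(n - i) * stride + t < (n - i') * stride + t'" using less x y by simp
      then have "n - i < n - i' \<or> n - i = n - i' \<and> t < t'"
        using block_code_less_iff less_stride x y by metis
      then have "i' < i \<or> i = i' \<and> t < t'" using x(1) y(1) by arith
      then show ?thesis unfolding x(4) y(4) p_le_iff[OF x(1-3) y(1-3)] by blast
    next
      case y: (q m)
      have "(Inl (i, t, g), Inr m) \<in> cantor_sum n \<delta> s k"
        using Inl_in[OF x(1-3)] y(1) by (rule cantor_sum_Inl_Inr)
      then show ?thesis
        using \<phi>_iff[OF Inl_in[OF x(1-3)] Inr_in[OF y(1)]] unfolding x(4) y(2) p_def q_def by blast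
    qed
  next
    case x: (q m)
    show ?thesis
      using xy(2)
    proof (cases rule: Field_cases)
      case y: (p i' t' g')
      then show ?thesis using less x code_bound[OF y(1,2)] by simp
    next
      case y: (q m')
      then have "(Inr m, Inr m') \<in> cantor_sum n \<delta> s k" using less x by (simp add: cantor_sum_Inr_iff)
      then show ?thesis
        using \<phi>_iff[OF Inr_in[OF x(1)] Inr_in[OF y(1)]] unfolding x(2) y(2) q_def by blast
    qed
  qed
qed

lemma block_mono:
  assumes "(x, y) \<in> W" shows "block x \<le> block y"
proof (rule ccontr)
  assume a: "\<not> block x \<le> block y"
  have "x \<in> Field W" "y \<in> Field W" using assms by (auto intro: FieldI1 FieldI2)
  then have "(y, x) \<in> W" "y \<noteq> x" using block_less[of y x] a by auto
  then show False using Linear_orderD(3)[OF lin assms] by blast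
qed

lemma block_p_less_q:
  assumes "i \<le> n" "t < s i" "g \<in> fs i" "m < k"
  shows "block (p i t g) < block (q m)"
  using code_bound[OF assms(1,2)] assms by simp

lemma block_eq_p:
  assumes "i \<le> n" "t < s i" "g \<in> fs i" "y \<in> Field W" "block y = block (p i t g)"
  shows "\<exists>g'\<in>fs i. y = p i t g'"
  using assms(4)
proof (cases rule: Field_cases)
  case y: (p i' t' g')
  have "(n - i) * stride + t = (n - i') * stride + t'" using assms y by simp
  then have "n - i = n - i' \<and> t = t'"
    using block_code_less_iff[of t stride t' "n - i" "n - i'"] block_code_less_iff[of t' stride t "n - i'" "n - i"]
      less_stride[OF assms(1,2)] less_stride[OF y(1,2)]
    by (metis less_irrefl linorder_neqE_nat)
  then have "i = i'" "t = t'" using assms(1) y(1) by auto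
  then show ?thesis using y by blast
next
  case (q m)
  then show ?thesis using block_p_less_q[OF assms(1-3)] assms(5) by fastforce
qed

lemma block_eq_q:
  assumes "m < k" "y \<in> Field W" "block y = block (q m)"
  shows "y = q m"
  using assms(2)
proof (cases rule: Field_cases)
  case (p i t g)
  then show ?thesis using block_p_less_q[OF p(1-3) assms(1)] assms(3) by simp
next
  case (q m')
  then show ?thesis using assms by simp
qed

lemma block_bound:
  assumes "x \<in> Field W" shows "block x < (n + 1) * stride + k"
  using assms
proof (cases rule: Field_cases)
  case (p i t g)
  then show ?thesis using code_bound[OF p(1,2)] by simp
qed simp

lemma \<delta>_lin: "i \<le> n \<Longrightarrow> Linear_order (\<delta> i)"
  using \<delta> well_order_onD(1) by blast

text \<open>In the block of \<open>x = p i t u\<close>, pointwise addition of \<open>u\<close> is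
  increasing by \<open>olt_add\<close> and stays above \<open>x\<close> by
  \<open>omega_exp_le_add\<close>. A block in the finite part is a singleton, where the identity
  suffices.\<close>

lemma tail_emb:
  assumes "x \<in> Field W"
  shows "\<exists>h. emb W (block_of x) W {y \<in> Field W. block y = block x \<and> (x, y) \<in> W} h"
  using assms
proof (cases rule: Field_cases)
  case x: (p i t u)
  have sum: "(\<lambda>z. g z + u z) \<in> fs i" if "g \<in> fs i" for g using fin_supp_add[OF that x(3)] .
  have "emb W (block_of x) W {y \<in> Field W. block y = block x \<and> (x, y) \<in> W}
    (\<lambda>y. p i t (\<lambda>z. fun_of y z + u z))"
  proof (rule embI)
    fix y assume "y \<in> block_of x"
    then obtain g where g: "g \<in> fs i" "y = p i t g" using block_eq_p[OF x(1-3)] x(4) by auto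
    have "(x, p i t (\<lambda>z. g z + u z)) \<in> W"
      unfolding x(4) p_le_iff[OF x(1-3) x(1,2) sum[OF g(1)]]
      using omega_exp_le_add[OF \<delta>_lin[OF x(1)] g(1) x(3)] by blast
    then show "p i t (\<lambda>z. fun_of y z + u z) \<in> {y \<in> Field W. block y = block x \<and> (x, y) \<in> W}"
      using x sum[OF g(1)] g by simp
  next
    fix y y' assume y: "y \<in> block_of x" "y' \<in> block_of x"
      "(y, y') \<in> W" "y \<noteq> y'"
    obtain g where g: "g \<in> fs i" "y = p i t g" using y(1) block_eq_p[OF x(1-3)] x(4) by auto
    obtain g' where g': "g' \<in> fs i" "y' = p i t g'" using y(2) block_eq_p[OF x(1-3)] x(4) by auto
    have "olt (\<delta> i) g g'" using p_less_iff[OF x(1,2) g(1) g'(1)] y(3,4) g(2) g'(2) by blast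
    then have "olt (\<delta> i) (\<lambda>z. g z + u z) (\<lambda>z. g' z + u z)" by (rule olt_add)
    then show "(p i t (\<lambda>z. fun_of y z + u z), p i t (\<lambda>z. fun_of y' z + u z)) \<in> W \<and>
      p i t (\<lambda>z. fun_of y z + u z) \<noteq> p i t (\<lambda>z. fun_of y' z + u z)"
      using p_less_iff[OF x(1,2) sum[OF g(1)] sum[OF g'(1)]] g g' x(1,2) by simp
  qed
  then show ?thesis by blast
next
  case x: (q m)
  have "block_of x = {x}" using block_eq_q[OF x(1)] assms x(2) by auto
  then have "emb W (block_of x) W {y \<in> Field W. block y = block x \<and> (x, y) \<in> W} id"
    using Linear_orderD(1)[OF lin assms] assms unfolding emb_def by simp
  then show ?thesis by blast
qed

text \<open>Later blocks have smaller or equal exponents. An embedding of the exponents induces one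
  of the blocks by \<open>push\<close>, and a singleton block can be sent to
  \<open>x\<close>.\<close>

lemma later_block_emb:
  assumes "x \<in> Field W" "z \<in> Field W" "block x \<le> block z"
  shows "\<exists>g. emb W (block_of z) W (block_of x) g"
  using assms(2)
proof (cases rule: Field_cases)
  case z: (q m)
  have "block_of z = {z}" using block_eq_q[OF z(1)] assms(2) z(2) by auto
  then have "emb W (block_of z) W (block_of x) (\<lambda>_. x)"
    using assms(1) unfolding emb_def by simp
  then show ?thesis by blast
next
  case z: (p j u v)
  show ?thesis
    using assms(1)
  proof (cases rule: Field_cases)
    case (q m)
    then show ?thesis using block_p_less_q[OF z(1-3) q(1)] assms(3) z(4) by simp
  next
    case x: (p i t g0)
    have "\<not> (n - j) * stride + u < (n - i) * stride + t" using assms(3) x z by simp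
    then have "\<not> n - j < n - i"
      using block_code_less_iff[OF less_stride[OF z(1,2)] less_stride[OF x(1,2)]] by blast
    then have ji: "j \<le> i" using x(1) z(1) by arith
    have "\<delta> j \<le>o \<delta> i"
      using \<delta>_less[of j i] ji x(1) ordLeq_reflexive[OF \<delta>] ordLess_imp_ordLeq by (cases "j = i") auto
    then obtain e where e: "emb (\<delta> j) (Field (\<delta> j)) (\<delta> i) (Field (\<delta> i)) e"
      using ordLeq_imp_emb by blast
    have inj: "inj_on e (Field (\<delta> j))" using emb_inj_on[OF \<delta>_lin[OF z(1)] _ e] by simp
    define P where "P g = push (Field (\<delta> j)) e g" for g
    have P: "P g \<in> fs i" if "g \<in> fs j" for g
      unfolding P_def by (rule push_fin_supp[OF inj embD(1)[OF e] that])
    have "emb W (block_of z) W (block_of x) (\<lambda>y. p i t (P (fun_of y)))"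
    proof (rule embI)
      fix y assume "y \<in> block_of z"
      then obtain g where g: "g \<in> fs j" "y = p j u g" using block_eq_p[OF z(1-3)] z(4) by auto
      then show "p i t (P (fun_of y)) \<in> block_of x"
        using P[OF g(1)] x z(1,2) by simp
    next
      fix y y' assume y: "y \<in> block_of z" "y' \<in> block_of z"
        "(y, y') \<in> W" "y \<noteq> y'"
      obtain g where g: "g \<in> fs j" "y = p j u g" using y(1) block_eq_p[OF z(1-3)] z(4) by auto
      obtain g' where g': "g' \<in> fs j" "y' = p j u g'" using y(2) block_eq_p[OF z(1-3)] z(4) by auto
      have "olt (\<delta> j) g g'" using p_less_iff[OF z(1,2) g(1) g'(1)] y(3,4) g(2) g'(2) by blast
      then have "olt (\<delta> i) (P g) (P g')"
        unfolding P_def by (rule olt_push[OF \<delta>_lin[OF z(1)] \<delta>_lin[OF x(1)] e])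
      then show "(p i t (P (fun_of y)), p i t (P (fun_of y'))) \<in> W \<and>
          p i t (P (fun_of y)) \<noteq> p i t (P (fun_of y'))"
        using p_less_iff[OF x(1,2) P[OF g(1)] P[OF g'(1)]] g g' z(1,2) by simp
    qed
    then show ?thesis by blast
  qed
qed

lemma emb_block:
  assumes "emb W (Field W) W (Field W) f" "x \<in> Field W"
  shows "block (f x) = block x"
  using W block_mono block_bound tail_emb later_block_emb assms by (rule emb_preserves_block)


text \<open>Linearity is inherited: the order is the pullback of \<open>W\<close> along its first
  block with exponent \<open>\<delta> i\<close>, which exists because \<open>s i\<close> is
  positive.\<close>

lemma linear_omega_exp:
  assumes i: "i \<le> n" shows "linear_order_on (fs i) (\<Omega> i)"
proof -
  have "\<Omega> i = {(g, g'). g \<in> fs i \<and> g' \<in> fs i \<and> (p i 0 g, p i 0 g') \<in> W}"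
    using p_le_iff[OF i s_pos[OF i] _ i s_pos[OF i]] by (auto simp: omega_exp_iff)
  moreover have "inj_on (p i 0) (fs i)"
    using p_eq_iff[OF i s_pos[OF i] _ i s_pos[OF i]] by (auto intro: inj_onI)
  ultimately show ?thesis
    using linear_order_pullback[OF lin, of "p i 0" "fs i"] i s_pos[OF i] by simp
qed

lemma Linear_omega_exp: "i \<le> n \<Longrightarrow> Linear_order (\<Omega> i)"
  using linear_omega_exp by (simp add: Field_omega_exp)

lemma Well_omega_exp:
  assumes i: "i \<le> n" shows "Well_order (\<Omega> i)"
proof -
  have "emb (\<Omega> i) (Field (\<Omega> i)) W (Field W) (p i 0)"
    by (rule embI) (use i s_pos[OF i] p_less_iff in \<open>auto simp: Field_omega_exp omega_exp_iff\<close>)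
  then show ?thesis by (rule well_order_on_emb[OF Linear_omega_exp[OF i] W])
qed

subsection \<open>Copies of a Cantor normal form\<close>

definition slice :: "nat \<Rightarrow> nat \<Rightarrow> 'a set \<Rightarrow> ('d \<Rightarrow> nat) set" where
  "slice i t A = {g \<in> fs i. p i t g \<in> A}"

text \<open>Since self-embeddings preserve blocks, they restrict to each power of \<omega> and fix
  every singleton block. Thus the finite part is contained in every copy and contributes no factor
  to the product.\<close>

lemma ocopies_slices:
  assumes A: "A \<in> ocopies W"
  shows "m < k \<Longrightarrow> q m \<in> A"
    and "i \<le> n \<Longrightarrow> t < s i \<Longrightarrow> slice i t A \<in> ocopies (\<Omega> i)"
proof -
  obtain f where f: "emb W (Field W) W (Field W) f" and Af: "A = f ` Field W"
    using A unfolding ocopies_def by blast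
  show "q m \<in> A" if m: "m < k"
  proof -
    have "f (q m) = q m"
      by (rule block_eq_q[OF m]) (use embD(1)[OF f] emb_block[OF f] m in auto)
    then show ?thesis unfolding Af using q_in[OF m] by (metis imageI)
  qed
  show "slice i t A \<in> ocopies (\<Omega> i)" if it: "i \<le> n" "t < s i"
  proof -
    define f' where "f' g = fun_of (f (p i t g))" for g
    have f': "f' g \<in> fs i \<and> f (p i t g) = p i t (f' g)" if g: "g \<in> fs i" for g
    proof -
      have pF: "p i t g \<in> Field W" using it g by simp
      obtain g' where "g' \<in> fs i" "f (p i t g) = p i t g'"
        using block_eq_p[OF it g embD(1)[OF f pF] emb_block[OF f pF]] by blast
      then show ?thesis unfolding f'_def using it by simp
    qed
    have "emb (\<Omega> i) (fs i) (\<Omega> i) (fs i) f'"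
    proof (rule embI)
      fix g g' assume g: "g \<in> fs i" "g' \<in> fs i" "(g, g') \<in> \<Omega> i" "g \<noteq> g'"
      then have "olt (\<delta> i) g g'" by (simp add: omega_exp_iff)
      then have lt: "(p i t g, p i t g') \<in> W" "p i t g \<noteq> p i t g'"
        using p_less_iff[OF it g(1,2)] by auto
      have "(f (p i t g), f (p i t g')) \<in> W" "f (p i t g) \<noteq> f (p i t g')"
        using embD(2,3)[OF f _ _ lt] it g(1,2) by auto
      then have "olt (\<delta> i) (f' g) (f' g')"
        using p_less_iff[OF it, of "f' g" "f' g'"] f'[OF g(1)] f'[OF g(2)] by auto
      then show "(f' g, f' g') \<in> \<Omega> i \<and> f' g \<noteq> f' g'"
        using f'[OF g(1)] f'[OF g(2)] olt_neq unfolding omega_exp_iff by blast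
    qed (use f' in blast)
    moreover have "slice i t A = f' ` fs i"
    proof (intro set_eqI iffI)
      fix g assume "g \<in> slice i t A"
      then obtain x where x: "g \<in> fs i" "x \<in> Field W" "p i t g = f x"
        unfolding slice_def Af by blast
      then obtain g0 where "g0 \<in> fs i" "x = p i t g0"
        using block_eq_p[OF it x(1,2)] emb_block[OF f x(2)] by auto
      then have "g = f' g0" using x(3) f'[of g0] p_eq_iff[OF it x(1) it, of "f' g0"] by auto
      then show "g \<in> f' ` fs i" using \<open>g0 \<in> fs i\<close> by blast
    next
      fix g assume "g \<in> f' ` fs i"
      then obtain g0 where g0: "g0 \<in> fs i" "g = f' g0" by blast
      have "f (p i t g0) \<in> A" unfolding Af using it g0(1) by simp
      then show "g \<in> slice i t A" unfolding slice_def using f'[OF g0(1)] g0(2) by simp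
    qed
    ultimately show ?thesis unfolding ocopies_def Field_omega_exp by blast
  qed
qed

text \<open>Embeddings of the individual blocks can be chosen independently, because points of
  different blocks are compared by their block numbers only.\<close>

lemma ocopiesI:
  assumes A: "A \<subseteq> Field W" and q: "\<And>m. m < k \<Longrightarrow> q m \<in> A"
    and slices: "\<And>i t. i \<le> n \<Longrightarrow> t < s i \<Longrightarrow> slice i t A \<in> ocopies (\<Omega> i)"
  shows "A \<in> ocopies W"
proof -
  have "\<exists>F. i \<le> n \<longrightarrow> t < s i \<longrightarrow> emb (\<Omega> i) (fs i) (\<Omega> i) (fs i) F \<and>
    slice i t A = F ` fs i" for i t
    using slices[of i t] unfolding ocopies_def Field_omega_exp by blast
  then obtain F where F: "\<And>i t. i \<le> n \<Longrightarrow> t < s i \<Longrightarrow>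
      emb (\<Omega> i) (fs i) (\<Omega> i) (fs i) (F i t)"
    and slice_F: "\<And>i t. i \<le> n \<Longrightarrow> t < s i \<Longrightarrow> slice i t A = F i t ` fs i"
    by metis
  define f where "f x = (case decode x of Inl (i, t, g) \<Rightarrow> p i t (F i t g) | Inr m \<Rightarrow> q m)" for x
  have f_p: "f (p i t g) = p i t (F i t g)" if "i \<le> n" "t < s i" "g \<in> fs i" for i t g
    unfolding f_def using that by simp
  have f_q: "f (q m) = q m" if "m < k" for m unfolding f_def using that by simp
  have F_in: "F i t g \<in> fs i" if "i \<le> n" "t < s i" "g \<in> fs i" for i t g
    using embD(1)[OF F] that by blast
  have f_block: "f x \<in> Field W \<and> block (f x) = block x" if "x \<in> Field W" for x
    using that by (cases rule: Field_cases) (simp_all add: f_p f_q F_in)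
  have "emb W (Field W) W (Field W) f"
  proof (rule embI)
    fix x y assume xy: "x \<in> Field W" "y \<in> Field W" "(x, y) \<in> W" "x \<noteq> y"
    show "(f x, f y) \<in> W \<and> f x \<noteq> f y"
    proof (cases "block x = block y")
      case False
      then have "block (f x) < block (f y)" using block_mono[OF xy(3)] f_block xy(1,2) by simp
      then show ?thesis using block_less[of "f x" "f y"] f_block xy(1,2) by blast
    next
      case True
      show ?thesis
        using xy(1)
      proof (cases rule: Field_cases)
        case x: (p i t g)
        obtain g' where g': "g' \<in> fs i" "y = p i t g'"
          using block_eq_p[OF x(1-3) xy(2)] True x(4) by auto
        have "olt (\<delta> i) g g'" using p_less_iff[OF x(1-3) g'(1)] xy(3,4) x(4) g'(2) by blast
        then have "(g, g') \<in> \<Omega> i" "g \<noteq> g'"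
          using x(3) g'(1) olt_neq by (auto simp: omega_exp_iff)
        then have "olt (\<delta> i) (F i t g) (F i t g')"
          using embD(2,3)[OF F[OF x(1,2)] x(3) g'(1)] by (auto simp: omega_exp_iff)
        then show ?thesis
          using p_less_iff[OF x(1,2) F_in[OF x(1-3)] F_in[OF x(1,2) g'(1)]] x g' f_p by simp
      next
        case x: (q m)
        then have "y = x" using block_eq_q[OF x(1) xy(2)] True by simp
        then show ?thesis using xy(4) by simp
      qed
    qed
  qed (use f_block in blast)
  moreover have "f ` Field W = A"
  proof (intro set_eqI iffI)
    fix y assume "y \<in> f ` Field W"
    then obtain x where x: "x \<in> Field W" "y = f x" by blast
    from x(1) show "y \<in> A"
    proof (cases rule: Field_cases)
      case (p i t g)
      then have "F i t g \<in> slice i t A" using slice_F by blast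
      then show ?thesis unfolding slice_def using x(2) p f_p by simp
    next
      case (q m)
      then show ?thesis using assms(2) x(2) f_q by simp
    qed
  next
    fix y assume y: "y \<in> A"
    then have yF: "y \<in> Field W" using A by blast
    then show "y \<in> f ` Field W"
    proof (cases rule: Field_cases)
      case (p i t g)
      then have "g \<in> slice i t A" unfolding slice_def using y by simp
      then obtain g0 where "g0 \<in> fs i" "g = F i t g0" using slice_F p by blast
      then have "y = f (p i t g0)" using p f_p by simp
      then show ?thesis using \<open>g0 \<in> fs i\<close> p by simp
    next
      case (q m)
      then have "y = f y" using f_q by simp
      then show ?thesis using yF by blast
    qed
  qed
  ultimately show ?thesis unfolding ocopies_def by blast
qed

lemma subset_iff_slices:
  assumes A: "A \<in> ocopies W" and B: "B \<in> ocopies W"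
  shows "A \<subseteq> B \<longleftrightarrow> (\<forall>i\<in>{0..n}. \<forall>t\<in>{..<s i}. slice i t A \<subseteq> slice i t B)"
proof
  assume sl: "\<forall>i\<in>{0..n}. \<forall>t\<in>{..<s i}. slice i t A \<subseteq> slice i t B"
  show "A \<subseteq> B"
  proof
    fix x assume x: "x \<in> A"
    then have "x \<in> Field W" using ocopies_subset[OF A] by blast
    then show "x \<in> B"
    proof (cases rule: Field_cases)
      case (p i t g)
      then have "g \<in> slice i t A" unfolding slice_def using x by simp
      then have "g \<in> slice i t B" using sl p(1,2) by fastforce
      then show ?thesis unfolding slice_def p(4) by simp
    next
      case (q m)
      then show ?thesis using ocopies_slices(1)[OF B] by simp
    qed
  qed
qed (auto simp: slice_def)

definition slices :: "'a set \<Rightarrow> nat \<Rightarrow> nat \<Rightarrow> ('d \<Rightarrow> nat) set" where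
  "slices A = (\<lambda>i\<in>{0..n}. \<lambda>t\<in>{..<s i}. slice i t A)"

lemma slices_bij:
  "bij_betw slices (ocopies W) (\<Pi>\<^sub>E i\<in>{0..n}. \<Pi>\<^sub>E t\<in>{..<s i}. ocopies (\<Omega> i))"
  (is "bij_betw _ _ ?Q")
proof (rule bij_betw_imageI)
  show "inj_on slices (ocopies W)"
  proof (rule inj_onI)
    fix A B assume AB: "A \<in> ocopies W" "B \<in> ocopies W" "slices A = slices B"
    have "slice i t A = slice i t B" if "i \<in> {0..n}" "t \<in> {..<s i}" for i t
    proof -
      have "slices A i t = slices B i t" using AB(3) by simp
      then show ?thesis using that unfolding slices_def by simp
    qed
    then show "A = B" using subset_iff_slices AB(1,2) by blast
  qed
  show "slices ` ocopies W = ?Q"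
  proof
    show "slices ` ocopies W \<subseteq> ?Q"
      using ocopies_slices(2) unfolding slices_def by (auto simp: PiE_iff)
    show "?Q \<subseteq> slices ` ocopies W"
    proof
      fix c assume c: "c \<in> ?Q"
      have c1: "c i t \<in> ocopies (\<Omega> i)" if "i \<le> n" "t < s i" for i t
        using c that by (simp add: PiE_iff)
      have c2: "c i t \<subseteq> fs i" if "i \<le> n" "t < s i" for i t
        using ocopies_subset[OF c1[OF that]] by (simp add: Field_omega_exp)
      \<comment> \<open>The finite part is added in full, as it belongs to every copy.\<close>
      define A where "A = {p i t g | i t g. i \<le> n \<and> t < s i \<and> g \<in> c i t} \<union> {q m | m. m < k}"
      have sl: "slice i t A = c i t" if it: "i \<le> n" "t < s i" for i t
      proof (intro set_eqI iffI)
        fix g assume "g \<in> slice i t A"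
        then have g: "g \<in> fs i" "p i t g \<in> A" unfolding slice_def by auto
        then consider i' t' g' where "i' \<le> n" "t' < s i'" "g' \<in> c i' t'" "p i t g = p i' t' g'"
          | m where "m < k" "p i t g = q m"
          unfolding A_def by blast
        then show "g \<in> c i t"
        proof cases
          case 1
          then show ?thesis using p_eq_iff[OF it g(1), of i' t' g'] c2 by blast
        next
          case 2
          then show ?thesis using block_p_less_q[OF it g(1)] by fastforce
        qed
      next
        fix g assume "g \<in> c i t"
        then show "g \<in> slice i t A" unfolding slice_def A_def using it c2 by blast
      qed
      have "A \<in> ocopies W"
      proof (rule ocopiesI)
        show "A \<subseteq> Field W" unfolding A_def using c2 p_in q_in by blast
      qed (use sl c1 in \<open>auto simp: A_def\<close>)
      moreover have "slices A = c"
      proof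
        fix i show "slices A i = c i"
        proof (cases "i \<in> {0..n}")
          case True
          show ?thesis
          proof
            fix t show "slices A i t = c i t"
            proof (cases "t < s i")
              case False
              have "c i \<in> extensional {..<s i}" using c True by (auto simp: PiE_iff)
              then show ?thesis using True False unfolding slices_def by (simp add: extensional_def)
            qed (use True sl in \<open>simp add: slices_def\<close>)
          qed
        next
          case False
          then show ?thesis using c unfolding slices_def by (auto simp: PiE_iff extensional_def)
        qed
      qed
      ultimately show "c \<in> slices ` ocopies W" by blast
    qed
  qed
qed

lemma Field_prod_copies:
  "Field (poset_prod {0..n} (\<lambda>i. poset_power (copies (order_struct (\<Omega> i))) (s i))) =
    (\<Pi>\<^sub>E i\<in>{0..n}. \<Pi>\<^sub>E t\<in>{..<s i}. ocopies (\<Omega> i))"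
proof -
  have "Field (poset_power (copies (order_struct (\<Omega> i))) (s i)) =
      (\<Pi>\<^sub>E t\<in>{..<s i}. ocopies (\<Omega> i))" if "i \<in> {0..n}" for i
    using that by (simp add: Field_poset_power[OF Preorder_copies] Field_copies_order Linear_omega_exp)
  then have "(\<Pi>\<^sub>E i\<in>{0..n}. Field (poset_power (copies (order_struct (\<Omega> i))) (s i))) =
      (\<Pi>\<^sub>E i\<in>{0..n}. \<Pi>\<^sub>E t\<in>{..<s i}. ocopies (\<Omega> i))"
    by (rule PiE_cong)
  then show ?thesis
    by (subst Field_poset_prod) (auto intro!: Preorder_poset_power Preorder_copies)
qed

lemma copies_iso:
  "copies (order_struct W) \<cong>\<^sub>p
    poset_prod {0..n} (\<lambda>i. poset_power (copies (order_struct (\<Omega> i))) (s i))"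
  (is "_ \<cong>\<^sub>p ?Q")
proof (rule poset_isoI[of slices])
  show bij: "bij_betw slices (Field (copies (order_struct W))) (Field ?Q)"
    unfolding Field_copies_order[OF lin] Field_prod_copies by (rule slices_bij)
  fix A B assume "A \<in> Field (copies (order_struct W))" "B \<in> Field (copies (order_struct W))"
  then have AB: "A \<in> ocopies W" "B \<in> ocopies W" by (simp_all add: Field_copies_order[OF lin])
  have power: "(slices A i, slices B i) \<in> poset_power (copies (order_struct (\<Omega> i))) (s i)
      \<longleftrightarrow> (\<forall>t\<in>{..<s i}. slice i t A \<subseteq> slice i t B)" if i: "i \<in> {0..n}" for i
  proof -
    have in_copies: "slice i t C \<in> Field (copies (order_struct (\<Omega> i)))"
      if "C \<in> ocopies W" "t < s i" for C t
      using that i ocopies_slices(2) by (simp add: Field_copies_order Linear_omega_exp)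
    then have "slices C i \<in> (\<Pi>\<^sub>E t\<in>{..<s i}. Field (copies (order_struct (\<Omega> i))))"
      if "C \<in> ocopies W" for C
      using that i unfolding slices_def by (simp add: PiE_iff)
    then have "(slices A i, slices B i) \<in> poset_power (copies (order_struct (\<Omega> i))) (s i) \<longleftrightarrow>
        (\<forall>t\<in>{..<s i}. (slices A i t, slices B i t) \<in> copies (order_struct (\<Omega> i)))"
      using AB unfolding poset_power_def poset_prod_def by simp
    also have "\<dots> \<longleftrightarrow> (\<forall>t\<in>{..<s i}. slice i t A \<subseteq> slice i t B)"
      using i in_copies AB unfolding slices_def by (simp add: copies_iff)
    finally show ?thesis .
  qed
  have "slices A \<in> Field ?Q" "slices B \<in> Field ?Q"
    unfolding Field_prod_copies using bij_betw_apply[OF slices_bij] AB by blast+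
  then have "(slices A, slices B) \<in> ?Q \<longleftrightarrow> (\<forall>i\<in>{0..n}. (slices A i, slices B i) \<in>
      poset_power (copies (order_struct (\<Omega> i))) (s i))"
    by (simp add: poset_prod_iff Preorder_poset_power Preorder_copies)
  also have "\<dots> \<longleftrightarrow> A \<subseteq> B" using power subset_iff_slices[OF AB] by simp
  finally show "(A, B) \<in> copies (order_struct W) \<longleftrightarrow> (slices A, slices B) \<in> ?Q"
    using AB by (simp add: copies_iff Field_copies_order[OF lin])
qed

theorem sq_copies_iso:
  "sq (copies (order_struct W)) \<cong>\<^sub>p
    poset_prod {0..n} (\<lambda>i. poset_power (sq (copies (order_struct (\<Omega> i)))) (s i))"
proof -
  note pre = Preorder_copies Preorder_poset_power Preorder_poset_prod Partial_order_sq(1)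
  have "sq (copies (order_struct W)) \<cong>\<^sub>p
      sq (poset_prod {0..n} (\<lambda>i. poset_power (copies (order_struct (\<Omega> i))) (s i)))"
    by (intro sq_cong copies_iso pre)
  also have "\<dots> \<cong>\<^sub>p
      poset_prod {0..n} (\<lambda>i. sq (poset_power (copies (order_struct (\<Omega> i))) (s i)))"
    by (intro sq_poset_prod pre)
  also have "\<dots> \<cong>\<^sub>p
      poset_prod {0..n} (\<lambda>i. poset_power (sq (copies (order_struct (\<Omega> i)))) (s i))"
  proof (intro poset_prod_cong pre)
    show "sq (poset_power (copies (order_struct (\<Omega> i))) (s i)) \<cong>\<^sub>p
      poset_power (sq (copies (order_struct (\<Omega> i)))) (s i)" for i
      unfolding poset_power_def by (intro sq_poset_prod pre)
  qed
  finally show ?thesis .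
qed


subsection \<open>The leading term\<close>

text \<open>The initial segment of type \<open>\<omega>^(\<delta> n) * s n\<close>. Its blocks have
  first digit \<open>n - n = 0\<close>, which is why block numbers below \<open>stride\<close>
  characterise it.\<close>

definition M :: "'a set" where
  "M = {p n t g | t g. t < s n \<and> g \<in> fs n}"

lemma MI: "t < s n \<Longrightarrow> g \<in> fs n \<Longrightarrow> p n t g \<in> M"
  unfolding M_def by blast

lemma M_cases:
  assumes "x \<in> M" obtains t g where "t < s n" "g \<in> fs n" "x = p n t g"
  using assms unfolding M_def by blast

lemma M_subset: "M \<subseteq> Field W"
  unfolding M_def using p_in by blast

lemma M_iff_block:
  assumes "x \<in> Field W" shows "x \<in> M \<longleftrightarrow> block x < stride"
proof
  assume "x \<in> M"
  then show "block x < stride" by (rule M_cases) (use less_stride[OF order_refl] in simp)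
next
  assume less: "block x < stride"
  show "x \<in> M"
    using assms
  proof (cases rule: Field_cases)
    case (p i t g)
    have "n - i = 0" using less p by (cases "n - i") auto
    then have "i = n" using p(1) by simp
    then show ?thesis using p MI by simp
  next
    case (q m)
    then show ?thesis using less by simp
  qed
qed

lemma M_less:
  assumes "x \<in> M" "y \<in> Field W - M" shows "(x, y) \<in> W" "x \<noteq> y"
proof -
  have "x \<in> Field W" "y \<in> Field W" using assms M_subset by auto
  moreover have "block x < block y" using assms M_iff_block calculation by fastforce
  ultimately show "(x, y) \<in> W" "x \<noteq> y" using block_less by auto
qed

lemma M_down:
  assumes "(x, y) \<in> W" "y \<in> M" shows "x \<in> M"
proof (rule ccontr)
  assume "x \<notin> M"
  then have "x \<in> Field W - M" using FieldI1[OF assms(1)] by blast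
  then show False using M_less[OF assms(2)] Linear_orderD(3)[OF lin assms(1)] by blast
qed

text \<open>If \<open>n\<close> is the successor of \<open>n'\<close>, then
  \<open>\<delta> n'\<close> is the largest of the smaller exponents, and its isomorphic copy as a
  proper initial segment of \<open>\<delta> n\<close> provides one \<open>d\<close> for all of them.
  If \<open>n = 0\<close>, any element of \<open>\<delta> n\<close> will do.\<close>

lemma uniform_exponent_bound:
  obtains d e where "d \<in> Field (\<delta> n)"
    "\<And>i. i < n \<Longrightarrow> emb (\<delta> i) (Field (\<delta> i)) (\<delta> n) (underS (\<delta> n) d) (e i)"
proof (cases n)
  case 0
  then show ?thesis using that \<delta>_nonempty by blast
next
  case (Suc n')
  have "\<delta> n' <o \<delta> n" using \<delta>_less Suc by simp
  then obtain d where d: "d \<in> Field (\<delta> n)" "\<delta> n' =o Restr (\<delta> n) (underS (\<delta> n) d)"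
    using ordLess_iff_ordIso_Restr[OF \<delta> \<delta>, of n n'] Suc by auto
  have "\<exists>f. emb (\<delta> i) (Field (\<delta> i)) (\<delta> n) (underS (\<delta> n) d) f" if i: "i < n" for i
  proof -
    have "\<delta> i \<le>o \<delta> n'"
      using \<delta>_less[of i n'] i Suc ordLeq_reflexive[OF \<delta>, of i] ordLess_imp_ordLeq
      by (cases "i = n'") auto
    then have "\<delta> i \<le>o Restr (\<delta> n) (underS (\<delta> n) d)" using d(2) by (rule ordLeq_ordIso_trans)
    then obtain f where f: "emb (\<delta> i) (Field (\<delta> i)) (Restr (\<delta> n) (underS (\<delta> n) d))
        (Field (Restr (\<delta> n) (underS (\<delta> n) d))) f"
      using ordLeq_imp_emb by blast
    have "emb (\<delta> i) (Field (\<delta> i)) (\<delta> n) (underS (\<delta> n) d) f"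
    proof (rule embI)
      fix x assume "x \<in> Field (\<delta> i)"
      then show "f x \<in> underS (\<delta> n) d" using in_FieldD[OF embD(1)[OF f]] by blast
    next
      fix x y assume xy: "x \<in> Field (\<delta> i)" "y \<in> Field (\<delta> i)" "(x, y) \<in> \<delta> i" "x \<noteq> y"
      show "(f x, f y) \<in> \<delta> n \<and> f x \<noteq> f y" using embD(2,3)[OF f xy] by blast
    qed
    then show ?thesis by blast
  qed
  then obtain e where "\<And>i. i < n \<Longrightarrow> emb (\<delta> i) (Field (\<delta> i)) (\<delta> n) (underS (\<delta> n) d) (e i)"
    by metis
  then show ?thesis using that d(1) by blast
qed

text \<open>
  The remainder embeds below some \<open>z < \<omega>\<^bsup>\<delta> n\<^esup>\<close>: choose \<open>d < \<delta> n\<close> above all smaller exponents,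
  map all blocks below \<open>\<omega>\<^bsup>d\<^esup>\<close>, and add \<open>\<omega>\<^bsup>d\<^esup> \<cdot> j\<close> in the \<open>j\<close>-th block.
\<close>

lemma remainder_bounded_emb:
  obtains \<rho> z where "z \<in> fs n" "emb W (Field W - M) (\<Omega> n) {f \<in> fs n. olt (\<delta> n) f z} \<rho>"
proof -
  obtain d e where d: "d \<in> Field (\<delta> n)"
    and e: "\<And>i. i < n \<Longrightarrow> emb (\<delta> i) (Field (\<delta> i)) (\<delta> n) (underS (\<delta> n) d) (e i)"
    using uniform_exponent_bound by blast
  have e': "emb (\<delta> i) (Field (\<delta> i)) (\<delta> n) (Field (\<delta> n)) (e i)" if "i < n" for i
    using e[OF that] unfolding emb_def underS_def by (auto intro: FieldI1)
  \<comment> \<open>Elements of the finite part receive the zero function: each is a block of its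
    own, so the term added by \<open>mark\<close> already separates them.\<close>
  define E where "E x = (case decode x of Inl (i, t, g) \<Rightarrow> push (Field (\<delta> i)) (e i) g
    | Inr m \<Rightarrow> (\<lambda>_. 0))" for x
  define mark where "mark c = (\<lambda>y. if y = d then c else 0)" for c :: nat
  define \<rho> where "\<rho> x = (\<lambda>y. E x y + mark (block x) y)" for x
  \<comment> \<open>The coefficient is the bound from \<open>block_bound\<close>, hence larger than
    the number of any block.\<close>
  define z where "z = mark ((n + 1) * stride + k)"
  have E_p: "E (p i t g) = push (Field (\<delta> i)) (e i) g" if "i \<le> n" "t < s i" "g \<in> fs i" for i t g
    unfolding E_def using that by simp
  have R_cases: "(\<exists>i t g. i < n \<and> t < s i \<and> g \<in> fs i \<and> x = p i t g) \<or> (\<exists>m<k. x = q m)"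
    if x: "x \<in> Field W - M" for x
  proof -
    have "x \<in> Field W" using x by blast
    then show ?thesis
    proof (cases rule: Field_cases)
      case (p i t g)
      then have "i \<noteq> n" using x MI by auto
      then show ?thesis using p by (metis le_neq_implies_less)
    qed blast
  qed
  have E: "E x \<in> fs n \<and> (\<forall>y. E x y \<noteq> 0 \<longrightarrow> y \<in> underS (\<delta> n) d)" if x: "x \<in> Field W - M" for x
    using R_cases[OF x]
  proof (elim disjE exE conjE)
    fix i t g assume p: "i < n" "t < s i" "g \<in> fs i" "x = p i t g"
    have inj: "inj_on (e i) (Field (\<delta> i))" using emb_inj_on[OF \<delta>_lin _ e[OF p(1)]] p(1) by simp
    have "push (Field (\<delta> i)) (e i) g \<in> fs n"
      by (rule push_fin_supp[OF inj embD(1)[OF e'[OF p(1)]] p(3)])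
    moreover have "y \<in> underS (\<delta> n) d" if "push (Field (\<delta> i)) (e i) g y \<noteq> 0" for y
      using push_nonzero[OF that] embD(1)[OF e[OF p(1)]] by blast
    ultimately show ?thesis using E_p[of i t g] p by simp
  next
    fix m assume "m < k" "x = q m"
    then show ?thesis unfolding E_def by (simp add: fin_supp_zero)
  qed
  have E_above: "E x y = 0" if "x \<in> Field W - M" "(d, y) \<in> \<delta> n" for x y
  proof (rule ccontr)
    assume "E x y \<noteq> 0"
    then have "(y, d) \<in> \<delta> n" "y \<noteq> d" using E[OF that(1)] unfolding underS_def by auto
    then show False using Linear_orderD(3)[OF \<delta>_lin that(2)] by simp
  qed
  have E_d: "E x d = 0" if "x \<in> Field W - M" for x
    using E_above[OF that] Linear_orderD(1)[OF \<delta>_lin d] by simp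
  have \<rho>_in: "\<rho> x \<in> fs n" if "x \<in> Field W - M" for x
    unfolding \<rho>_def mark_def using E[OF that] fin_supp_single[OF d] by (intro fin_supp_add) auto
  have z_in: "z \<in> fs n" unfolding z_def mark_def by (rule fin_supp_single[OF d])
  have "emb W (Field W - M) (\<Omega> n) {f \<in> fs n. olt (\<delta> n) f z} \<rho>"
  proof (rule embI)
    fix x assume x: "x \<in> Field W - M"
    have "olt (\<delta> n) (\<rho> x) z"
      unfolding olt_def
    proof (intro bexI[OF _ d] conjI allI impI)
      show "\<rho> x d < z d" unfolding \<rho>_def z_def mark_def using block_bound[of x] E_d[OF x] x by simp
      fix y assume "(d, y) \<in> \<delta> n \<and> y \<noteq> d"
      then show "\<rho> x y = z y" unfolding \<rho>_def z_def mark_def using E_above[OF x] by simp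
    qed
    then show "\<rho> x \<in> {f \<in> fs n. olt (\<delta> n) f z}" using \<rho>_in[OF x] by simp
  next
    fix x y assume xy: "x \<in> Field W - M" "y \<in> Field W - M" "(x, y) \<in> W" "x \<noteq> y"
    have "olt (\<delta> n) (\<rho> x) (\<rho> y)"
    proof (cases "block x = block y")
      case False
      show ?thesis
        unfolding olt_def
      proof (intro bexI[OF _ d] conjI allI impI)
        show "\<rho> x d < \<rho> y d"
          unfolding \<rho>_def mark_def using False block_mono[OF xy(3)] E_d xy(1,2) by simp
        fix u assume "(d, u) \<in> \<delta> n \<and> u \<noteq> d"
        then show "\<rho> x u = \<rho> y u" unfolding \<rho>_def mark_def using E_above xy(1,2) by simp
      qed
    next
      case True
      from R_cases[OF xy(1)] show ?thesis
      proof (elim disjE exE conjE)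
        fix i t g assume p: "i < n" "t < s i" "g \<in> fs i" "x = p i t g"
        have i: "i \<le> n" using p(1) by simp
        obtain g' where g': "g' \<in> fs i" "y = p i t g'"
          using block_eq_p[OF i p(2,3), of y] xy(2) True p(4) by auto
        have "olt (\<delta> i) g g'" using p_less_iff[OF i p(2,3) g'(1)] xy(3,4) p(4) g'(2) by blast
        then have "olt (\<delta> n) (E x) (E y)"
          using olt_push[OF \<delta>_lin[OF i] \<delta>_lin e'[OF p(1)]] E_p[OF i p(2)] p g' by simp
        then show ?thesis unfolding \<rho>_def True by (rule olt_add)
      next
        fix m assume m: "m < k" "x = q m"
        then show ?thesis using block_eq_q[OF m(1), of y] True xy by simp
      qed
    qed
    then show "(\<rho> x, \<rho> y) \<in> \<Omega> n \<and> \<rho> x \<noteq> \<rho> y"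
      using \<rho>_in xy(1,2) olt_neq unfolding omega_exp_iff by blast
  qed
  then show ?thesis using that z_in by blast
qed

text \<open>The remainder is placed below \<open>z\<close> in the first leading block, and the
  leading term makes room for it by adding \<open>z\<close> in each of its blocks. Together the two
  parts of \<theta> embed the remainder followed by \<open>M\<close> into \<open>M\<close>.\<close>

lemma remainder_absorbed:
  obtains \<theta> where "emb W (Field W - M) W M \<theta>" "emb W M W M \<theta>"
    "\<And>x y. x \<in> Field W - M \<Longrightarrow> y \<in> M \<Longrightarrow> (\<theta> x, \<theta> y) \<in> W \<and> \<theta> x \<noteq> \<theta> y"
proof -
  obtain \<rho> z where z: "z \<in> fs n"
    and \<rho>: "emb W (Field W - M) (\<Omega> n) {f \<in> fs n. olt (\<delta> n) f z} \<rho>"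
    using remainder_bounded_emb by blast
  define add where "add g = (\<lambda>y. g y + z y)" for g :: "'d \<Rightarrow> nat"
  have add: "add g \<in> fs n" if "g \<in> fs n" for g unfolding add_def using fin_supp_add[OF that z] .
  define \<theta> where "\<theta> x = (if x \<in> M then p n (pos_of x) (add (fun_of x)) else p n 0 (\<rho> x))" for x
  have \<theta>_M: "\<theta> (p n t g) = p n t (add g)" if "t < s n" "g \<in> fs n" for t g
    unfolding \<theta>_def using MI[OF that] that by simp
  have \<theta>_R: "\<theta> x = p n 0 (\<rho> x)" "\<rho> x \<in> fs n" "olt (\<delta> n) (\<rho> x) z" if "x \<in> Field W - M" for x
    unfolding \<theta>_def using that embD(1)[OF \<rho> that] by auto
  note s0 = s_pos[OF order_refl]
  show ?thesis
  proof
    show "emb W (Field W - M) W M \<theta>"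
    proof (rule embI)
      fix x y assume xy: "x \<in> Field W - M" "y \<in> Field W - M" "(x, y) \<in> W" "x \<noteq> y"
      have "olt (\<delta> n) (\<rho> x) (\<rho> y)" using embD(2,3)[OF \<rho> xy] unfolding omega_exp_iff by blast
      then show "(\<theta> x, \<theta> y) \<in> W \<and> \<theta> x \<noteq> \<theta> y"
        using p_less_iff[OF order_refl s0 \<theta>_R(2)[OF xy(1)] \<theta>_R(2)[OF xy(2)]]
          \<theta>_R(1)[OF xy(1)] \<theta>_R(1)[OF xy(2)] by simp
    qed (use \<theta>_R MI[OF s0] in simp)
    show "emb W M W M \<theta>"
    proof (rule embI)
      fix x assume "x \<in> M"
      then show "\<theta> x \<in> M" by (rule M_cases) (use \<theta>_M MI add in simp)
    next
      fix x y assume xy: "x \<in> M" "y \<in> M" "(x, y) \<in> W" "x \<noteq> y"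
      obtain t g where x: "t < s n" "g \<in> fs n" "x = p n t g" using xy(1) by (rule M_cases)
      obtain t' g' where y: "t' < s n" "g' \<in> fs n" "y = p n t' g'" using xy(2) by (rule M_cases)
      have "t < t' \<or> t = t' \<and> olt (\<delta> n) g g'"
        using xy(3,4) p_lex_iff[OF order_refl x(1,2) y(1,2)] x(3) y(3) by blast
      then have "t < t' \<or> t = t' \<and> olt (\<delta> n) (add g) (add g')"
        unfolding add_def using olt_add by blast
      then have "(p n t (add g), p n t' (add g')) \<in> W \<and> p n t (add g) \<noteq> p n t' (add g')"
        using p_lex_iff[OF order_refl x(1) add[OF x(2)] y(1) add[OF y(2)]] by blast
      then show "(\<theta> x, \<theta> y) \<in> W \<and> \<theta> x \<noteq> \<theta> y" using \<theta>_M x y by simp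
    qed
    fix x y assume xy: "x \<in> Field W - M" "y \<in> M"
    obtain t g where y: "t < s n" "g \<in> fs n" "y = p n t g" using xy(2) by (rule M_cases)
    note \<rho>x = \<theta>_R(2)[OF xy(1)]
    have less: "(p n 0 (\<rho> x), p n 0 z) \<in> W" "p n 0 (\<rho> x) \<noteq> p n 0 z"
      using p_less_iff[OF order_refl s0 \<rho>x z] \<theta>_R(3)[OF xy(1)] by auto
    have le: "(p n 0 z, p n t (add g)) \<in> W"
      using p_le_iff[OF order_refl s0 z order_refl y(1) add[OF y(2)]]
        omega_exp_le_add[OF \<delta>_lin y(2) z] unfolding add_def by auto
    have "(p n 0 (\<rho> x), p n t (add g)) \<in> W" using Linear_orderD(2)[OF lin less(1) le] .
    moreover have "p n 0 (\<rho> x) \<noteq> p n t (add g)"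
      using less le Linear_orderD(3)[OF lin less(1)] by auto
    ultimately show "(\<theta> x, \<theta> y) \<in> W \<and> \<theta> x \<noteq> \<theta> y" using \<theta>_R(1)[OF xy(1)] \<theta>_M y by simp
  qed
qed

text \<open>If \<open>f x\<close> left \<open>M\<close>, so would the images of all later points, in
  particular those of the tail above \<open>x\<close> of its block, which contains a copy of the
  whole block. Followed by the bounded embedding \<open>\<rho>\<close> of the remainder, this gives
  a self-embedding of \<open>\<Omega> n\<close> with all values below \<open>z\<close>, which
  contradicts \<open>emb_ge\<close> at \<open>z\<close>.\<close>

lemma emb_leading_term:
  assumes f: "emb W M W (Field W) f" and x: "x \<in> M"
  shows "f x \<in> M"
proof (rule ccontr)
  assume fx: "f x \<notin> M"
  obtain \<rho> z where z: "z \<in> fs n"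
    and \<rho>: "emb W (Field W - M) (\<Omega> n) {f \<in> fs n. olt (\<delta> n) f z} \<rho>"
    using remainder_bounded_emb by blast
  obtain t u where u: "t < s n" "u \<in> fs n" "x = p n t u" using x by (rule M_cases)
  define add where "add g = (\<lambda>y. g y + u y)" for g :: "'d \<Rightarrow> nat"
  have add: "add g \<in> fs n" if "g \<in> fs n" for g unfolding add_def using fin_supp_add[OF that u(2)] .
  have "emb (\<Omega> n) (fs n) W (Field W - M) (\<lambda>g. f (p n t (add g)))"
  proof (rule embI)
    fix g assume g: "g \<in> fs n"
    have pM: "p n t (add g) \<in> M" using MI[OF u(1) add[OF g]] .
    have "(x, p n t (add g)) \<in> W"
      unfolding u(3) p_le_iff[OF order_refl u(1,2) order_refl u(1) add[OF g]]
      using omega_exp_le_add[OF \<delta>_lin g u(2)] unfolding add_def by simp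
    then have "(f x, f (p n t (add g))) \<in> W"
      using emb_iff[OF lin M_subset lin _ f x pM] by simp
    then have "f (p n t (add g)) \<notin> M" using M_down fx by blast
    then show "f (p n t (add g)) \<in> Field W - M" using embD(1)[OF f pM] by simp
  next
    fix g g' assume g: "g \<in> fs n" "g' \<in> fs n" "(g, g') \<in> \<Omega> n" "g \<noteq> g'"
    then have "olt (\<delta> n) (add g) (add g')" unfolding add_def omega_exp_iff using olt_add by blast
    then have "(p n t (add g), p n t (add g')) \<in> W" "p n t (add g) \<noteq> p n t (add g')"
      using p_less_iff[OF order_refl u(1) add[OF g(1)] add[OF g(2)]] by auto
    then show "(f (p n t (add g)), f (p n t (add g'))) \<in> W \<and> f (p n t (add g)) \<noteq> f (p n t (add g'))"
      using embD(2,3)[OF f MI[OF u(1) add[OF g(1)]] MI[OF u(1) add[OF g(2)]]] by blast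
  qed
  from emb_comp[OF this \<rho>] have *: "emb (\<Omega> n) (fs n) (\<Omega> n)
    {f \<in> fs n. olt (\<delta> n) f z} (\<lambda>g. \<rho> (f (p n t (add g))))" .
  define h where "h g = \<rho> (f (p n t (add g)))" for g
  have h: "emb (\<Omega> n) (fs n) (\<Omega> n) {f \<in> fs n. olt (\<delta> n) f z} h"
    using * unfolding h_def .
  then have "emb (\<Omega> n) (fs n) (\<Omega> n) (fs n) h"
    unfolding emb_def by blast
  then have ge: "(z, h z) \<in> \<Omega> n"
    using emb_ge[OF Well_omega_exp[OF order_refl] _ _ z] by (simp add: Field_omega_exp)
  have "h z \<in> fs n" "olt (\<delta> n) (h z) z" using embD(1)[OF h z] by auto
  then have "(h z, z) \<in> \<Omega> n" "h z \<noteq> z" using z olt_neq unfolding omega_exp_iff by auto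
  then show False using Linear_orderD(3)[OF linear_omega_exp[OF order_refl] ge] by simp
qed

text \<open>
  If \<open>W = I + F\<close> and \<open>F\<close> begins inside the \<open>j\<close>-th leading block, then the leading blocks numbered
  \<open>j, \<dots>, s n - 1\<close> embed into \<open>F\<close>, and those numbered \<open>0, \<dots>, j - 1\<close> lie in \<open>I\<close>.
\<close>

lemma leading_term_emb_rotation:
  assumes IF: "Field W = I \<union> F" "I \<inter> F = {}" "I \<times> F \<subseteq> W"
  obtains h where "\<And>x. x \<in> M \<Longrightarrow> h x \<in> Field W"
    "\<And>x y. x \<in> M \<Longrightarrow> y \<in> M \<Longrightarrow> (x, y) \<in> W \<Longrightarrow> x \<noteq> y \<Longrightarrow>
      h x \<in> F \<and> h y \<in> I \<or> (h x \<in> F \<longleftrightarrow> h y \<in> F) \<and> (h x, h y) \<in> W \<and> h x \<noteq> h y"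
proof -
  \<comment> \<open>The alternative \<open>t = s n\<close> covers the case that \<open>F\<close>
    meets no leading block. Then no block is rotated and \<open>h\<close> is the identity on
    \<open>M\<close>.\<close>
  define j where "j = (LEAST t. t = s n \<or> (\<exists>g\<in>fs n. p n t g \<in> F))"
  have j: "j = s n \<or> (\<exists>g\<in>fs n. p n j g \<in> F)" unfolding j_def by (rule LeastI[of _ "s n"]) simp
  have j_le: "j \<le> s n" unfolding j_def by (rule Least_le) simp
  have below: "p n t g \<in> I" if "t < j" "g \<in> fs n" for t g
  proof -
    have "\<not> (\<exists>g\<in>fs n. p n t g \<in> F)" using not_less_Least[of t] that(1) unfolding j_def by blast
    then show ?thesis using IF(1) p_in[of n t g] that j_le by auto
  qed
  \<comment> \<open>If \<open>j = s n\<close>, there is no point of \<open>F\<close> to choose, and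
    the zero function serves as a placeholder.\<close>
  obtain u where u: "u \<in> fs n" "j < s n \<Longrightarrow> p n j u \<in> F"
    using j fin_supp_zero[of "Field (\<delta> n)"] by fastforce
  define add where "add g = (\<lambda>y. g y + u y)" for g :: "'d \<Rightarrow> nat"
  have add: "add g \<in> fs n" if "g \<in> fs n" for g unfolding add_def using fin_supp_add[OF that u(1)] .
  have above: "p n t (add g) \<in> F" if t: "j \<le> t" "t < s n" and g: "g \<in> fs n" for t g
  proof -
    have jn: "j < s n" using t by simp
    have le: "(p n j u, p n t (add g)) \<in> W"
      unfolding p_le_iff[OF order_refl jn u(1) order_refl t(2) add[OF g]]
      using omega_exp_le_add[OF \<delta>_lin g u(1)] t(1) unfolding add_def by auto
    show ?thesis
    proof (rule ccontr)
      assume "p n t (add g) \<notin> F"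
      then have I: "p n t (add g) \<in> I" using IF(1) p_in[OF order_refl t(2) add[OF g]] by blast
      then have "(p n t (add g), p n j u) \<in> W" using IF(3) u(2)[OF jn] by blast
      then have "p n j u = p n t (add g)" using Linear_orderD(3)[OF lin le] by blast
      then show False using I u(2)[OF jn] IF(2) by auto
    qed
  qed
  \<comment> \<open>The first \<open>s n - j\<close> leading blocks move to the positions from
    \<open>j\<close> on, shifted by \<open>u\<close> to lie in \<open>F\<close>; the last
    \<open>j\<close> move to the initial positions, inside \<open>I\<close>. The two properties
    claimed for \<open>h\<close> say that it is strictly increasing into the rotated order
    \<open>F + I\<close>.\<close>
  define h where "h x = (if pos_of x < s n - j then p n (j + pos_of x) (add (fun_of x))
    else p n (pos_of x - (s n - j)) (fun_of x))" for x
  have h_lo: "h (p n t g) = p n (j + t) (add g)" "h (p n t g) \<in> F"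
    if "t < s n - j" "g \<in> fs n" for t g
    unfolding h_def using that above[of "j + t" g] by auto
  have h_hi: "h (p n t g) = p n (t - (s n - j)) g" "h (p n t g) \<in> I"
    if "\<not> t < s n - j" "t < s n" "g \<in> fs n" for t g
    unfolding h_def using that below[of "t - (s n - j)" g] by auto
  have notF: "x \<notin> F" if "x \<in> I" for x using that IF(2) by blast
  show ?thesis
  proof
    fix x assume "x \<in> M"
    then obtain t g where x: "t < s n" "g \<in> fs n" "x = p n t g" by (rule M_cases)
    then show "h x \<in> Field W" using h_lo(2)[of t g] h_hi(2)[of t g] IF(1) by blast
  next
    fix x y assume xy: "x \<in> M" "y \<in> M" "(x, y) \<in> W" "x \<noteq> y"
    obtain t g where x: "t < s n" "g \<in> fs n" "x = p n t g" using xy(1) by (rule M_cases)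
    obtain t' g' where y: "t' < s n" "g' \<in> fs n" "y = p n t' g'" using xy(2) by (rule M_cases)
    have lex: "t < t' \<or> t = t' \<and> olt (\<delta> n) g g'"
      using xy(3,4) p_lex_iff[OF order_refl x(1,2) y(1,2)] x(3) y(3) by blast
    consider "t < s n - j" "t' < s n - j" | "t < s n - j" "\<not> t' < s n - j"
      | "\<not> t < s n - j" "\<not> t' < s n - j"
      using lex by fastforce
    then show "h x \<in> F \<and> h y \<in> I \<or> (h x \<in> F \<longleftrightarrow> h y \<in> F) \<and> (h x, h y) \<in> W \<and> h x \<noteq> h y"
    proof cases
      case 1
      have "j + t < j + t' \<or> j + t = j + t' \<and> olt (\<delta> n) (add g) (add g')"
        using lex olt_add unfolding add_def by auto
      then have "(h x, h y) \<in> W \<and> h x \<noteq> h y"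
        using p_lex_iff[of n "j + t" "add g" "j + t'" "add g'"] 1 add[OF x(2)] add[OF y(2)]
          h_lo(1)[OF 1(1) x(2)] h_lo(1)[OF 1(2) y(2)] x(3) y(3) by simp
      then show ?thesis using h_lo(2)[OF 1(1) x(2)] h_lo(2)[OF 1(2) y(2)] x(3) y(3) by blast
    next
      case 2
      then show ?thesis using h_lo(2)[OF 2(1) x(2)] h_hi(2)[OF 2(2) y(1,2)] x(3) y(3) by blast
    next
      case 3
      have "t - (s n - j) < t' - (s n - j) \<or> t - (s n - j) = t' - (s n - j) \<and> olt (\<delta> n) g g'"
        using lex 3 by auto
      then have "(h x, h y) \<in> W \<and> h x \<noteq> h y"
        using p_lex_iff[of n "t - (s n - j)" g "t' - (s n - j)" g'] x(1,2) y(1,2)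
          h_hi(1)[OF 3(1) x(1,2)] h_hi(1)[OF 3(2) y(1,2)] x(3) y(3) by simp
      moreover have "h x \<notin> F" "h y \<notin> F"
        using notF h_hi(2)[OF 3(1) x(1,2)] h_hi(2)[OF 3(2) y(1,2)] x(3) y(3) by auto
      ultimately show ?thesis by blast
    qed
  qed
qed

section \<open>The leading term as a normal form of its own\<close>

lemma Field_Restr_M: "Field (Restr W M) = M"
  by (rule Field_linear_order_on[OF linear_order_on_Restr[OF lin M_subset]])

text \<open>With a single exponent and no finite part, the result on copies can be reused for
  \<open>M\<close>. The value \<open>undefined\<close> is never reached because \<open>k\<close> is
  0 here.\<close>

lemma cantor_form_leading_term:
  "cantor_form (Restr W M) 0 0 (\<lambda>_. \<delta> n) (\<lambda>_. s n)
    (\<lambda>x. case x of Inl (i, t, g) \<Rightarrow> p n t g | Inr m \<Rightarrow> undefined)"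
  (is "cantor_form _ _ _ _ _ ?f")
proof
  show "Well_order (Restr W M)" using W by (rule Well_order_Restr)
  have F: "Field (cantor_sum 0 (\<lambda>_. \<delta> n) (\<lambda>_. s n) 0) = {Inl (0, t, g) | t g. t < s n \<and> g \<in> fs n}"
    unfolding Field_cantor_sum by auto
  show "bij_betw ?f (Field (cantor_sum 0 (\<lambda>_. \<delta> n) (\<lambda>_. s n) 0)) (Field (Restr W M))"
    unfolding Field_Restr_M F
  proof (rule bij_betw_imageI)
    show "inj_on ?f {Inl (0, t, g) | t g. t < s n \<and> g \<in> fs n}"
      by (rule inj_onI) (auto simp: p_eq_iff)
    show "?f ` {Inl (0, t, g) | t g. t < s n \<and> g \<in> fs n} = M"
      unfolding M_def by (force simp: image_iff)
  qed
  show "(x, y) \<in> cantor_sum 0 (\<lambda>_. \<delta> n) (\<lambda>_. s n) 0 \<longleftrightarrow> (?f x, ?f y) \<in> Restr W M"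
    if "x \<in> Field (cantor_sum 0 (\<lambda>_. \<delta> n) (\<lambda>_. s n) 0)" "y \<in> Field (cantor_sum 0 (\<lambda>_. \<delta> n) (\<lambda>_. s n) 0)"
    for x y
    using that unfolding F by (auto simp: cantor_sum_Inl_iff p_le_iff MI)
qed (use \<delta> \<delta>_nonempty s_pos in auto)

lemma sq_copies_leading_term:
  "sq (copies (order_struct (Restr W M))) \<cong>\<^sub>p
    poset_power (sq (copies (order_struct (\<Omega> n)))) (s n)"
proof -
  interpret top: cantor_form "Restr W M" 0 0 "\<lambda>_. \<delta> n" "\<lambda>_. s n"
    "\<lambda>x. case x of Inl (i, t, g) \<Rightarrow> p n t g | Inr m \<Rightarrow> undefined"
    by (rule cantor_form_leading_term)
  note top.sq_copies_iso
  also have "poset_prod {0..0::nat} (\<lambda>i. poset_power (sq (copies (order_struct (\<Omega> n)))) (s n))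
    \<cong>\<^sub>p poset_power (sq (copies (order_struct (\<Omega> n)))) (s n)"
    unfolding atLeastAtMost_singleton
    by (intro poset_prod_singleton Preorder_poset_power Partial_order_sq Preorder_copies)
  finally show ?thesis .
qed

lemma leading_term_iso: "oprod (\<Omega> n) (natLeq_on (s n)) \<cong>\<^sub>p Restr W M"
proof (rule poset_isoI[of "\<lambda>(t, g). p n t g"])
  show "bij_betw (\<lambda>(t, g). p n t g) (Field (oprod (\<Omega> n) (natLeq_on (s n)))) (Field (Restr W M))"
    unfolding Field_Restr_M Field_oprod
  proof (rule bij_betw_imageI)
    show "inj_on (\<lambda>(t, g). p n t g) ({..<s n} \<times> fs n)"
      by (rule inj_onI) (auto simp: p_eq_iff)
    show "(\<lambda>(t, g). p n t g) ` ({..<s n} \<times> fs n) = M"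
      unfolding M_def by (force simp: image_iff)
  qed
  fix x y assume "x \<in> Field (oprod (\<Omega> n) (natLeq_on (s n)))"
    "y \<in> Field (oprod (\<Omega> n) (natLeq_on (s n)))"
  then show "(x, y) \<in> oprod (\<Omega> n) (natLeq_on (s n)) \<longleftrightarrow>
      (case x of (t, g) \<Rightarrow> p n t g, case y of (t, g) \<Rightarrow> p n t g) \<in> Restr W M"
    unfolding Field_oprod by (auto simp: oprod_iff p_le_iff MI)
qed

end

subsection \<open>The least rotation\<close>

lemma (in cantor_form) min_rotation:
  "is_min_ordinal {osum \<gamma> \<beta> | (\<beta> :: 'a rel) (\<gamma> :: 'a rel).
      Well_order \<beta> \<and> Well_order \<gamma> \<and> W =o osum \<beta> \<gamma>}
    (oprod (omega_exp (\<delta> n)) (natLeq_on (s n)))"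
proof -
  let ?\<mu> = "oprod (omega_exp (\<delta> n)) (natLeq_on (s n))"
  let ?R = "Field W - M"
  define \<beta> where "\<beta> = Restr W M"
  define \<gamma> where "\<gamma> = Restr W ?R"
  have wo: "Well_order \<beta>" "Well_order \<gamma>" unfolding \<beta>_def \<gamma>_def using W by (simp_all add: Well_order_Restr)
  have F: "Field \<beta> = M" "Field \<gamma> = ?R"
    unfolding \<beta>_def \<gamma>_def using Field_linear_order_on[OF linear_order_on_Restr[OF lin]] M_subset by blast+
  note Fosum = Field_osum[OF wo(1,2)[THEN well_order_onD(1)]]
    and Fosum' = Field_osum[OF wo(2,1)[THEN well_order_onD(1)]]
  have \<mu>: "?\<mu> =o \<beta>"
    using ordIso_iff_poset_iso leading_term_iso Well_order_poset_iso wo(1) unfolding \<beta>_def by blast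
  have W_eq: "W =o osum \<beta> \<gamma>"
  proof -
    let ?f = "\<lambda>x. if x \<in> M then Inl x else Inr x"
    have "W \<cong>\<^sub>p osum \<beta> \<gamma>"
    proof (rule poset_isoI[of ?f])
      show "bij_betw ?f (Field W) (Field (osum \<beta> \<gamma>))"
        unfolding Fosum F using M_subset by (intro bij_betw_imageI inj_onI) (auto split: if_splits)
      fix x y assume xy: "x \<in> Field W" "y \<in> Field W"
      consider "x \<in> M" "y \<in> M" | "x \<in> ?R" "y \<in> ?R" | "x \<in> M" "y \<in> ?R" | "x \<in> ?R" "y \<in> M"
        using xy by blast
      then show "(x, y) \<in> W \<longleftrightarrow> (?f x, ?f y) \<in> osum \<beta> \<gamma>"
      proof cases
        case 3
        then show ?thesis using M_less(1)[OF 3] F by simp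
      next
        case 4
        then show ?thesis using M_down by auto
      qed (auto simp: \<beta>_def \<gamma>_def)
    qed
    then show ?thesis using W Well_order_osum[OF wo] ordIso_iff_poset_iso by blast
  qed
  \<comment> \<open>One inequality is the absorption of the remainder by \<open>\<theta>\<close>,
    the other is the inclusion \<open>Inr\<close> of the second summand.\<close>
  have "osum \<gamma> \<beta> =o \<beta>"
  proof -
    obtain \<theta> where \<theta>: "emb W ?R W M \<theta>" "emb W M W M \<theta>"
      "\<And>x y. x \<in> ?R \<Longrightarrow> y \<in> M \<Longrightarrow> (\<theta> x, \<theta> y) \<in> W \<and> \<theta> x \<noteq> \<theta> y"
      using remainder_absorbed by blast
    have "emb (osum \<gamma> \<beta>) (Field (osum \<gamma> \<beta>)) \<beta> (Field \<beta>) (case_sum \<theta> \<theta>)"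
    proof (rule embI)
      fix x assume "x \<in> Field (osum \<gamma> \<beta>)"
      then show "case_sum \<theta> \<theta> x \<in> Field \<beta>"
        unfolding Fosum' F using embD(1)[OF \<theta>(1)] embD(1)[OF \<theta>(2)] by auto
    next
      fix x y assume xy: "x \<in> Field (osum \<gamma> \<beta>)" "y \<in> Field (osum \<gamma> \<beta>)" "(x, y) \<in> osum \<gamma> \<beta>" "x \<noteq> y"
      have M: "case_sum \<theta> \<theta> u \<in> M" if "u \<in> Field (osum \<gamma> \<beta>)" for u
        using that unfolding Fosum' F using embD(1)[OF \<theta>(1)] embD(1)[OF \<theta>(2)] by auto
      have "(case_sum \<theta> \<theta> x, case_sum \<theta> \<theta> y) \<in> W \<and> case_sum \<theta> \<theta> x \<noteq> case_sum \<theta> \<theta> y"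
      proof (cases x; cases y)
        fix a b assume ab: "x = Inl a" "y = Inl b"
        have "a \<in> ?R" "b \<in> ?R" "(a, b) \<in> W" "a \<noteq> b" using xy ab unfolding \<gamma>_def by auto
        then show ?thesis using embD(2,3)[OF \<theta>(1)] ab by simp
      next
        fix a b assume ab: "x = Inl a" "y = Inr b"
        have "a \<in> ?R" "b \<in> M" using xy ab F by auto
        then show ?thesis using \<theta>(3)[of a b] ab by simp
      next
        fix a b assume ab: "x = Inr a" "y = Inl b"
        then show ?thesis using xy by simp
      next
        fix a b assume ab: "x = Inr a" "y = Inr b"
        have "a \<in> M" "b \<in> M" "(a, b) \<in> W" "a \<noteq> b" using xy ab unfolding \<beta>_def by auto
        then show ?thesis using embD(2,3)[OF \<theta>(2)] ab by simp
      qed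
      then show "(case_sum \<theta> \<theta> x, case_sum \<theta> \<theta> y) \<in> \<beta> \<and> case_sum \<theta> \<theta> x \<noteq> case_sum \<theta> \<theta> y"
        using M[OF xy(1)] M[OF xy(2)] unfolding \<beta>_def by blast
    qed
    then have "osum \<gamma> \<beta> \<le>o \<beta>" using emb_imp_ordLeq Well_order_osum wo by blast
    moreover have "emb \<beta> (Field \<beta>) (osum \<gamma> \<beta>) (Field (osum \<gamma> \<beta>)) Inr"
      by (rule embI) (auto simp: Fosum')
    then have "\<beta> \<le>o osum \<gamma> \<beta>" using emb_imp_ordLeq Well_order_osum wo by blast
    ultimately show ?thesis using ordIso_iff_ordLeq by blast
  qed
  then have "osum \<gamma> \<beta> =o ?\<mu>" using \<mu> ordIso_symmetric ordIso_transitive by blast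
  \<comment> \<open>An arbitrary decomposition is carried over by \<open>\<psi>\<close> to a cut of
    \<open>W\<close> into \<open>I\<close> and \<open>F\<close>; the leading term then embeds into
    the rotation at that cut.\<close>
  moreover have "?\<mu> \<le>o osum \<gamma>' \<beta>'"
    if wo': "Well_order \<beta>'" "Well_order \<gamma>'" and eq: "W =o osum \<beta>' \<gamma>'" for \<beta>' \<gamma>' :: "'a rel"
  proof -
    obtain \<psi> where \<psi>: "bij_betw \<psi> (Field W) (Field (osum \<beta>' \<gamma>'))"
      and \<psi>_iff: "\<And>x y. x \<in> Field W \<Longrightarrow> y \<in> Field W \<Longrightarrow> (x, y) \<in> W \<longleftrightarrow> (\<psi> x, \<psi> y) \<in> osum \<beta>' \<gamma>'"
      using eq unfolding ordIso_iff_poset_iso poset_iso_def by blast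
    have \<psi>_in: "\<psi> x \<in> Inl ` Field \<beta>' \<union> Inr ` Field \<gamma>'" if "x \<in> Field W" for x
      using bij_betw_apply[OF \<psi> that] unfolding Field_osum[OF wo'[THEN well_order_onD(1)]] .
    define I where "I = {x \<in> Field W. \<exists>a\<in>Field \<beta>'. \<psi> x = Inl a}"
    define F where "F = {x \<in> Field W. \<exists>c\<in>Field \<gamma>'. \<psi> x = Inr c}"
    have "Field W = I \<union> F" unfolding I_def F_def using \<psi>_in by blast
    moreover have "I \<inter> F = {}" unfolding I_def F_def by auto
    moreover have "I \<times> F \<subseteq> W" unfolding I_def F_def using \<psi>_iff by auto
    ultimately obtain h where h: "\<And>x. x \<in> M \<Longrightarrow> h x \<in> Field W"
      "\<And>x y. x \<in> M \<Longrightarrow> y \<in> M \<Longrightarrow> (x, y) \<in> W \<Longrightarrow> x \<noteq> y \<Longrightarrow>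
        h x \<in> F \<and> h y \<in> I \<or> (h x \<in> F \<longleftrightarrow> h y \<in> F) \<and> (h x, h y) \<in> W \<and> h x \<noteq> h y"
      using leading_term_emb_rotation by blast
    \<comment> \<open>\<open>\<psi>\<close> takes values in the sum with \<open>\<beta>'\<close> in
      front, whereas the rotated sum has \<open>\<gamma>'\<close> in front.\<close>
    define swap :: "'a + 'a \<Rightarrow> 'a + 'a" where "swap = case_sum Inr Inl"
    have "emb \<beta> (Field \<beta>) (osum \<gamma>' \<beta>') (Field (osum \<gamma>' \<beta>')) (\<lambda>x. swap (\<psi> (h x)))"
    proof (rule embI)
      fix x assume "x \<in> Field \<beta>"
      then have "\<psi> (h x) \<in> Inl ` Field \<beta>' \<union> Inr ` Field \<gamma>'" using h(1) \<psi>_in \<open>Field \<beta> = M\<close> by simp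
      then show "swap (\<psi> (h x)) \<in> Field (osum \<gamma>' \<beta>')"
        unfolding Field_osum[OF wo'(2,1)[THEN well_order_onD(1)]] swap_def by auto
    next
      fix x y assume "x \<in> Field \<beta>" "y \<in> Field \<beta>" and xy: "(x, y) \<in> \<beta>" "x \<noteq> y"
      then have M: "x \<in> M" "y \<in> M" using \<open>Field \<beta> = M\<close> by auto
      have W': "(x, y) \<in> W" using xy(1) unfolding \<beta>_def by blast
      note hF = h(1)[OF M(1)] h(1)[OF M(2)]
      from h(2)[OF M W' xy(2)]
      show "(swap (\<psi> (h x)), swap (\<psi> (h y))) \<in> osum \<gamma>' \<beta>' \<and> swap (\<psi> (h x)) \<noteq> swap (\<psi> (h y))"
      proof (elim disjE conjE)
        assume "h x \<in> F" "h y \<in> I"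
        then show ?thesis unfolding F_def I_def swap_def by auto
      next
        assume iff: "h x \<in> F \<longleftrightarrow> h y \<in> F" and hxy: "(h x, h y) \<in> W" "h x \<noteq> h y"
        have le: "(\<psi> (h x), \<psi> (h y)) \<in> osum \<beta>' \<gamma>'" using \<psi>_iff[OF hF] hxy(1) by blast
        have ne: "\<psi> (h x) \<noteq> \<psi> (h y)" using \<psi> hF hxy(2) unfolding bij_betw_def inj_on_def by blast
        show ?thesis
        proof (cases "h x \<in> F")
          case True
          then obtain a b where "\<psi> (h x) = Inr a" "\<psi> (h y) = Inr b" using iff unfolding F_def by blast
          then show ?thesis using le ne unfolding swap_def by simp
        next
          case False
          then obtain a b where "\<psi> (h x) = Inl a" "\<psi> (h y) = Inl b"
            using iff \<psi>_in[OF hF(1)] \<psi>_in[OF hF(2)] hF unfolding F_def by blast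
          then show ?thesis using le ne unfolding swap_def by simp
        qed
      qed
    qed
    then have "\<beta> \<le>o osum \<gamma>' \<beta>'" using emb_imp_ordLeq Well_order_osum wo wo' by blast
    then show ?thesis using \<mu> ordIso_ordLeq_trans by blast
  qed
  ultimately show ?thesis
    unfolding is_min_ordinal_def using W_eq wo by blast
qed

subsection \<open>Orders chaining a structure\<close>

lemma LX_D: "L \<in> LX \<X> \<Longrightarrow> linear_order_on (universe \<X>) L" "L \<in> LX \<X> \<Longrightarrow> Field L = universe \<X>"
  unfolding LX_def using Field_linear_order_on by auto

text \<open>An increasing map on \<open>A\<close>, cut down to a partial map with domain
  \<open>A\<close>, is a partial automorphism of \<open>L\<close>. Stated for total functions, this
  is the form in which chaining is used throughout.\<close>

lemma LX_interp_iff: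
  assumes L: "L \<in> LX \<X>" and S: "A \<subseteq> universe \<X>" and c: "emb L A L (universe \<X>) c"
    and i: "i \<in> symbols \<X>" and xs: "xs \<in> tuples A (arity \<X> i)"
  shows "xs \<in> interp \<X> i \<longleftrightarrow> map c xs \<in> interp \<X> i"
proof -
  note lin = LX_D(1)[OF L] and F = LX_D(2)[OF L]
  define \<phi> where "\<phi> x = (if x \<in> A then Some (c x) else None)" for x
  have dom: "dom \<phi> = A" unfolding \<phi>_def dom_def by simp
  have inj: "inj_on c A" using emb_inj_on[OF lin S c] .
  have "\<phi> \<in> partial_auts (order_struct L)"
    unfolding partial_auts_def mem_Collect_eq dom
  proof (intro conjI ballI)
    show "A \<subseteq> universe (order_struct L)" using S F by (simp add: order_struct_def)
    show "ran \<phi> \<subseteq> universe (order_struct L)"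
      using embD(1)[OF c] F unfolding ran_def \<phi>_def by (auto simp: order_struct_def)
    show "inj_on \<phi> A" using inj unfolding \<phi>_def inj_on_def by simp
    fix j ys assume "ys \<in> tuples A (arity (order_struct L) j)"
    then obtain x y where xy: "x \<in> A" "y \<in> A" "ys = [x, y]" by (auto simp: order_struct_def tuples_2)
    have "(c x, c y) \<in> L \<longleftrightarrow> (x, y) \<in> L" using emb_iff[OF lin S lin order_refl c xy(1,2)] .
    moreover have "c x = c y \<longleftrightarrow> x = y" using inj xy by (auto dest: inj_onD)
    ultimately show "ys \<in> interp (order_struct L) j \<longleftrightarrow>
        map (\<lambda>x. the (\<phi> x)) ys \<in> interp (order_struct L) j"
      using xy unfolding \<phi>_def by (simp add: order_struct_def)
  qed
  then have "\<phi> \<in> partial_auts \<X>" using L unfolding LX_def by blast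
  then have "xs \<in> interp \<X> i \<longleftrightarrow> map (\<lambda>x. the (\<phi> x)) xs \<in> interp \<X> i"
    using i xs unfolding partial_auts_def mem_Collect_eq dom by blast
  moreover have "map (\<lambda>x. the (\<phi> x)) xs = map c xs"
    using xs unfolding tuples_def \<phi>_def by (auto intro: map_cong)
  ultimately show ?thesis by simp
qed

lemma tuples_map: "xs \<in> tuples A m \<Longrightarrow> (\<And>x. x \<in> A \<Longrightarrow> f x \<in> B) \<Longrightarrow> map f xs \<in> tuples B m"
  unfolding tuples_def by auto

lemma tuples_set: "xs \<in> tuples A m \<Longrightarrow> set xs \<subseteq> A \<and> finite (set xs) \<and> xs \<in> tuples (set xs) m"
  unfolding tuples_def by auto

lemma LX_self_embedding:
  assumes L: "L \<in> LX \<X>" and f: "emb L (universe \<X>) L (universe \<X>) f"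
  shows "f \<in> self_embeddings \<X>"
  unfolding self_embeddings_def
  using LX_interp_iff[OF L order_refl f] emb_inj_on[OF LX_D(1)[OF L] order_refl f] embD(1)[OF f]
  by blast

definition pullback :: "('a, 'i) rel_struct \<Rightarrow> ('a \<Rightarrow> 'a) \<Rightarrow> 'a rel \<Rightarrow> 'a rel" where
  "pullback \<X> f L = {(x, y). x \<in> universe \<X> \<and> y \<in> universe \<X> \<and> (f x, f y) \<in> L}"

lemma pullback_emb:
  assumes f: "f \<in> self_embeddings \<X>"
  shows "emb (pullback \<X> f L) (universe \<X>) L (universe \<X>) f"
  using f unfolding self_embeddings_def pullback_def emb_def inj_on_def by blast

text \<open>Conjugation by \<open>f\<close> turns a partial automorphism of the pulled-back order
  into one of \<open>L\<close> on a subset of the range of \<open>f\<close>. It preserves the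
  relations because \<open>L\<close> chains \<open>\<X>\<close>, and \<open>f\<close> transfers this
  back since it preserves and reflects them.\<close>

lemma pullback_in_LX:
  assumes L: "L \<in> LX \<X>" and f: "f \<in> self_embeddings \<X>"
  shows "pullback \<X> f L \<in> LX \<X>"
proof -
  let ?U = "universe \<X>"
  note lin = LX_D(1)[OF L]
  have inj: "inj_on f ?U" and fU: "\<And>x. x \<in> ?U \<Longrightarrow> f x \<in> ?U"
    and f_iff: "\<And>i xs. i \<in> symbols \<X> \<Longrightarrow> xs \<in> tuples ?U (arity \<X> i) \<Longrightarrow>
      xs \<in> interp \<X> i \<longleftrightarrow> map f xs \<in> interp \<X> i"
    using f unfolding self_embeddings_def by blast+
  have lin': "linear_order_on ?U (pullback \<X> f L)"
    unfolding pullback_def by (rule linear_order_pullback[OF lin inj fU])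
  note F' = Field_linear_order_on[OF lin']
  have "\<psi> \<in> partial_auts \<X>" if "\<psi> \<in> partial_auts (order_struct (pullback \<X> f L))" for \<psi>
  proof -
    define v where "v x = the (\<psi> x)" for x
    have dom: "dom \<psi> \<subseteq> ?U" and ran: "ran \<psi> \<subseteq> ?U" and inj\<psi>: "inj_on \<psi> (dom \<psi>)"
      and pres: "\<And>ys. ys \<in> tuples (dom \<psi>) 2 \<Longrightarrow>
        ys \<in> interp (order_struct (pullback \<X> f L)) () \<longleftrightarrow>
        map v ys \<in> interp (order_struct (pullback \<X> f L)) ()"
      using that F' unfolding partial_auts_def v_def by (auto simp: order_struct_def)
    have vU: "v x \<in> ?U" if "x \<in> dom \<psi>" for x
      using that ran unfolding v_def by (auto simp: ran_def)
    have v_iff: "(x, y) \<in> pullback \<X> f L \<and> x \<noteq> y \<longleftrightarrow> (v x, v y) \<in> pullback \<X> f L \<and> v x \<noteq> v y"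
      if "x \<in> dom \<psi>" "y \<in> dom \<psi>" for x y
    proof -
      have "[x, y] \<in> tuples (dom \<psi>) 2" using that by (simp add: tuples_2)
      from pres[OF this] show ?thesis by (simp add: order_struct_def)
    qed
    \<comment> \<open>The conjugate of \<open>v\<close> by \<open>f\<close>, meaningful on the image
      of the domain of \<open>\<psi>\<close>.\<close>
    define w where "w y = f (v (inv_into ?U f y))" for y
    have w: "w (f x) = f (v x)" if "x \<in> dom \<psi>" for x
      unfolding w_def using inv_into_f_f[OF inj] dom that by (simp add: subset_iff)
    have emb: "emb L (f ` dom \<psi>) L ?U w"
    proof (rule embI)
      fix y assume "y \<in> f ` dom \<psi>"
      then obtain x where "x \<in> dom \<psi>" "y = f x" by blast
      then show "w y \<in> ?U" using w vU fU by simp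
    next
      fix y y' assume "y \<in> f ` dom \<psi>" "y' \<in> f ` dom \<psi>" and yy': "(y, y') \<in> L" "y \<noteq> y'"
      then obtain x x' where x: "x \<in> dom \<psi>" "y = f x" "x' \<in> dom \<psi>" "y' = f x'" by blast
      then have "(x, x') \<in> pullback \<X> f L \<and> x \<noteq> x'" unfolding pullback_def using yy' dom by auto
      then have v: "(v x, v x') \<in> pullback \<X> f L" "v x \<noteq> v x'" using v_iff x by blast+
      then have "(f (v x), f (v x')) \<in> L" unfolding pullback_def by simp
      moreover have "f (v x) \<noteq> f (v x')" using inj vU x v(2) unfolding inj_on_def by blast
      ultimately show "(w y, w y') \<in> L \<and> w y \<noteq> w y'" using w x by simp
    qed
    have "xs \<in> interp \<X> i \<longleftrightarrow> map v xs \<in> interp \<X> i"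
      if i: "i \<in> symbols \<X>" and xs: "xs \<in> tuples (dom \<psi>) (arity \<X> i)" for i xs
    proof -
      have xsU: "xs \<in> tuples ?U (arity \<X> i)" using xs dom unfolding tuples_def by auto
      have vxs: "map v xs \<in> tuples ?U (arity \<X> i)" by (rule tuples_map[OF xs vU])
      have fxs: "map f xs \<in> tuples (f ` dom \<psi>) (arity \<X> i)" by (rule tuples_map[OF xs imageI])
      have "xs \<in> interp \<X> i \<longleftrightarrow> map f xs \<in> interp \<X> i" using f_iff[OF i xsU] .
      also have "\<dots> \<longleftrightarrow> map w (map f xs) \<in> interp \<X> i"
        by (rule LX_interp_iff[OF L _ emb i fxs]) (use dom fU in blast)
      also have "map w (map f xs) = map f (map v xs)"
        using xs w unfolding tuples_def by (simp add: subset_iff)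
      also have "map f (map v xs) \<in> interp \<X> i \<longleftrightarrow> map v xs \<in> interp \<X> i" using f_iff[OF i vxs] by blast
      finally show ?thesis .
    qed
    then show ?thesis using dom ran inj\<psi> unfolding partial_auts_def v_def by blast
  qed
  then show ?thesis using lin' unfolding LX_def by blast
qed

lemma pullback_well_order:
  assumes L: "L \<in> LX \<X>" "Well_order L" and f: "f \<in> self_embeddings \<X>"
  shows "well_order_on (universe \<X>) (pullback \<X> f L)"
  using well_order_on_emb[OF LX_D(1)[OF pullback_in_LX[OF L(1) f]] L(2) pullback_emb[OF f]] .

text \<open>
  Every finite part of \<open>L'\<close> has a copy inside \<open>C\<close>, where both orders agree; passing through \<open>C\<close>
  turns \<open>g\<close> into a composition of partial automorphisms of \<open>L'\<close> and of \<open>L\<close>.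
\<close>

lemma LX_mixed_self_embedding:
  assumes L: "L \<in> LX \<X>" "Well_order L" and L': "L' \<in> LX \<X>" "Well_order L'"
    and C: "C \<subseteq> universe \<X>" "infinite C" "\<And>x y. x \<in> C \<Longrightarrow> y \<in> C \<Longrightarrow> (x, y) \<in> L \<longleftrightarrow> (x, y) \<in> L'"
    and g: "emb L' (universe \<X>) L (universe \<X>) g"
  shows "g \<in> self_embeddings \<X>"
proof -
  let ?U = "universe \<X>"
  note lin = LX_D(1)[OF L(1)] and lin' = LX_D(1)[OF L'(1)]
  note F = LX_D(2)[OF L(1)] and F' = LX_D(2)[OF L'(1)]
  have "xs \<in> interp \<X> i \<longleftrightarrow> map g xs \<in> interp \<X> i"
    if i: "i \<in> symbols \<X>" and xs: "xs \<in> tuples ?U (arity \<X> i)" for i xs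
  proof -
    define A where "A = set xs"
    have A: "A \<subseteq> ?U" "finite A" "xs \<in> tuples A (arity \<X> i)" using tuples_set[OF xs] unfolding A_def by auto
    have "well_order_on A (Restr L' A)" "well_order_on C (Restr L C)"
      using well_order_on_Restr[OF L'(2)] well_order_on_Restr[OF L(2)] A(1) C(1) F F' by auto
    then obtain c where c0: "emb (Restr L' A) A (Restr L C) C c"
      using finite_order_emb[OF A(2) _ C(2)] by blast
    have c: "emb L' A L C c" using c0 unfolding emb_def by blast
    \<comment> \<open>As the orders agree on \<open>C\<close>, the map \<open>c\<close> is
      increasing for \<open>L'\<close> on both sides and is handled by chaining with
      \<open>L'\<close>. The map \<open>w\<close>, which undoes \<open>c\<close> and then applies
      \<open>g\<close>, is increasing for \<open>L\<close> on both sides and is handled by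
      \<open>L\<close>.\<close>
    have c': "emb L' A L' ?U c"
      using c C(1) C(3) unfolding emb_def by blast
    have inj: "inj_on c A" using emb_inj_on[OF lin' A(1) c] .
    define w where "w y = g (inv_into A c y)" for y
    have w: "w (c x) = g x" if "x \<in> A" for x unfolding w_def using inv_into_f_f[OF inj that] by simp
    have cA: "c ` A \<subseteq> ?U" using embD(1)[OF c] C(1) by blast
    have "emb L (c ` A) L ?U w"
    proof (rule embI)
      fix y assume "y \<in> c ` A"
      then show "w y \<in> ?U" using w embD(1)[OF g] A(1) by auto
    next
      fix y y' assume "y \<in> c ` A" "y' \<in> c ` A" and yy': "(y, y') \<in> L" "y \<noteq> y'"
      then obtain x x' where x: "x \<in> A" "y = c x" "x' \<in> A" "y' = c x'" by blast
      have lt: "(x, x') \<in> L'" using emb_iff[OF lin' A(1) lin C(1) c x(1,3)] yy'(1) x by simp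
      have ne: "x \<noteq> x'" using yy'(2) x by auto
      have "x \<in> ?U" "x' \<in> ?U" using x A(1) by auto
      then have "(g x, g x') \<in> L \<and> g x \<noteq> g x'" using embD(2,3)[OF g] lt ne by simp
      then show "(w y, w y') \<in> L \<and> w y \<noteq> w y'" using w x by simp
    qed
    moreover have "map c xs \<in> tuples (c ` A) (arity \<X> i)" by (rule tuples_map[OF A(3) imageI])
    ultimately have "map c xs \<in> interp \<X> i \<longleftrightarrow> map w (map c xs) \<in> interp \<X> i"
      using LX_interp_iff[OF L(1) cA _ i] by blast
    also have "map w (map c xs) = map g xs" using w unfolding A_def by auto
    finally show ?thesis using LX_interp_iff[OF L'(1) A(1) c' i A(3)] by blast
  qed
  then show ?thesis
    unfolding self_embeddings_def using embD(1)[OF g] emb_inj_on[OF lin' order_refl g] by blast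
qed

lemma copies_eqI: "Field (copies \<X>) = Field (copies \<Y>) \<Longrightarrow> copies \<X> = copies \<Y>"
  by (auto simp: copies_iff)

lemma Field_lsum: "Field (r \<oplus>\<^sub>l s) = Field r \<union> Field s"
  unfolding lsum_def Field_def by auto

subsection \<open>Structures chained by all linear orders\<close>

text \<open>An order listing \<open>A\<close> first, then \<open>c\<close> applied to
  \<open>A\<close> in the matching sequence, then all other points makes \<open>c\<close> increasing
  on \<open>A\<close>, and every linear order is available. Disjointness ensures that no point is
  assigned two places in the list.\<close>

lemma all_orders_interp_iff:
  assumes L: "linear_order_on (universe \<X>) L" and all: "LX \<X> = {r. linear_order_on (universe \<X>) r}"
    and A: "finite A" "A \<subseteq> universe \<X>" and c: "inj_on c A" "c ` A \<subseteq> universe \<X>" "A \<inter> c ` A = {}"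
    and i: "i \<in> symbols \<X>" and xs: "xs \<in> tuples A (arity \<X> i)"
  shows "xs \<in> interp \<X> i \<longleftrightarrow> map c xs \<in> interp \<X> i"
proof -
  obtain h where h: "bij_betw h A {0..<card A}" using ex_bij_betw_finite_nat[OF A(1)] by blast
  define rk where "rk x = (if x \<in> A then h x else if x \<in> c ` A then card A + h (inv_into A c x)
    else 2 * card A)" for x
  define r where "r = {(x, y). x \<in> universe \<X> \<and> y \<in> universe \<X> \<and>
    (rk x < rk y \<or> rk x = rk y \<and> (x, y) \<in> L)}"
  have "linear_order_on (universe \<X>) r"
  proof (rule linear_order_onI)
    fix x y z assume "(x, y) \<in> r" "(y, z) \<in> r"
    then show "(x, z) \<in> r" unfolding r_def by (auto intro: Linear_orderD(2)[OF L])
  next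
    fix x y assume "(x, y) \<in> r" "(y, x) \<in> r"
    then show "x = y" unfolding r_def by (auto intro: Linear_orderD(3)[OF L])
  next
    fix x y assume "x \<in> universe \<X>" "y \<in> universe \<X>" "x \<noteq> y"
    then show "(x, y) \<in> r \<or> (y, x) \<in> r" unfolding r_def using Linear_orderD(4)[OF L, of x y] by auto
  qed (auto simp: r_def Linear_orderD(1)[OF L])
  then have r: "r \<in> LX \<X>" using all by blast
  have rk_c: "rk (c x) = card A + h x" if "x \<in> A" for x
    unfolding rk_def using that c(3) inv_into_f_f[OF c(1) that] by auto
  have "emb r A r (universe \<X>) c"
  proof (rule embI)
    fix x y assume xy: "x \<in> A" "y \<in> A" "(x, y) \<in> r" "x \<noteq> y"
    have "h x \<noteq> h y" using h xy unfolding bij_betw_def inj_on_def by blast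
    moreover have "h x \<le> h y" using xy unfolding r_def rk_def by auto
    ultimately have "rk (c x) < rk (c y)" using rk_c xy(1,2) by simp
    then show "(c x, c y) \<in> r \<and> c x \<noteq> c y" using c(2) xy(1,2) unfolding r_def by auto
  qed (use c(2) in blast)
  then show ?thesis by (rule LX_interp_iff[OF r A(2) _ i xs])
qed

text \<open>A finite set \<open>A\<close> may overlap its image under \<open>f\<close>, so the
  preceding lemma does not apply directly. Both sets are compared with a third set \<open>C\<close>
  of the same size, disjoint from each of them.\<close>

lemma all_orders_self_embedding:
  assumes L: "linear_order_on (universe \<X>) L" and all: "LX \<X> = {r. linear_order_on (universe \<X>) r}"
    and inf: "infinite (universe \<X>)" and f: "inj_on f (universe \<X>)" "f ` universe \<X> \<subseteq> universe \<X>"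
  shows "f \<in> self_embeddings \<X>"
proof -
  let ?U = "universe \<X>"
  have "xs \<in> interp \<X> i \<longleftrightarrow> map f xs \<in> interp \<X> i"
    if i: "i \<in> symbols \<X>" and xs: "xs \<in> tuples ?U (arity \<X> i)" for i xs
  proof -
    define A where "A = set xs"
    have A: "A \<subseteq> ?U" "finite A" "xs \<in> tuples A (arity \<X> i)" using tuples_set[OF xs] unfolding A_def by auto
    have fA: "f ` A \<subseteq> ?U" "finite (f ` A)" using A f(2) by auto
    have injA: "inj_on f A" using f(1) A(1) by (rule inj_on_subset)
    have "infinite (?U - (A \<union> f ` A))" using inf A(2) by simp
    from infinite_arbitrarily_large[OF this, of "card A"]
    obtain C where C: "C \<subseteq> ?U - (A \<union> f ` A)" "finite C" "card C = card A" by blast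
    obtain c where c: "bij_betw c A C" using finite_same_card_bij[OF A(2) C(2)] C(3) by auto
    define w where "w y = c (inv_into A f y)" for y
    have w: "w (f x) = c x" if "x \<in> A" for x unfolding w_def using inv_into_f_f[OF injA that] by simp
    have cA: "inj_on c A" "c ` A = C" using c unfolding bij_betw_def by auto
    have wA: "inj_on w (f ` A)" "w ` f ` A = C"
      using w cA unfolding inj_on_def by (auto simp: image_iff)
    have fxs: "map f xs \<in> tuples (f ` A) (arity \<X> i)" by (rule tuples_map[OF A(3) imageI])
    have "xs \<in> interp \<X> i \<longleftrightarrow> map c xs \<in> interp \<X> i"
      by (rule all_orders_interp_iff[OF L all A(2,1) cA(1) _ _ i A(3)]) (use cA(2) C in auto)
    also have "map c xs = map w (map f xs)" using w unfolding A_def by auto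
    also have "map w (map f xs) \<in> interp \<X> i \<longleftrightarrow> map f xs \<in> interp \<X> i"
      by (rule all_orders_interp_iff[OF L all fA(2,1) wA(1) _ _ i fxs, symmetric]) (use wA(2) C in auto)
    finally show ?thesis .
  qed
  then show ?thesis unfolding self_embeddings_def using f by blast
qed

text \<open>All injections being self-embeddings, equality of cardinals is the only condition on a
  subset.\<close>

lemma all_orders_Field_copies:
  assumes L: "linear_order_on (universe \<X>) L" and all: "LX \<X> = {r. linear_order_on (universe \<X>) r}"
    and inf: "infinite (universe \<X>)"
  shows "Field (copies \<X>) = {A. A \<subseteq> universe \<X> \<and> |A| =o |universe \<X>| }"
proof (intro set_eqI iffI)
  fix A assume "A \<in> Field (copies \<X>)"
  then obtain f where f: "f \<in> self_embeddings \<X>" "A = f ` universe \<X>" unfolding Field_copies by blast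
  then have "bij_betw f (universe \<X>) A" "A \<subseteq> universe \<X>"
    unfolding self_embeddings_def bij_betw_def by auto
  then show "A \<in> {A. A \<subseteq> universe \<X> \<and> |A| =o |universe \<X>| }"
    using card_of_ordIsoI ordIso_symmetric by blast
next
  fix A assume A: "A \<in> {A. A \<subseteq> universe \<X> \<and> |A| =o |universe \<X>| }"
  then obtain f where f: "bij_betw f (universe \<X>) A"
    using card_of_ordIso[of "universe \<X>" A] ordIso_symmetric by blast
  then have "f \<in> self_embeddings \<X>"
    using all_orders_self_embedding[OF L all inf] A unfolding bij_betw_def by blast
  then show "A \<in> Field (copies \<X>)" using f unfolding Field_copies bij_betw_def by blast
qed

text \<open>The bijection \<open>h\<close> takes copies to full-size subsets of \<open>T\<close>,
  and their classes exhaust the quotient, so density is immediate. If a class lies below two others,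
  its representative meets both in a full-size set, because the smaller sets form an ideal when
  \<open>T\<close> is infinite; the preimage of this intersection is a copy below both.\<close>

lemma ro_CP:
  fixes T :: "'a set" and \<X> :: "('x, 'i) rel_struct"
  assumes inf: "infinite T" and h: "bij_betw h (universe \<X>) T"
    and copies: "Field (copies \<X>) = {A. A \<subseteq> universe \<X> \<and> |A| =o |universe \<X>| }"
  shows "ro (copies \<X>) \<cong>\<^sub>p ro (CP |T| )"
proof -
  let ?U = "universe \<X>"
  define small :: "'a set \<Rightarrow> bool" where "small Y \<longleftrightarrow> |Y| <o |T|" for Y
  have small_subset: "small Y" if "Y \<subseteq> Z" "small Z" for Y Z
    using card_of_mono1[OF that(1)] that(2) ordLeq_ordLess_trans unfolding small_def by blast
  have small_Un: "small (Y \<union> Z)" if "small Y" "small Z" for Y Z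
    using card_of_Un_ordLess_infinite[OF inf] that unfolding small_def by blast
  have small_empty: "small {}"
    unfolding small_def
    by (rule finite_ordLess_infinite[OF card_of_Well_order card_of_Well_order]) (simp_all add: Field_card_of inf)
  have big_iff: "\<not> small Y \<longleftrightarrow> |Y| =o |T|" if "Y \<subseteq> T" for Y
  proof -
    have "|Y| \<le>o |T|" using that by (rule card_of_mono1)
    then show ?thesis
      unfolding small_def using not_ordLess_iff_ordLeq[OF card_of_Well_order card_of_Well_order]
        ordIso_iff_ordLeq by blast
  qed
  define E where "E = {(A, B). A \<subseteq> T \<and> B \<subseteq> T \<and> small ((A - B) \<union> (B - A))}"
  have CP_eq: "CP |T| = {(E `` {A}, E `` {B}) | A B. A \<subseteq> T \<and> B \<subseteq> T \<and>
      \<not> small A \<and> \<not> small B \<and> small (A - B)}"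
    unfolding CP_def E_def small_def Let_def Field_card_of by simp
  have E_eqD: "small (A - B) \<and> small (B - A)" if "E `` {A} = E `` {B}" "A \<subseteq> T" "B \<subseteq> T" for A B
  proof -
    have "(B, B) \<in> E" using that(3) small_empty unfolding E_def by simp
    then have "(A, B) \<in> E" using that(1) by blast
    then have "small ((A - B) \<union> (B - A))" unfolding E_def by blast
    then show ?thesis by (blast intro: small_subset)
  qed
  have CP_iff: "(E `` {A}, E `` {B}) \<in> CP |T| \<longleftrightarrow> small (A - B)"
    if AB: "A \<subseteq> T" "B \<subseteq> T" "\<not> small A" "\<not> small B" for A B
  proof
    assume "(E `` {A}, E `` {B}) \<in> CP |T|"
    then obtain A' B' where AB': "E `` {A} = E `` {A'}" "E `` {B} = E `` {B'}" "A' \<subseteq> T" "B' \<subseteq> T"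
      "small (A' - B')"
      unfolding CP_eq by blast
    have "small ((A - A') \<union> (A' - B') \<union> (B' - B))"
      using E_eqD[OF AB'(1) AB(1) AB'(3)] E_eqD[OF AB'(2) AB(2) AB'(4)] AB'(5)
      by (intro small_Un) auto
    then show "small (A - B)" by (rule small_subset[rotated]) blast
  qed (use AB in \<open>auto simp: CP_eq\<close>)
  have Field_CP: "Field (CP |T| ) = {E `` {A} | A. A \<subseteq> T \<and> \<not> small A}"
  proof (intro set_eqI iffI)
    fix y assume "y \<in> {E `` {A} | A. A \<subseteq> T \<and> \<not> small A}"
    then obtain A where A: "y = E `` {A}" "A \<subseteq> T" "\<not> small A" by blast
    have "(y, y) \<in> CP |T|" unfolding A(1) CP_iff[OF A(2,2,3,3)] using small_empty by simp
    then show "y \<in> Field (CP |T| )" by (rule FieldI1)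
  next
    fix y assume "y \<in> Field (CP |T| )"
    then show "y \<in> {E `` {A} | A. A \<subseteq> T \<and> \<not> small A}"
      unfolding CP_eq by (fast dest: in_FieldD)
  qed
  have pre: "Preorder (CP |T| )"
  proof (rule PreorderI)
    fix x assume "x \<in> Field (CP |T| )"
    then obtain A where A: "x = E `` {A}" "A \<subseteq> T" "\<not> small A" unfolding Field_CP by blast
    show "(x, x) \<in> CP |T|" unfolding A(1) CP_iff[OF A(2,2,3,3)] using small_empty by simp
  next
    fix x y z assume xyz: "(x, y) \<in> CP |T|" "(y, z) \<in> CP |T|"
    then have "x \<in> Field (CP |T| )" "y \<in> Field (CP |T| )" "z \<in> Field (CP |T| )"
      by (auto intro: FieldI1 FieldI2)
    then obtain A B C where ABC: "x = E `` {A}" "y = E `` {B}" "z = E `` {C}"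
      "A \<subseteq> T" "B \<subseteq> T" "C \<subseteq> T" "\<not> small A" "\<not> small B" "\<not> small C"
      unfolding Field_CP by blast
    have "small (A - B)" "small (B - C)"
      using xyz unfolding ABC(1-3) CP_iff[OF ABC(4,5,7,8)] CP_iff[OF ABC(5,6,8,9)] .
    then have "small ((A - B) \<union> (B - C))" by (rule small_Un)
    then have "small (A - C)" by (rule small_subset[rotated]) blast
    then show "(x, z) \<in> CP |T|" unfolding ABC(1,3) CP_iff[OF ABC(4,6,7,9)] .
  qed
  have UT: "|?U| =o |T|" using card_of_ordIsoI[OF h] .
  have copy_image: "h ` A \<subseteq> T \<and> \<not> small (h ` A)" if "A \<in> Field (copies \<X>)" for A
  proof -
    have A: "A \<subseteq> ?U" "|A| =o |?U|" using that copies by auto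
    have hA: "bij_betw h A (h ` A)" using h A(1) bij_betw_subset by blast
    have "|h ` A| =o |A|" by (rule ordIso_symmetric[OF card_of_ordIsoI[OF hA]])
    from ordIso_transitive[OF this ordIso_transitive[OF A(2) UT]] have "|h ` A| =o |T|" .
    moreover have "h ` A \<subseteq> T" using h A(1) unfolding bij_betw_def by blast
    ultimately show ?thesis using big_iff by blast
  qed
  have preimage_copy: "{x \<in> ?U. h x \<in> B} \<in> Field (copies \<X>) \<and> h ` {x \<in> ?U. h x \<in> B} = B"
    if B: "B \<subseteq> T" "\<not> small B" for B
  proof -
    have hB: "h ` {x \<in> ?U. h x \<in> B} = B" using h B(1) unfolding bij_betw_def by auto
    then have "bij_betw h {x \<in> ?U. h x \<in> B} B"
      using h unfolding bij_betw_def by (auto intro: inj_on_subset)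
    then have pB: "|{x \<in> ?U. h x \<in> B}| =o |B|" by (rule card_of_ordIsoI)
    have "|B| =o |T|" using big_iff[OF B(1)] B(2) by blast
    from ordIso_transitive[OF pB ordIso_transitive[OF this ordIso_symmetric[OF UT]]]
    have "|{x \<in> ?U. h x \<in> B}| =o |?U|" .
    then show ?thesis using copies hB by auto
  qed
  show ?thesis
  proof (rule ro_dense_map[OF Preorder_copies pre, where e = "\<lambda>A. E `` {h ` A}"])
    fix A assume "A \<in> Field (copies \<X>)"
    then show "E `` {h ` A} \<in> Field (CP |T| )" unfolding Field_CP using copy_image by blast
  next
    fix A B assume "(A, B) \<in> copies \<X>"
    then have AB: "A \<in> Field (copies \<X>)" "B \<in> Field (copies \<X>)" "A \<subseteq> B" by (auto simp: copies_iff)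
    have "h ` A - h ` B = {}" using AB(3) by blast
    then have "small (h ` A - h ` B)" using small_empty by (simp only:)
    then show "(E `` {h ` A}, E `` {h ` B}) \<in> CP |T|"
      using CP_iff[of "h ` A" "h ` B"] copy_image AB(1,2) by blast
  next
    fix A B y assume AB: "A \<in> Field (copies \<X>)" "B \<in> Field (copies \<X>)"
      and y: "(y, E `` {h ` A}) \<in> CP |T|" "(y, E `` {h ` B}) \<in> CP |T|"
    obtain C where C: "y = E `` {C}" "C \<subseteq> T" "\<not> small C"
      using FieldI1[OF y(1)] unfolding Field_CP by blast
    have sm: "small (C - h ` A)" "small (C - h ` B)"
      using y CP_iff[of C "h ` A"] CP_iff[of C "h ` B"] copy_image[OF AB(1)] copy_image[OF AB(2)] C
      by auto
    let ?D = "C \<inter> h ` A \<inter> h ` B"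
    have "\<not> small ?D"
    proof
      assume "small ?D"
      then have "small (?D \<union> (C - h ` A) \<union> (C - h ` B))" using sm by (intro small_Un)
      then have "small C" by (rule small_subset[rotated]) blast
      then show False using C(3) by blast
    qed
    then have D: "{x \<in> ?U. h x \<in> ?D} \<in> Field (copies \<X>)" using preimage_copy[of ?D] C(2) by blast
    have inj: "inj_on h ?U" using h unfolding bij_betw_def by blast
    have "A \<subseteq> ?U" "B \<subseteq> ?U" using AB copies by auto
    then have "{x \<in> ?U. h x \<in> ?D} \<subseteq> A" "{x \<in> ?U. h x \<in> ?D} \<subseteq> B"
      using inj unfolding inj_on_def by blast+
    then show "\<exists>q. (q, A) \<in> copies \<X> \<and> (q, B) \<in> copies \<X>" using D AB copies_iff by blast
  next
    fix y assume yF: "y \<in> Field (CP |T| )"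
    then obtain B where B: "y = E `` {B}" "B \<subseteq> T" "\<not> small B" unfolding Field_CP by blast
    then show "\<exists>A\<in>Field (copies \<X>). (E `` {h ` A}, y) \<in> CP |T|"
      using preimage_copy[OF B(2,3)] Preorder_refl[OF pre yF]
      by (intro bexI[of _ "{x \<in> ?U. h x \<in> B}"]) simp_all
  qed
qed

subsection \<open>Structures chained by end rearrangements\<close>

lemma finite_rearrangement_iso:
  assumes L: "well_order_on U L" and K: "K \<subseteq> U" "finite K" "linear_order_on K r"
  obtains f where "bij_betw f K K" "emb L K r K f"
proof -
  have LK: "well_order_on K (Restr L K)" using well_order_on_Restr[OF L K(1)] .
  have "r \<subseteq> K \<times> K" using Linear_orderD(5)[OF K(3)] by auto
  then have "finite r" using K(2) finite_subset by blast
  then have rK: "well_order_on K r" using K(3) linear_order_on_well_order_on by blast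
  have F: "Field (Restr L K) = K" "Field r = K"
    using Field_linear_order_on[OF well_order_onD(1)[OF LK]] Field_linear_order_on[OF K(3)] .
  have "Restr L K =o r" using finite_well_order_on_ordIso[OF K(2) LK rK] .
  then obtain f where f: "bij_betw f (Field (Restr L K)) (Field r)"
    "\<And>x y. x \<in> Field (Restr L K) \<Longrightarrow> y \<in> Field (Restr L K) \<Longrightarrow> (x, y) \<in> Restr L K \<longleftrightarrow> (f x, f y) \<in> r"
    unfolding ordIso_iff_poset_iso poset_iso_def by blast
  have "emb (Restr L K) K r K f" using poset_iso_emb[OF f] F by simp
  then have "emb L K r K f" unfolding emb_def by blast
  then show ?thesis using that f(1) F by simp
qed

text \<open>Reversal would make the infinite middle part \<open>M\<close> well-ordered in both
  directions. In the remaining alternative only the finite parts \<open>K\<close> and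
  \<open>H\<close> change their order, so permuting each of them and fixing \<open>M\<close>
  suffices. That \<open>g\<close> maps onto \<open>U\<close> is what keeps a copy the same set when
  the order is changed.\<close>

lemma end_rearrangement_iso:
  assumes L: "well_order_on U L" "infinite U" and L': "L' \<in> end_rearrangements m L" "well_order_on U L'"
  obtains g where "emb L U L' U g" "g ` U = U"
proof -
  note lin = well_order_onD(1)[OF L(1)] and lin' = well_order_onD(1)[OF L'(2)]
  have FL: "Field L = U" "Field L' = U" using Field_linear_order_on lin lin' by auto
  obtain K M H rK rH where d: "decomp3 L K M H" and fin: "finite (K \<union> H)"
    and rK: "linear_order_on K rK" and rH: "linear_order_on H rH"
    and L'_cases: "L' = rK \<oplus>\<^sub>l Restr L M \<oplus>\<^sub>l rH \<or> L' = rH \<oplus>\<^sub>l (Restr L M)\<inverse> \<oplus>\<^sub>l rK"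
    using L'(1) unfolding end_rearrangements_def by auto
  have U: "U = K \<union> M \<union> H" and disj: "K \<inter> M = {}" "K \<inter> H = {}" "M \<inter> H = {}"
    and le: "K \<times> M \<subseteq> L" "K \<times> H \<subseteq> L" "M \<times> H \<subseteq> L"
    using d FL unfolding decomp3_def by auto
  have MF: "Field (Restr L M) = M"
    using Field_linear_order_on[OF linear_order_on_Restr[OF lin]] U by auto
  note KF = Field_linear_order_on[OF rK] and HF = Field_linear_order_on[OF rH]
  have rK_in: "x \<in> K \<and> y \<in> K" if "(x, y) \<in> rK" for x y using Linear_orderD(5)[OF rK that] .
  have rH_in: "x \<in> H \<and> y \<in> H" if "(x, y) \<in> rH" for x y using Linear_orderD(5)[OF rH that] .
  have "infinite M" using L(2) fin U by auto
  have "L' \<noteq> rH \<oplus>\<^sub>l (Restr L M)\<inverse> \<oplus>\<^sub>l rK"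
  proof
    assume eq: "L' = rH \<oplus>\<^sub>l (Restr L M)\<inverse> \<oplus>\<^sub>l rK"
    have "finite M"
    proof (rule finite_if_both_well_ordered[OF lin' well_order_onD(2)[OF L'(2)], of L])
      show "Well_order L" using L(1) FL by simp
      fix x y assume xy: "x \<in> M" "y \<in> M"
      have "x \<notin> H" "x \<notin> K" "y \<notin> H" "y \<notin> K" using xy disj by auto
      then show "(x, y) \<in> L' \<longleftrightarrow> (y, x) \<in> L"
        unfolding eq lsum_def using xy rK_in rH_in KF HF by auto
    qed (use U FL in auto)
    then show False using \<open>infinite M\<close> by simp
  qed
  then have eq: "L' = rK \<oplus>\<^sub>l Restr L M \<oplus>\<^sub>l rH" using L'_cases by blast
  have L'_eq: "L' = rK \<union> Restr L M \<union> rH \<union> K \<times> (M \<union> H) \<union> M \<times> H"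
  proof -
    have "Field (Restr L M \<oplus>\<^sub>l rH) = M \<union> H" by (simp add: Field_lsum MF HF)
    then have "L' = rK \<union> (Restr L M \<oplus>\<^sub>l rH) \<union> K \<times> (M \<union> H)"
      unfolding eq by (subst lsum_def) (simp add: KF)
    also have "Restr L M \<oplus>\<^sub>l rH = Restr L M \<union> rH \<union> M \<times> H" unfolding lsum_def MF HF ..
    finally show ?thesis by blast
  qed
  obtain kf where kf: "bij_betw kf K K" "emb L K rK K kf"
    using finite_rearrangement_iso[OF L(1) _ _ rK] fin U by auto
  obtain hf where hf: "bij_betw hf H H" "emb L H rH H hf"
    using finite_rearrangement_iso[OF L(1) _ _ rH] fin U by auto
  define g where "g x = (if x \<in> K then kf x else if x \<in> H then hf x else x)" for x
  have gK: "g x = kf x" "g x \<in> K" if "x \<in> K" for x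
    unfolding g_def using that bij_betw_apply[OF kf(1)] by auto
  have gH: "g x = hf x" "g x \<in> H" if "x \<in> H" for x
    unfolding g_def using that bij_betw_apply[OF hf(1)] disj by auto
  have gM: "g x = x" if "x \<in> M" for x unfolding g_def using that disj by auto
  have anti: "False" if "(x, y) \<in> L" "(y, x) \<in> L" "x \<noteq> y" for x y
    using Linear_orderD(3)[OF lin that(1,2)] that(3) by blast
  have "emb L U L' U g"
  proof (rule embI)
    fix x assume "x \<in> U"
    then show "g x \<in> U" using U gK gH gM by auto
  next
    fix x y assume xy: "x \<in> U" "y \<in> U" "(x, y) \<in> L" "x \<noteq> y"
    have "(x, y) \<notin> M \<times> K" "(x, y) \<notin> H \<times> K" "(x, y) \<notin> H \<times> M" using anti[OF xy(3) _ xy(4)] le by blast+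
    then consider "x \<in> K" "y \<in> K" | "x \<in> K" "y \<in> M" | "x \<in> K" "y \<in> H" | "x \<in> M" "y \<in> M"
      | "x \<in> M" "y \<in> H" | "x \<in> H" "y \<in> H"
      using xy U by blast
    then show "(g x, g y) \<in> L' \<and> g x \<noteq> g y"
    proof cases
      case 1
      then show ?thesis unfolding L'_eq using embD(2,3)[OF kf(2) 1 xy(3,4)] gK by simp
    next
      case 2
      then show ?thesis unfolding L'_eq using gK(2)[OF 2(1)] gM[OF 2(2)] disj by auto
    next
      case 3
      then show ?thesis unfolding L'_eq using gK(2)[OF 3(1)] gH(2)[OF 3(2)] disj by auto
    next
      case 4
      then show ?thesis unfolding L'_eq using gM xy(3,4) by simp
    next
      case 5
      then show ?thesis unfolding L'_eq using gM[OF 5(1)] gH(2)[OF 5(2)] disj by auto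
    next
      case 6
      then show ?thesis unfolding L'_eq using embD(2,3)[OF hf(2) 6 xy(3,4)] gH by simp
    qed
  qed
  moreover have "g ` U = U"
  proof -
    have "g ` K = K" "g ` H = H" "g ` M = M"
      using gK(1) gH(1) gM kf(1) hf(1) unfolding bij_betw_def by auto
    then show ?thesis unfolding U by (simp add: image_Un)
  qed
  ultimately show ?thesis using that by blast
qed

text \<open>Precomposing a self-embedding of \<open>\<X>\<close> with the permutation
  \<open>g\<close> yields a self-embedding of \<open>L\<close> with the same image.\<close>

lemma end_rearrangements_copies:
  assumes L: "L \<in> LX \<X>" "Well_order L" and inf: "infinite (universe \<X>)"
    and end_r: "LX \<X> = end_rearrangements m L"
  shows "copies \<X> = copies (order_struct L)"
proof (rule copies_eqI)
  let ?U = "universe \<X>"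
  note F = LX_D(2)[OF L(1)]
  have "Field (copies \<X>) = ocopies L"
  proof (intro set_eqI iffI)
    fix A assume "A \<in> Field (copies \<X>)"
    then obtain f where f: "f \<in> self_embeddings \<X>" "A = f ` ?U" unfolding Field_copies by blast
    have wo: "well_order_on ?U L" using L(2) F by simp
    obtain g where g: "emb L ?U (pullback \<X> f L) ?U g" "g ` ?U = ?U"
      using end_rearrangement_iso[OF wo inf, of "pullback \<X> f L" m] pullback_in_LX[OF L(1) f(1)] end_r
        pullback_well_order[OF L f(1)] by blast
    have "emb L ?U L ?U (\<lambda>x. f (g x))" by (rule emb_comp[OF g(1) pullback_emb[OF f(1)]])
    moreover have "A = (\<lambda>x. f (g x)) ` ?U" unfolding f(2) using g(2) by (metis image_image)
    ultimately show "A \<in> ocopies L" unfolding ocopies_def F by blast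
  next
    fix A assume "A \<in> ocopies L"
    then obtain f where "emb L ?U L ?U f" "A = f ` ?U" unfolding ocopies_def F by blast
    then show "A \<in> Field (copies \<X>)" unfolding Field_copies using LX_self_embedding[OF L(1)] by blast
  qed
  then show "Field (copies \<X>) = Field (copies (order_struct L))"
    by (simp add: Field_copies_order[OF well_order_onD(1)[OF L(2)]])
qed

subsection \<open>Structures chained by cyclic rearrangements\<close>

text \<open>The reversed alternative would force both \<open>I\<close> and \<open>F\<close> to be
  finite, being well-ordered in both directions.\<close>

lemma cyclic_rearrangement_cases:
  assumes L: "well_order_on U L" "infinite U" and L': "L' \<in> cyclic_rearrangements L" "well_order_on U L'"
  obtains I F where "decomp2 L I F" "L' = Restr L F \<union> Restr L I \<union> F \<times> I"
proof -
  note lin = well_order_onD(1)[OF L(1)] and lin' = well_order_onD(1)[OF L'(2)]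
  have FL: "Field L = U" "Field L' = U" using Field_linear_order_on lin lin' by auto
  obtain I F where d: "decomp2 L I F"
    and c: "L' = Restr L F \<oplus>\<^sub>l Restr L I \<or> L' = (Restr L I)\<inverse> \<oplus>\<^sub>l (Restr L F)\<inverse>"
    using L'(1) unfolding cyclic_rearrangements_def by auto
  have U: "U = I \<union> F" "I \<inter> F = {}" using d FL unfolding decomp2_def by auto
  have RF: "Field (Restr L A) = A" if "A \<subseteq> U" for A
    using Field_linear_order_on[OF linear_order_on_Restr[OF lin that]] .
  have IF: "Field (Restr L I) = I" "Field (Restr L F) = F" using RF U by auto
  have "L' \<noteq> (Restr L I)\<inverse> \<oplus>\<^sub>l (Restr L F)\<inverse>"
  proof
    assume eq: "L' = (Restr L I)\<inverse> \<oplus>\<^sub>l (Restr L F)\<inverse>"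
    have L'_eq: "L' = (Restr L I)\<inverse> \<union> (Restr L F)\<inverse> \<union> I \<times> F"
      unfolding eq lsum_def Field_converse IF ..
    have "finite A" if A: "A = I \<or> A = F" for A
    proof (rule finite_if_both_well_ordered[OF lin' well_order_onD(2)[OF L'(2)], of L])
      show "Well_order L" using L(1) FL by simp
      show "(x, y) \<in> L' \<longleftrightarrow> (y, x) \<in> L" if "x \<in> A" "y \<in> A" for x y
        unfolding L'_eq using that A U(2) by auto
    qed (use U FL A in auto)
    then show False using L(2) U(1) by auto
  qed
  then have "L' = Restr L F \<union> Restr L I \<union> F \<times> I" using c IF unfolding lsum_def by simp
  then show ?thesis using that d by blast
qed

context cantor_form
begin

context
  fixes \<X> :: "('a, 'i) rel_struct"
  assumes W_LX: "W \<in> LX \<X>" and inf: "infinite (universe \<X>)"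
    and cyclic: "LX \<X> = cyclic_rearrangements W"
begin

text \<open>The order pulled back along \<open>f\<close> is a rotation of \<open>W\<close>, and the
  leading term embeds into it by some \<open>h\<close>. Applying \<open>h\<close> and then
  \<open>f\<close> maps \<open>M\<close> increasingly into \<open>W\<close>, hence into
  \<open>M\<close> by \<open>emb_leading_term\<close>.\<close>

lemma cyclic_copy_contains_leading_copy:
  assumes "A \<in> Field (copies \<X>)"
  shows "\<exists>B\<in>ocopies (Restr W M). B \<subseteq> A"
proof -
  let ?U = "universe \<X>"
  note FU = LX_D(2)[OF W_LX]
  have wo: "well_order_on ?U W" using W FU by simp
  obtain f where f: "f \<in> self_embeddings \<X>" "A = f ` ?U" using assms unfolding Field_copies by blast
  let ?L = "pullback \<X> f W"
  obtain I F where d: "decomp2 W I F" and L: "?L = Restr W F \<union> Restr W I \<union> F \<times> I"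
    using cyclic_rearrangement_cases[OF wo inf, of ?L] pullback_in_LX[OF W_LX f(1)] cyclic
      pullback_well_order[OF W_LX W f(1)] by blast
  have IF: "Field W = I \<union> F" "I \<inter> F = {}" "I \<times> F \<subseteq> W" using d unfolding decomp2_def by auto
  obtain h where h: "\<And>x. x \<in> M \<Longrightarrow> h x \<in> Field W"
    "\<And>x y. x \<in> M \<Longrightarrow> y \<in> M \<Longrightarrow> (x, y) \<in> W \<Longrightarrow> x \<noteq> y \<Longrightarrow>
      h x \<in> F \<and> h y \<in> I \<or> (h x \<in> F \<longleftrightarrow> h y \<in> F) \<and> (h x, h y) \<in> W \<and> h x \<noteq> h y"
    using leading_term_emb_rotation[OF IF] by blast
  have "emb W M ?L ?U h"
  proof (rule embI)
    fix x y assume xy: "x \<in> M" "y \<in> M" "(x, y) \<in> W" "x \<noteq> y"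
    from h(2)[OF xy] show "(h x, h y) \<in> ?L \<and> h x \<noteq> h y"
      unfolding L using h(1)[OF xy(1)] h(1)[OF xy(2)] IF(1,2) by auto
  qed (use h(1) FU in simp)
  then have fh: "emb W M W ?U (\<lambda>x. f (h x))" by (rule emb_comp[OF _ pullback_emb[OF f(1)]])
  then have "f (h x) \<in> M" if "x \<in> M" for x using emb_leading_term[OF _ that] FU by simp
  then have "emb (Restr W M) M (Restr W M) M (\<lambda>x. f (h x))" using fh unfolding emb_def by blast
  then have "(\<lambda>x. f (h x)) ` M \<in> ocopies (Restr W M)" unfolding ocopies_def Field_Restr_M by blast
  moreover have "(\<lambda>x. f (h x)) ` M \<subseteq> A" unfolding f(2) using h(1) FU by blast
  ultimately show ?thesis by blast
qed

text \<open>The rotation with the remainder in front of \<open>M\<close> chains \<open>\<X>\<close>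
  and, by absorption, is isomorphic to \<open>M\<close>. This isomorphism followed by
  \<open>e\<close> is increasing from the rotation to \<open>W\<close> and has image
  \<open>A\<close>. The two orders agree on the infinite set \<open>M\<close>, so
  \<open>LX_mixed_self_embedding\<close> applies.\<close>

lemma leading_copy_is_cyclic_copy:
  assumes "A \<in> ocopies (Restr W M)"
  shows "A \<in> Field (copies \<X>)"
proof -
  let ?U = "universe \<X>" and ?R = "Field W - M"
  note FU = LX_D(2)[OF W_LX]
  obtain e where e: "emb (Restr W M) M (Restr W M) M e" "A = e ` M"
    using assms unfolding ocopies_def Field_Restr_M by blast
  have e': "emb W M W ?U e" using e(1) M_subset FU unfolding emb_def by blast
  define L where "L = Restr W ?R \<oplus>\<^sub>l Restr W M"
  have FR: "Field (Restr W ?R) = ?R"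
    using Field_linear_order_on[OF linear_order_on_Restr[OF lin]] by blast
  have L_eq: "L = Restr W ?R \<union> Restr W M \<union> ?R \<times> M"
    unfolding L_def lsum_def FR Field_Restr_M ..
  have "decomp2 W M ?R" unfolding decomp2_def using M_subset M_less(1) by blast
  then have "L \<in> cyclic_rearrangements W" unfolding cyclic_rearrangements_def L_def by blast
  then have L_LX: "L \<in> LX \<X>" using cyclic by simp
  have FL: "Field L = ?U" using LX_D(2)[OF L_LX] .
  obtain \<theta> where \<theta>: "emb W ?R W M \<theta>" "emb W M W M \<theta>"
    "\<And>x y. x \<in> ?R \<Longrightarrow> y \<in> M \<Longrightarrow> (\<theta> x, \<theta> y) \<in> W \<and> \<theta> x \<noteq> \<theta> y"
    using remainder_absorbed by blast
  have \<theta>_M: "\<theta> x \<in> M" if "x \<in> ?U" for x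
    using that FU embD(1)[OF \<theta>(1)] embD(1)[OF \<theta>(2)] by blast
  have \<theta>_emb: "emb L ?U (Restr W M) M \<theta>"
  proof (rule embI)
    fix x y assume xy: "x \<in> ?U" "y \<in> ?U" "(x, y) \<in> L" "x \<noteq> y"
    consider "x \<in> ?R" "y \<in> ?R" "(x, y) \<in> W" | "x \<in> M" "y \<in> M" "(x, y) \<in> W" | "x \<in> ?R" "y \<in> M"
      using xy(3) unfolding L_eq by blast
    then have "(\<theta> x, \<theta> y) \<in> W \<and> \<theta> x \<noteq> \<theta> y"
    proof cases
      case 1
      then show ?thesis using embD(2,3)[OF \<theta>(1) 1 xy(4)] by blast
    next
      case 2
      then show ?thesis using embD(2,3)[OF \<theta>(2) 2 xy(4)] by blast
    next
      case 3
      then show ?thesis using \<theta>(3) by blast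
    qed
    then show "(\<theta> x, \<theta> y) \<in> Restr W M \<and> \<theta> x \<noteq> \<theta> y" using \<theta>_M xy(1,2) by blast
  qed (rule \<theta>_M)
  have woM: "Well_order (Restr W M)" using W by (rule Well_order_Restr)
  have woL: "Well_order L" using well_order_on_emb[OF LX_D(1)[OF L_LX] woM \<theta>_emb] FL by simp
  have "L \<le>o Restr W M" using emb_imp_ordLeq[OF woL woM] \<theta>_emb FL Field_Restr_M by simp
  moreover have "emb (Restr W M) M L ?U id"
    unfolding emb_def L_eq using M_subset FU by auto
  then have "Restr W M \<le>o L" using emb_imp_ordLeq[OF woM woL] FL Field_Restr_M by simp
  ultimately have "L =o Restr W M" using ordIso_iff_ordLeq by blast
  then obtain \<psi> where \<psi>: "bij_betw \<psi> (Field L) (Field (Restr W M))"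
    "\<And>x y. x \<in> Field L \<Longrightarrow> y \<in> Field L \<Longrightarrow> (x, y) \<in> L \<longleftrightarrow> (\<psi> x, \<psi> y) \<in> Restr W M"
    unfolding ordIso_iff_poset_iso poset_iso_def by blast
  have \<psi>_bij: "bij_betw \<psi> ?U M" using \<psi>(1) FL Field_Restr_M by simp
  have "emb L ?U (Restr W M) M \<psi>" using poset_iso_emb[OF \<psi>] FL Field_Restr_M by simp
  then have "emb L ?U W M \<psi>" unfolding emb_def by blast
  then have g: "emb L ?U W ?U (\<lambda>x. e (\<psi> x))" using e' by (rule emb_comp)
  have "infinite M" using inf bij_betw_finite[OF \<psi>_bij] by blast
  moreover have "(x, y) \<in> W \<longleftrightarrow> (x, y) \<in> L" if "x \<in> M" "y \<in> M" for x y
    unfolding L_eq using that by blast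
  ultimately have "(\<lambda>x. e (\<psi> x)) \<in> self_embeddings \<X>"
    using LX_mixed_self_embedding[OF W_LX W L_LX woL _ _ _ g] M_subset FU by blast
  moreover have "(\<lambda>x. e (\<psi> x)) ` ?U = A"
    unfolding e(2) using \<psi>_bij unfolding bij_betw_def by (metis image_image)
  ultimately show ?thesis unfolding Field_copies by blast
qed

text \<open>A lower bound, among the copies of \<open>\<X>\<close>, of two copies of
  \<open>M\<close> need not itself be a copy of \<open>M\<close>, but it contains one. So the
  inclusion is a dense map.\<close>

lemma ro_cyclic: "ro (copies (order_struct (Restr W M))) \<cong>\<^sub>p ro (copies \<X>)"
proof -
  have Fc: "Field (copies (order_struct (Restr W M))) = ocopies (Restr W M)"
    using Field_copies_order[OF well_order_onD(1)[OF Well_order_Restr[OF W]]] .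
  show ?thesis
  proof (rule ro_dense_map[OF Preorder_copies Preorder_copies, where e = id])
    fix A B C assume AB: "A \<in> Field (copies (order_struct (Restr W M)))"
      "B \<in> Field (copies (order_struct (Restr W M)))"
      and C: "(C, id A) \<in> copies \<X>" "(C, id B) \<in> copies \<X>"
    obtain D where "D \<in> ocopies (Restr W M)" "D \<subseteq> C"
      using cyclic_copy_contains_leading_copy FieldI1[OF C(1)] by blast
    then show "\<exists>D. (D, A) \<in> copies (order_struct (Restr W M)) \<and>
        (D, B) \<in> copies (order_struct (Restr W M))"
      using AB C Fc unfolding copies_iff id_apply by blast
  next
    fix C assume C: "C \<in> Field (copies \<X>)"
    then obtain D where "D \<in> ocopies (Restr W M)" "D \<subseteq> C"
      using cyclic_copy_contains_leading_copy by blast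
    then show "\<exists>D\<in>Field (copies (order_struct (Restr W M))). (id D, C) \<in> copies \<X>"
      using C Fc leading_copy_is_cyclic_copy unfolding copies_iff id_apply by blast
  qed (use Fc leading_copy_is_cyclic_copy in \<open>auto simp: copies_iff\<close>)
qed

end

end

theorem theorem5p2:
  fixes \<alpha> :: "'a rel" and \<delta> :: "nat \<Rightarrow> 'd rel" and s :: "nat \<Rightarrow> nat" and n k :: nat
  assumes "Well_order \<alpha>" and "infinite (Field \<alpha>)"
    and "\<forall>i\<le>n. Well_order (\<delta> i)"
    and "({} :: 'd rel) <o \<delta> 0"
    and "\<forall>i j. i < j \<and> j \<le> n \<longrightarrow> \<delta> i <o \<delta> j"
    and "\<forall>i\<le>n. 0 < s i"
    and "\<alpha> =o cantor_sum n \<delta> s k"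
  shows
    "sq (copies (order_struct \<alpha>)) \<cong>\<^sub>p
       poset_prod {0..n} (\<lambda>i. poset_power (sq (copies (order_struct (omega_exp (\<delta> i))))) (s i))
     \<and>
     is_min_ordinal
       {osum \<gamma> \<beta> | (\<beta> :: 'a rel) (\<gamma> :: 'a rel).
          Well_order \<beta> \<and> Well_order \<gamma> \<and> \<alpha> =o osum \<beta> \<gamma>}
       (oprod (omega_exp (\<delta> n)) (natLeq_on (s n)))
     \<and>
     (\<forall>(\<X> :: ('x, 'i) rel_struct) L.
        relational_structure \<X> \<and> chainable \<X> \<and> L \<in> LX \<X> \<and> L \<cong>\<^sub>p \<alpha> \<longrightarrow>
          (LX \<X> = {r. linear_order_on (universe \<X>) r} \<longrightarrow>
             BX \<X> \<cong>\<^sub>p ro (CP |Field \<alpha>| )) \<and>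
          (LX \<X> = cyclic_rearrangements L \<longrightarrow>
             BX \<X> \<cong>\<^sub>p ro (poset_power (sq (copies (order_struct (omega_exp (\<delta> n))))) (s n))) \<and>
          ((\<exists>m. LX \<X> = end_rearrangements m L) \<longrightarrow>
             BX \<X> \<cong>\<^sub>p ro (poset_prod {0..n}
               (\<lambda>i. poset_power (sq (copies (order_struct (omega_exp (\<delta> i))))) (s i)))))"
proof -
  note wo = assms(1)
  \<comment> \<open>Positivity is given for the lowest exponent and passes upward to the leading
    one.\<close>
  have nonempty: "Field (\<delta> n) \<noteq> {}"
  proof
    assume "Field (\<delta> n) = {}"
    then have "\<delta> n = {}" unfolding Field_def by auto
    moreover have "({} :: 'd rel) <o \<delta> n"
    proof (cases "n = 0")
      case False
      then have "\<delta> 0 <o \<delta> n" using assms(5) by simp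
      with assms(4) show ?thesis by (rule ordLess_transitive)
    qed (use assms(4) in simp)
    ultimately show False using ordLess_irreflexive by auto
  qed
  \<comment> \<open>Arbitrary carrier type, since the normal form is set up both on \<alpha> and on
    the orders \<open>L\<close> on the universe of \<open>\<X>\<close>.\<close>
  have form: "\<exists>\<phi>. cantor_form r n k \<delta> s \<phi>" if r: "r =o cantor_sum n \<delta> s k" for r :: "'c rel"
  proof -
    obtain \<phi> where "bij_betw \<phi> (Field (cantor_sum n \<delta> s k)) (Field r)"
      "\<And>x y. x \<in> Field (cantor_sum n \<delta> s k) \<Longrightarrow> y \<in> Field (cantor_sum n \<delta> s k) \<Longrightarrow>
        (x, y) \<in> cantor_sum n \<delta> s k \<longleftrightarrow> (\<phi> x, \<phi> y) \<in> r"
      using ordIso_symmetric[OF r] unfolding ordIso_iff_poset_iso poset_iso_def by blast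
    moreover have "Well_order r" using r unfolding ordIso_iff_poset_iso by blast
    ultimately have "cantor_form r n k \<delta> s \<phi>"
      using assms(3,5,6) nonempty by unfold_locales auto
    then show ?thesis by blast
  qed
  let ?P = "poset_prod {0..n} (\<lambda>i. poset_power (sq (copies (order_struct (omega_exp (\<delta> i))))) (s i))"
  let ?Q = "poset_power (sq (copies (order_struct (omega_exp (\<delta> n))))) (s n)"
  have preP: "Preorder ?P" and preQ: "Preorder ?Q"
    by (intro Preorder_poset_prod Preorder_poset_power Partial_order_sq(1) Preorder_copies)+
  note pre_sq = Partial_order_sq(1)[OF Preorder_copies]
  obtain \<phi> where "cantor_form \<alpha> n k \<delta> s \<phi>" using form[OF assms(7)] by blast
  then interpret A: cantor_form \<alpha> n k \<delta> s \<phi> .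
  have c: "(LX \<X> = {r. linear_order_on (universe \<X>) r} \<longrightarrow> BX \<X> \<cong>\<^sub>p ro (CP |Field \<alpha>| )) \<and>
      (LX \<X> = cyclic_rearrangements L \<longrightarrow> BX \<X> \<cong>\<^sub>p ro ?Q) \<and>
      ((\<exists>m. LX \<X> = end_rearrangements m L) \<longrightarrow> BX \<X> \<cong>\<^sub>p ro ?P)"
    if L: "L \<in> LX \<X>" "L \<cong>\<^sub>p \<alpha>" for \<X> :: "('x, 'i) rel_struct" and L
  proof (intro conjI impI)
    note FU = LX_D(2)[OF L(1)]
    obtain h where "bij_betw h (Field L) (Field \<alpha>)" using L(2) unfolding poset_iso_def by blast
    then have h: "bij_betw h (universe \<X>) (Field \<alpha>)" using FU by simp
    then have inf: "infinite (universe \<X>)" using assms(2) bij_betw_finite by blast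
    have woL: "Well_order L" using Well_order_poset_iso[OF L(2) wo] .
    then have "L =o \<alpha>" using L(2) wo ordIso_iff_poset_iso by blast
    then have "L =o cantor_sum n \<delta> s k" using assms(7) by (rule ordIso_transitive)
    then obtain \<chi> where "cantor_form L n k \<delta> s \<chi>" using form by blast
    \<comment> \<open>Copies of \<open>\<X>\<close> are subsets of its own universe, so blocks and
      leading term are taken in \<open>L\<close> itself.\<close>
    then interpret B: cantor_form L n k \<delta> s \<chi> .
    have BX: "BX \<X> \<cong>\<^sub>p ro (copies \<X>)"
      unfolding BX_def by (rule poset_iso_sym[OF ro_sq[OF Preorder_copies]])
    show "BX \<X> \<cong>\<^sub>p ro (CP |Field \<alpha>| )" if all: "LX \<X> = {r. linear_order_on (universe \<X>) r}"
      using poset_iso_trans[OF BX]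
        ro_CP[OF assms(2) h all_orders_Field_copies[OF LX_D(1)[OF L(1)] all inf]] by blast
    show "BX \<X> \<cong>\<^sub>p ro ?Q" if cyclic: "LX \<X> = cyclic_rearrangements L"
    proof -
      note BX
      also have "ro (copies \<X>) \<cong>\<^sub>p ro (copies (order_struct (Restr L B.M)))"
        by (rule poset_iso_sym[OF B.ro_cyclic[OF L(1) inf cyclic]])
      also have "\<dots> \<cong>\<^sub>p ro (sq (copies (order_struct (Restr L B.M))))"
        by (rule ro_sq[OF Preorder_copies])
      also have "\<dots> \<cong>\<^sub>p ro ?Q"
        by (rule ro_cong[OF B.sq_copies_leading_term pre_sq preQ])
      finally show ?thesis .
    qed
    show "BX \<X> \<cong>\<^sub>p ro ?P" if ends: "\<exists>m. LX \<X> = end_rearrangements m L"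
    proof -
      obtain m where "LX \<X> = end_rearrangements m L" using ends by blast
      then have "copies \<X> = copies (order_struct L)"
        by (rule end_rearrangements_copies[OF L(1) woL inf])
      then show ?thesis
        unfolding BX_def using ro_cong[OF B.sq_copies_iso pre_sq preP] by simp
    qed
  qed
  show ?thesis
    using A.sq_copies_iso A.min_rotation c by blast
qed

end
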